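(* Let $\mathcal{C}$ be an accessible category, $\mathcal{D}$ a cocomplete accessible category, and $p\colon\mathcal{C}\to\mathcal{D}$ an accessible functor. Then the functor $$\mathrm{Lan}_p(p\circ -)\colon \big(\mathbf{End}(\mathcal{C}),\mathrm{id}_{\mathcal{C}},\circ\big)\to\big(\mathbf{End}(\mathcal{D}),\mathrm{id}_{\mathcal{D}},\circ\big),\qquad q\mapsto \mathrm{Lan}_p(p\circ q),$$ is colax monoidal. In particular there are coherent counit and comultiplication maps, the latter natural in $q,r\in\mathbf{End}(\mathcal{C})$ (the canonical maps described in the context): $$\mathrm{Lan}_p(p)\Rightarrow \mathrm{id}_{\mathcal{D}},\qquad \mathrm{Lan}_p(p\circ q\circ r)\Rightarrow \mathrm{Lan}_p(p\circ q)\circ \mathrm{Lan}_p(p\circ r).$$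
   Context: For an accessible category $\mathcal{C}$, $\mathbf{End}(\mathcal{C})$ is the category of accessible endofunctors of $\mathcal{C}$ and natural transformations, with strict monoidal structure given by $\mathrm{id}_{\mathcal{C}}$ and composition $\circ$ (where $(q\circ r)(x)=q(r(x))$). For accessible functors $q\colon\mathcal{C}\to\mathcal{C}'$ and $p\colon\mathcal{C}\to\mathcal{D}$ between accessible categories with $\mathcal{D}$ cocomplete, $\mathrm{Lan}_q(p)\colon\mathcal{C}'\to\mathcal{D}$ denotes the left Kan extension of $p$ along $q$ (it exists and is accessible), with unit $\eta_p^q\colon p\Rightarrow \mathrm{Lan}_q(p)\circ q$; natural transformations $\mathrm{Lan}_q(p)\Rightarrow r$ correspond bijectively (via $\eta_p^q$) to natural transformations $p\Rightarrow r\circ q$. The functor $\mathrm{Lan}_p(p\circ-)$ acts on natural transformations by functoriality of Kan extension. The counit map $\mathrm{Lan}_p(p)\Rightarrow\mathrm{id}_{\mathcal{D}}$ corresponds to the identity $p\Rightarrow\mathrm{id}_{\mathcal{D}}\circ p$. The comultiplication map corresponds to the composite $p\circ q\circ r\Rightarrow \mathrm{Lan}_p(p\circ q)\circ p\circ r\Rightarrow \mathrm{Lan}_p(p\circ q)\circ\mathrm{Lan}_p(p\circ r)\circ p$ of Kan extension units. A functor is colax monoidal when equipped with such maps satisfying the usual coassociativity and counitality axioms. *)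

theory Defs
  imports Main "HOL-Library.FuncSet"
begin

unbundle cardinal_syntax

section \<open>Categories, functors, natural transformations\<close>

record ('o, 'm) cat =
  Obj :: "'o set"
  Arr :: "'m set"
  Dom :: "'m \<Rightarrow> 'o"
  Cod :: "'m \<Rightarrow> 'o"
  Ident :: "'o \<Rightarrow> 'm"
  Comp :: "'m \<Rightarrow> 'm \<Rightarrow> 'm"  \<comment> \<open>\<open>Comp C g f\<close> is \<open>g \<circ> f\<close>\<close>

definition Hom :: "('o, 'm, 'z) cat_scheme \<Rightarrow> 'o \<Rightarrow> 'o \<Rightarrow> 'm set" where
  "Hom C a b = {f \<in> Arr C. Dom C f = a \<and> Cod C f = b}"

locale category =
  fixes C :: "('o, 'm, 'z) cat_scheme"
  assumes Dom_Obj: "f \<in> Arr C \<Longrightarrow> Dom C f \<in> Obj C"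
    and Cod_Obj: "f \<in> Arr C \<Longrightarrow> Cod C f \<in> Obj C"
    and Ident_Hom: "a \<in> Obj C \<Longrightarrow> Ident C a \<in> Hom C a a"
    and Comp_Hom: "f \<in> Hom C a b \<Longrightarrow> g \<in> Hom C b c \<Longrightarrow> Comp C g f \<in> Hom C a c"
    and Comp_assoc: "f \<in> Hom C a b \<Longrightarrow> g \<in> Hom C b c \<Longrightarrow> h \<in> Hom C c d \<Longrightarrow>
      Comp C h (Comp C g f) = Comp C (Comp C h g) f"
    and Comp_Ident: "f \<in> Hom C a b \<Longrightarrow> Comp C f (Ident C a) = f"
    and Ident_Comp: "f \<in> Hom C a b \<Longrightarrow> Comp C (Ident C b) f = f"

record ('o1, 'm1, 'o2, 'm2) cfun =
  OMap :: "'o1 \<Rightarrow> 'o2"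
  AMap :: "'m1 \<Rightarrow> 'm2"

text \<open>
  The maps of a functor and the components of a natural transformation are required to be
  \<^const>\<open>undefined\<close> outside their domains, so that equality in HOL is equality of functors (natural
  transformations) and composition of functors is strictly associative and unital.
\<close>

locale is_functor = dom: category C + cod: category D
  for C :: "('o1, 'm1, 'z1) cat_scheme" and D :: "('o2, 'm2, 'z2) cat_scheme" +
  fixes F :: "('o1, 'm1, 'o2, 'm2) cfun"
  assumes OMap_ext: "OMap F \<in> extensional (Obj C)"
    and AMap_ext: "AMap F \<in> extensional (Arr C)"
    and OMap_Obj: "a \<in> Obj C \<Longrightarrow> OMap F a \<in> Obj D"
    and AMap_Hom: "f \<in> Hom C a b \<Longrightarrow> AMap F f \<in> Hom D (OMap F a) (OMap F b)"
    and AMap_Ident: "a \<in> Obj C \<Longrightarrow> AMap F (Ident C a) = Ident D (OMap F a)"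
    and AMap_Comp: "f \<in> Hom C a b \<Longrightarrow> g \<in> Hom C b c \<Longrightarrow>
      AMap F (Comp C g f) = Comp D (AMap F g) (AMap F f)"

definition id_fun :: "('o, 'm, 'z) cat_scheme \<Rightarrow> ('o, 'm, 'o, 'm) cfun" where
  "id_fun C = \<lparr>OMap = (\<lambda>a\<in>Obj C. a), AMap = (\<lambda>f\<in>Arr C. f)\<rparr>"

text \<open>\<open>cfun_comp C G F\<close> is \<open>G \<circ> F\<close>, where \<open>C\<close> is the source of \<open>F\<close>.\<close>

definition cfun_comp ::
  "('o1, 'm1, 'z) cat_scheme \<Rightarrow> ('o2, 'm2, 'o3, 'm3) cfun \<Rightarrow> ('o1, 'm1, 'o2, 'm2) cfun
    \<Rightarrow> ('o1, 'm1, 'o3, 'm3) cfun" where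
  "cfun_comp C G F =
    \<lparr>OMap = (\<lambda>a\<in>Obj C. OMap G (OMap F a)), AMap = (\<lambda>f\<in>Arr C. AMap G (AMap F f))\<rparr>"

locale nat_trans = src: is_functor C D F + tgt: is_functor C D G
  for C :: "('o1, 'm1, 'z1) cat_scheme" and D :: "('o2, 'm2, 'z2) cat_scheme"
    and F G :: "('o1, 'm1, 'o2, 'm2) cfun" +
  fixes \<tau> :: "'o1 \<Rightarrow> 'm2"
  assumes comp_ext: "\<tau> \<in> extensional (Obj C)"
    and comp_Hom: "a \<in> Obj C \<Longrightarrow> \<tau> a \<in> Hom D (OMap F a) (OMap G a)"
    and naturality: "f \<in> Hom C a b \<Longrightarrow> Comp D (\<tau> b) (AMap F f) = Comp D (AMap G f) (\<tau> a)"

definition nt_ident ::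
  "('o1, 'm1, 'z1) cat_scheme \<Rightarrow> ('o2, 'm2, 'z2) cat_scheme \<Rightarrow> ('o1, 'm1, 'o2, 'm2) cfun
    \<Rightarrow> 'o1 \<Rightarrow> 'm2" where
  "nt_ident C D F = (\<lambda>a\<in>Obj C. Ident D (OMap F a))"

text \<open>\<open>vcomp C D \<sigma> \<tau>\<close> is the vertical composite of \<open>\<tau> : F \<Rightarrow> G\<close> followed by \<open>\<sigma> : G \<Rightarrow> H\<close>.\<close>

definition vcomp ::
  "('o1, 'm1, 'z1) cat_scheme \<Rightarrow> ('o2, 'm2, 'z2) cat_scheme \<Rightarrow> ('o1 \<Rightarrow> 'm2) \<Rightarrow> ('o1 \<Rightarrow> 'm2)
    \<Rightarrow> 'o1 \<Rightarrow> 'm2" where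
  "vcomp C D \<sigma> \<tau> = (\<lambda>a\<in>Obj C. Comp D (\<sigma> a) (\<tau> a))"

text \<open>Whiskering: \<open>whisker_left C F \<tau>\<close> is \<open>F \<circ> \<tau>\<close> and \<open>whisker_right C \<tau> F\<close> is \<open>\<tau> \<circ> F\<close>, where \<open>C\<close>
  is the source of the resulting functors.\<close>

definition whisker_left ::
  "('o1, 'm1, 'z) cat_scheme \<Rightarrow> ('o2, 'm2, 'o3, 'm3) cfun \<Rightarrow> ('o1 \<Rightarrow> 'm2) \<Rightarrow> 'o1 \<Rightarrow> 'm3" where
  "whisker_left C F \<tau> = (\<lambda>a\<in>Obj C. AMap F (\<tau> a))"

definition whisker_right ::
  "('o1, 'm1, 'z) cat_scheme \<Rightarrow> ('o2 \<Rightarrow> 'm3) \<Rightarrow> ('o1, 'm1, 'o2, 'm2) cfun \<Rightarrow> 'o1 \<Rightarrow> 'm3" where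
  "whisker_right C \<tau> F = (\<lambda>a\<in>Obj C. \<tau> (OMap F a))"


section \<open>Smallness\<close>

text \<open>
  Size is measured against a universe: a set \<open>U\<close> whose cardinality is an uncountable strongly
  inaccessible cardinal.  A set, of whatever type, is small if its cardinality is below that of
  \<open>U\<close>.  Every small set is in bijection with a subset of \<open>U\<close>, so up to isomorphism every small
  category has its objects and arrows in the type \<^typ>\<open>'u\<close> of the elements of \<open>U\<close>, and every
  small cardinal is represented by a cardinal order on that type; diagram shapes and regular
  cardinals below are therefore taken from there.  The objects and arrows of the (large)
  categories under consideration may have any type.
\<close>

definition inaccessible :: "'u set \<Rightarrow> bool" where
  "inaccessible U \<longleftrightarrow> natLeq <o |U| \<and> regularCard |U| \<and>
    (\<forall>A :: 'u set. |A| <o |U| \<longrightarrow> |Pow A| <o |U| )"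

definition small :: "'u set \<Rightarrow> 'a set \<Rightarrow> bool" where
  "small U A \<longleftrightarrow> |A| <o |U|"

definition regular_cardinal :: "'u set \<Rightarrow> 'u rel \<Rightarrow> bool" where
  "regular_cardinal U \<kappa> \<longleftrightarrow> Cinfinite \<kappa> \<and> regularCard \<kappa> \<and> \<kappa> <o |U|"

definition small_category :: "'u set \<Rightarrow> ('o, 'm, 'z) cat_scheme \<Rightarrow> bool" where
  "small_category U J \<longleftrightarrow> category J \<and> small U (Obj J) \<and> small U (Arr J)"

definition locally_small :: "'u set \<Rightarrow> ('o, 'm, 'z) cat_scheme \<Rightarrow> bool" where
  "locally_small U C \<longleftrightarrow> (\<forall>a\<in>Obj C. \<forall>b\<in>Obj C. small U (Hom C a b))"


section \<open>Colimits\<close>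

definition is_cocone ::
  "('i, 'k, 'y) cat_scheme \<Rightarrow> ('o, 'm, 'z) cat_scheme \<Rightarrow> ('i, 'k, 'o, 'm) cfun \<Rightarrow> 'o
    \<Rightarrow> ('i \<Rightarrow> 'm) \<Rightarrow> bool" where
  "is_cocone J C G c \<iota> \<longleftrightarrow> c \<in> Obj C \<and> (\<forall>j\<in>Obj J. \<iota> j \<in> Hom C (OMap G j) c) \<and>
    (\<forall>i\<in>Obj J. \<forall>j\<in>Obj J. \<forall>u\<in>Hom J i j. Comp C (\<iota> j) (AMap G u) = \<iota> i)"

definition is_colimit ::
  "('i, 'k, 'y) cat_scheme \<Rightarrow> ('o, 'm, 'z) cat_scheme \<Rightarrow> ('i, 'k, 'o, 'm) cfun \<Rightarrow> 'o
    \<Rightarrow> ('i \<Rightarrow> 'm) \<Rightarrow> bool" where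
  "is_colimit J C G c \<iota> \<longleftrightarrow> is_cocone J C G c \<iota> \<and>
    (\<forall>c' \<iota>'. is_cocone J C G c' \<iota>' \<longrightarrow>
      (\<exists>!h. h \<in> Hom C c c' \<and> (\<forall>j\<in>Obj J. Comp C h (\<iota> j) = \<iota>' j)))"

definition cocomplete :: "'u set \<Rightarrow> ('o, 'm, 'z) cat_scheme \<Rightarrow> bool" where
  "cocomplete U C \<longleftrightarrow>
    (\<forall>(J :: ('u, 'u) cat) G. small_category U J \<and> is_functor J C G \<longrightarrow>
      (\<exists>c \<iota>. is_colimit J C G c \<iota>))"

text \<open>
  Small \<open>\<kappa>\<close>-directed posets, viewed as categories: there is at most one arrow between any two
  objects, isomorphic objects are equal, and every set of fewer than \<open>\<kappa>\<close> elements (in particular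
  the empty one) has an upper bound.
\<close>

definition directed_poset :: "'u set \<Rightarrow> 'u rel \<Rightarrow> ('u, 'u) cat \<Rightarrow> bool" where
  "directed_poset U \<kappa> J \<longleftrightarrow> small_category U J \<and>
    (\<forall>i j. \<forall>f\<in>Hom J i j. \<forall>g\<in>Hom J i j. f = g) \<and>
    (\<forall>i j. Hom J i j \<noteq> {} \<and> Hom J j i \<noteq> {} \<longrightarrow> i = j) \<and>
    (\<forall>S\<subseteq>Obj J. |S| <o \<kappa> \<longrightarrow> (\<exists>u\<in>Obj J. \<forall>s\<in>S. Hom J s u \<noteq> {}))"

definition has_directed_colimits :: "'u set \<Rightarrow> 'u rel \<Rightarrow> ('o, 'm, 'z) cat_scheme \<Rightarrow> bool" where
  "has_directed_colimits U \<kappa> C \<longleftrightarrow>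
    (\<forall>J G. directed_poset U \<kappa> J \<and> is_functor J C G \<longrightarrow> (\<exists>c \<iota>. is_colimit J C G c \<iota>))"

definition preserves_directed_colimits ::
  "'u set \<Rightarrow> 'u rel \<Rightarrow> ('o1, 'm1, 'z1) cat_scheme \<Rightarrow> ('o2, 'm2, 'z2) cat_scheme
    \<Rightarrow> ('o1, 'm1, 'o2, 'm2) cfun \<Rightarrow> bool" where
  "preserves_directed_colimits U \<kappa> C D F \<longleftrightarrow>
    (\<forall>J G c \<iota>. directed_poset U \<kappa> J \<and> is_functor J C G \<and> is_colimit J C G c \<iota> \<longrightarrow>
      is_colimit J D (cfun_comp J F G) (OMap F c) (\<lambda>j. AMap F (\<iota> j)))"


section \<open>Accessible categories and functors\<close>

text \<open>
  The category of small sets with elements in a given type; arrows are triples of source, target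
  and (extensional) function.  Hom-functors of a category with arrows of type \<^typ>\<open>'m\<close> take values in
  the small subsets of \<^typ>\<open>'m + 'u\<close>; the summand \<^typ>\<open>'u\<close> makes the type large enough for every
  small set to occur up to bijection.

  Presentability and accessibility follow Adamek and Rosicky, Locally Presentable and Accessible
  Categories: directed colimits are indexed by directed posets, and an accessible functor is one
  that, for some regular \<open>\<kappa>\<close>, preserves \<open>\<kappa>\<close>-directed colimits between \<open>\<kappa>\<close>-accessible categories.
\<close>

definition set_cat :: "'u set \<Rightarrow> ('x set, 'x set \<times> 'x set \<times> ('x \<Rightarrow> 'x)) cat" where
  "set_cat U =
    \<lparr>Obj = {X. small U X},
     Arr = {(X, Y, f). small U X \<and> small U Y \<and> f \<in> X \<rightarrow>\<^sub>E Y},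
     Dom = (\<lambda>(X, Y, f). X),
     Cod = (\<lambda>(X, Y, f). Y),
     Ident = (\<lambda>X. (X, X, \<lambda>x\<in>X. x)),
     Comp = (\<lambda>(Y, Z, g) (X, Y', f). (X, Z, compose X g f))\<rparr>"

definition hom_fun ::
  "('o, 'm, 'z) cat_scheme \<Rightarrow> 'o
    \<Rightarrow> ('o, 'm, ('m + 'u) set, ('m + 'u) set \<times> ('m + 'u) set \<times> ('m + 'u \<Rightarrow> 'm + 'u)) cfun" where
  "hom_fun C a =
    \<lparr>OMap = (\<lambda>x\<in>Obj C. Inl ` Hom C a x),
     AMap = (\<lambda>f\<in>Arr C. (Inl ` Hom C a (Dom C f), Inl ` Hom C a (Cod C f),
       \<lambda>g\<in>Inl ` Hom C a (Dom C f). Inl (Comp C f (projl g))))\<rparr>"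

definition presentable :: "'u set \<Rightarrow> 'u rel \<Rightarrow> ('o, 'm, 'z) cat_scheme \<Rightarrow> 'o \<Rightarrow> bool" where
  "presentable U \<kappa> C a \<longleftrightarrow> a \<in> Obj C \<and>
    preserves_directed_colimits U \<kappa> C (set_cat U)
      (hom_fun C a :: (_, _, (_ + 'u) set, _) cfun)"

definition accessible_at :: "'u set \<Rightarrow> 'u rel \<Rightarrow> ('o, 'm, 'z) cat_scheme \<Rightarrow> bool" where
  "accessible_at U \<kappa> C \<longleftrightarrow> category C \<and> locally_small U C \<and> has_directed_colimits U \<kappa> C \<and>
    (\<exists>A. small U A \<and> (\<forall>a\<in>A. presentable U \<kappa> C a) \<and>
      (\<forall>x\<in>Obj C. \<exists>J G \<iota>. directed_poset U \<kappa> J \<and> is_functor J C G \<and>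
        OMap G ` Obj J \<subseteq> A \<and> is_colimit J C G x \<iota>))"

definition accessible :: "'u set \<Rightarrow> ('o, 'm, 'z) cat_scheme \<Rightarrow> bool" where
  "accessible U C \<longleftrightarrow> (\<exists>\<kappa>. regular_cardinal U \<kappa> \<and> accessible_at U \<kappa> C)"

definition accessible_functor ::
  "'u set \<Rightarrow> ('o1, 'm1, 'z1) cat_scheme \<Rightarrow> ('o2, 'm2, 'z2) cat_scheme
    \<Rightarrow> ('o1, 'm1, 'o2, 'm2) cfun \<Rightarrow> bool" where
  "accessible_functor U C D F \<longleftrightarrow> is_functor C D F \<and>
    (\<exists>\<kappa>. regular_cardinal U \<kappa> \<and> accessible_at U \<kappa> C \<and> accessible_at U \<kappa> D \<and>
      preserves_directed_colimits U \<kappa> C D F)"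


section \<open>Strict monoidal categories and colax monoidal functors\<close>

record ('o, 'm) moncat = "('o, 'm) cat" +
  TensO :: "'o \<Rightarrow> 'o \<Rightarrow> 'o"
  TensA :: "'m \<Rightarrow> 'm \<Rightarrow> 'm"
  Unit :: 'o

locale strict_monoidal_category = category M
  for M :: "('o, 'm, 'z) moncat_scheme" +
  assumes Unit_Obj: "Unit M \<in> Obj M"
    and TensO_Obj: "x \<in> Obj M \<Longrightarrow> y \<in> Obj M \<Longrightarrow> TensO M x y \<in> Obj M"
    and TensA_Hom: "f \<in> Hom M a b \<Longrightarrow> g \<in> Hom M c d \<Longrightarrow>
      TensA M f g \<in> Hom M (TensO M a c) (TensO M b d)"
    and TensA_Ident: "x \<in> Obj M \<Longrightarrow> y \<in> Obj M \<Longrightarrow>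
      TensA M (Ident M x) (Ident M y) = Ident M (TensO M x y)"
    and TensA_Comp: "f \<in> Hom M a b \<Longrightarrow> f' \<in> Hom M b c \<Longrightarrow> g \<in> Hom M a' b' \<Longrightarrow> g' \<in> Hom M b' c' \<Longrightarrow>
      TensA M (Comp M f' f) (Comp M g' g) = Comp M (TensA M f' g') (TensA M f g)"
    and TensO_assoc: "x \<in> Obj M \<Longrightarrow> y \<in> Obj M \<Longrightarrow> z \<in> Obj M \<Longrightarrow>
      TensO M (TensO M x y) z = TensO M x (TensO M y z)"
    and TensA_assoc: "f \<in> Arr M \<Longrightarrow> g \<in> Arr M \<Longrightarrow> h \<in> Arr M \<Longrightarrow>
      TensA M (TensA M f g) h = TensA M f (TensA M g h)"
    and TensO_Unit: "x \<in> Obj M \<Longrightarrow> TensO M x (Unit M) = x"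
    and Unit_TensO: "x \<in> Obj M \<Longrightarrow> TensO M (Unit M) x = x"
    and TensA_Unit: "f \<in> Arr M \<Longrightarrow> TensA M f (Ident M (Unit M)) = f"
    and Unit_TensA: "f \<in> Arr M \<Longrightarrow> TensA M (Ident M (Unit M)) f = f"

locale colax_monoidal_functor =
  source: strict_monoidal_category M + target: strict_monoidal_category N + is_functor M N F
  for M :: "('o1, 'm1, 'z1) moncat_scheme" and N :: "('o2, 'm2, 'z2) moncat_scheme"
    and F :: "('o1, 'm1, 'o2, 'm2) cfun" +
  fixes \<epsilon> :: 'm2 and \<delta> :: "'o1 \<Rightarrow> 'o1 \<Rightarrow> 'm2"
  assumes counit_Hom: "\<epsilon> \<in> Hom N (OMap F (Unit M)) (Unit N)"
    and comult_Hom: "x \<in> Obj M \<Longrightarrow> y \<in> Obj M \<Longrightarrow>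
      \<delta> x y \<in> Hom N (OMap F (TensO M x y)) (TensO N (OMap F x) (OMap F y))"
    and comult_natural: "f \<in> Hom M x x' \<Longrightarrow> g \<in> Hom M y y' \<Longrightarrow>
      Comp N (\<delta> x' y') (AMap F (TensA M f g)) = Comp N (TensA N (AMap F f) (AMap F g)) (\<delta> x y)"
    and coassoc: "x \<in> Obj M \<Longrightarrow> y \<in> Obj M \<Longrightarrow> z \<in> Obj M \<Longrightarrow>
      Comp N (TensA N (\<delta> x y) (Ident N (OMap F z))) (\<delta> (TensO M x y) z) =
      Comp N (TensA N (Ident N (OMap F x)) (\<delta> y z)) (\<delta> x (TensO M y z))"
    and counit_left: "x \<in> Obj M \<Longrightarrow>
      Comp N (TensA N \<epsilon> (Ident N (OMap F x))) (\<delta> (Unit M) x) = Ident N (OMap F x)"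
    and counit_right: "x \<in> Obj M \<Longrightarrow>
      Comp N (TensA N (Ident N (OMap F x)) \<epsilon>) (\<delta> x (Unit M)) = Ident N (OMap F x)"

text \<open>
  Accessible endofunctors under composition.  An arrow is a triple of source, target and
  components; the tensor product of arrows is the horizontal composite.
\<close>

definition End_cat ::
  "'u set \<Rightarrow> ('o, 'm, 'z) cat_scheme
    \<Rightarrow> (('o, 'm, 'o, 'm) cfun,
        ('o, 'm, 'o, 'm) cfun \<times> ('o, 'm, 'o, 'm) cfun \<times> ('o \<Rightarrow> 'm)) moncat" where
  "End_cat U C =
    \<lparr>Obj = {q. accessible_functor U C C q},
     Arr = {(q, r, \<alpha>). accessible_functor U C C q \<and> accessible_functor U C C r \<and>
       nat_trans C C q r \<alpha>},
     Dom = (\<lambda>(q, r, \<alpha>). q),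
     Cod = (\<lambda>(q, r, \<alpha>). r),
     Ident = (\<lambda>q. (q, q, nt_ident C C q)),
     Comp = (\<lambda>(r, s, \<beta>) (q, r', \<alpha>). (q, s, vcomp C C \<beta> \<alpha>)),
     TensO = (\<lambda>q r. cfun_comp C q r),
     TensA = (\<lambda>(q, q', \<alpha>) (r, r', \<beta>).
       (cfun_comp C q r, cfun_comp C q' r', vcomp C C (whisker_right C \<alpha> r') (whisker_left C q \<beta>))),
     Unit = id_fun C\<rparr>"


section \<open>Left Kan extensions\<close>

text \<open>\<open>L\<close> with \<open>\<eta> : f \<Rightarrow> L \<circ> q\<close> is a left Kan extension of \<open>f : C \<rightarrow> D\<close> along \<open>q : C \<rightarrow> C'\<close>.\<close>

definition left_kan_extension ::
  "('o1, 'm1, 'z1) cat_scheme \<Rightarrow> ('o2, 'm2, 'z2) cat_scheme \<Rightarrow> ('o3, 'm3, 'z3) cat_scheme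
    \<Rightarrow> ('o1, 'm1, 'o2, 'm2) cfun \<Rightarrow> ('o1, 'm1, 'o3, 'm3) cfun
    \<Rightarrow> ('o2, 'm2, 'o3, 'm3) cfun \<Rightarrow> ('o1 \<Rightarrow> 'm3) \<Rightarrow> bool" where
  "left_kan_extension C C' D q f L \<eta> \<longleftrightarrow>
    is_functor C C' q \<and> is_functor C D f \<and> is_functor C' D L \<and>
    nat_trans C D f (cfun_comp C L q) \<eta> \<and>
    (\<forall>R \<sigma>. is_functor C' D R \<and> nat_trans C D f (cfun_comp C R q) \<sigma> \<longrightarrow>
      (\<exists>!\<tau>. nat_trans C' D L R \<tau> \<and> vcomp C D (whisker_right C \<tau> q) \<eta> = \<sigma>))"

definition lan_pair ::
  "('o1, 'm1, 'z1) cat_scheme \<Rightarrow> ('o2, 'm2, 'z2) cat_scheme \<Rightarrow> ('o3, 'm3, 'z3) cat_scheme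
    \<Rightarrow> ('o1, 'm1, 'o2, 'm2) cfun \<Rightarrow> ('o1, 'm1, 'o3, 'm3) cfun
    \<Rightarrow> ('o2, 'm2, 'o3, 'm3) cfun \<times> ('o1 \<Rightarrow> 'm3)" where
  "lan_pair C C' D q f = (SOME (L, \<eta>). left_kan_extension C C' D q f L \<eta>)"

definition Lan ::
  "('o1, 'm1, 'z1) cat_scheme \<Rightarrow> ('o2, 'm2, 'z2) cat_scheme \<Rightarrow> ('o3, 'm3, 'z3) cat_scheme
    \<Rightarrow> ('o1, 'm1, 'o2, 'm2) cfun \<Rightarrow> ('o1, 'm1, 'o3, 'm3) cfun \<Rightarrow> ('o2, 'm2, 'o3, 'm3) cfun" where
  "Lan C C' D q f = fst (lan_pair C C' D q f)"

definition lan_unit ::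
  "('o1, 'm1, 'z1) cat_scheme \<Rightarrow> ('o2, 'm2, 'z2) cat_scheme \<Rightarrow> ('o3, 'm3, 'z3) cat_scheme
    \<Rightarrow> ('o1, 'm1, 'o2, 'm2) cfun \<Rightarrow> ('o1, 'm1, 'o3, 'm3) cfun \<Rightarrow> 'o1 \<Rightarrow> 'm3" where
  "lan_unit C C' D q f = snd (lan_pair C C' D q f)"

text \<open>The transformation \<open>Lan q f \<Rightarrow> R\<close> corresponding to \<open>\<sigma> : f \<Rightarrow> R \<circ> q\<close>.\<close>

definition lan_mate ::
  "('o1, 'm1, 'z1) cat_scheme \<Rightarrow> ('o2, 'm2, 'z2) cat_scheme \<Rightarrow> ('o3, 'm3, 'z3) cat_scheme
    \<Rightarrow> ('o1, 'm1, 'o2, 'm2) cfun \<Rightarrow> ('o1, 'm1, 'o3, 'm3) cfun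
    \<Rightarrow> ('o2, 'm2, 'o3, 'm3) cfun \<Rightarrow> ('o1 \<Rightarrow> 'm3) \<Rightarrow> 'o2 \<Rightarrow> 'm3" where
  "lan_mate C C' D q f R \<sigma> =
    (THE \<tau>. nat_trans C' D (Lan C C' D q f) R \<tau> \<and>
      vcomp C D (whisker_right C \<tau> q) (lan_unit C C' D q f) = \<sigma>)"

definition lan_map ::
  "('o1, 'm1, 'z1) cat_scheme \<Rightarrow> ('o2, 'm2, 'z2) cat_scheme \<Rightarrow> ('o3, 'm3, 'z3) cat_scheme
    \<Rightarrow> ('o1, 'm1, 'o2, 'm2) cfun \<Rightarrow> ('o1, 'm1, 'o3, 'm3) cfun \<Rightarrow> ('o1, 'm1, 'o3, 'm3) cfun
    \<Rightarrow> ('o1 \<Rightarrow> 'm3) \<Rightarrow> 'o2 \<Rightarrow> 'm3" where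
  "lan_map C C' D q f g \<alpha> =
    lan_mate C C' D q f (Lan C C' D q g) (vcomp C D (lan_unit C C' D q g) \<alpha>)"


section \<open>The functor \<open>Lan p (p \<circ> -)\<close> and its structure maps\<close>

definition lan_post ::
  "('o1, 'm1, 'z1) cat_scheme \<Rightarrow> ('o2, 'm2, 'z2) cat_scheme \<Rightarrow> ('o1, 'm1, 'o2, 'm2) cfun
    \<Rightarrow> ('o1, 'm1, 'o1, 'm1) cfun \<Rightarrow> ('o2, 'm2, 'o2, 'm2) cfun" where
  "lan_post C D p q = Lan C D D p (cfun_comp C p q)"

definition lan_post_fun ::
  "'u set \<Rightarrow> ('o1, 'm1, 'z1) cat_scheme \<Rightarrow> ('o2, 'm2, 'z2) cat_scheme
    \<Rightarrow> ('o1, 'm1, 'o2, 'm2) cfun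
    \<Rightarrow> (('o1, 'm1, 'o1, 'm1) cfun,
        ('o1, 'm1, 'o1, 'm1) cfun \<times> ('o1, 'm1, 'o1, 'm1) cfun \<times> ('o1 \<Rightarrow> 'm1),
        ('o2, 'm2, 'o2, 'm2) cfun,
        ('o2, 'm2, 'o2, 'm2) cfun \<times> ('o2, 'm2, 'o2, 'm2) cfun \<times> ('o2 \<Rightarrow> 'm2)) cfun" where
  "lan_post_fun U C D p =
    \<lparr>OMap = (\<lambda>q\<in>Obj (End_cat U C). lan_post C D p q),
     AMap = (\<lambda>(q, r, \<alpha>)\<in>Arr (End_cat U C).
       (lan_post C D p q, lan_post C D p r,
        lan_map C D D p (cfun_comp C p q) (cfun_comp C p r) (whisker_left C p \<alpha>)))\<rparr>"

text \<open>The mate of the identity \<open>p \<Rightarrow> id \<circ> p\<close>; note that \<open>p \<circ> id = p\<close>.\<close>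

definition lan_counit ::
  "('o1, 'm1, 'z1) cat_scheme \<Rightarrow> ('o2, 'm2, 'z2) cat_scheme \<Rightarrow> ('o1, 'm1, 'o2, 'm2) cfun
    \<Rightarrow> ('o2, 'm2, 'o2, 'm2) cfun \<times> ('o2, 'm2, 'o2, 'm2) cfun \<times> ('o2 \<Rightarrow> 'm2)" where
  "lan_counit C D p =
    (Lan C D D p p, id_fun D, lan_mate C D D p p (id_fun D) (nt_ident C D p))"

text \<open>
  The mate of the composite
  \<open>p \<circ> q \<circ> r \<Rightarrow> Lan p (p \<circ> q) \<circ> p \<circ> r \<Rightarrow> Lan p (p \<circ> q) \<circ> Lan p (p \<circ> r) \<circ> p\<close> of whiskered units.
\<close>

definition lan_comult ::
  "('o1, 'm1, 'z1) cat_scheme \<Rightarrow> ('o2, 'm2, 'z2) cat_scheme \<Rightarrow> ('o1, 'm1, 'o2, 'm2) cfun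
    \<Rightarrow> ('o1, 'm1, 'o1, 'm1) cfun \<Rightarrow> ('o1, 'm1, 'o1, 'm1) cfun
    \<Rightarrow> ('o2, 'm2, 'o2, 'm2) cfun \<times> ('o2, 'm2, 'o2, 'm2) cfun \<times> ('o2 \<Rightarrow> 'm2)" where
  "lan_comult C D p q r =
    (let Lq = lan_post C D p q; Lr = lan_post C D p r; pqr = cfun_comp C p (cfun_comp C q r) in
      (Lan C D D p pqr, cfun_comp D Lq Lr,
       lan_mate C D D p pqr (cfun_comp D Lq Lr)
         (vcomp C D
           (whisker_left C Lq (lan_unit C D D p (cfun_comp C p r)))
           (whisker_right C (lan_unit C D D p (cfun_comp C p q)) r))))"

end

theory Submission
  imports Defs
begin

text \<open>
  \<open>Lan p f\<close> is computed pointwise: if \<open>f\<close> preserves \<open>\<kappa>\<close>-directed colimits and \<open>A\<close> is a small set of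
  \<open>\<kappa>\<close>-presentable objects generating \<open>C\<close>, then \<open>f\<close> is determined by its restriction to \<open>A\<close>, and its value at
  \<open>d\<close> is the small colimit of \<open>f a\<close> over all \<open>a \<in> A\<close> and \<open>p a \<rightarrow> d\<close>.  As soon as all \<open>p a\<close> are
  \<open>\<mu>\<close>-presentable, any arrow \<open>p a \<rightarrow> d\<close> into a \<open>\<mu>\<close>-directed colimit factors essentially uniquely through
  a stage, so the extension preserves \<open>\<mu>\<close>-directed colimits.  Such a \<open>\<mu>\<close> exists, and \<open>D\<close> is still
  accessible at it because it is cocomplete.  The coherence laws then follow from the uniqueness of
  transformations out of a Kan extension: both sides agree at the objects \<open>p x\<close> after the unit.
\<close>

section \<open>Small sets\<close>

text \<open>The obstacle is the index. Accessibility at \<kappa> passes in general only to sharply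
  larger cardinals, while \<open>accessible_functor\<close> asks for one index that fits source,
  target and functor alike. For \<open>D\<close>, a \<kappa>-directed diagram is replaced by the
  poset of its subdiagrams with fewer than \<mu> vertices: their colimits exist by cocompleteness,
  are \<mu>-presentable, and have the same colimit. \<open>C\<close> need not have such colimits, so
  its index is always one of those supplied with the given functors.

  Diagram shapes must have type \<open>('u, 'u) cat\<close>, whereas comma categories consist of
  pairs of objects and arrows of arbitrary types. Hence the detour through graphs, their subdivision
  into categories, and injections into \<open>U\<close>. Graphs also spare composition in the
  pointwise formula.

  \<open>Lan\<close> is picked by \<open>SOME\<close>. The pointwise construction only supplies a
  witness, and its accessibility has to be carried to the chosen extension along the comparison
  isomorphism.\<close>

lemma ordLess_image: "|A| <o r \<Longrightarrow> |f ` A| <o r"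
  by (rule ordLeq_ordLess_trans[OF card_of_image])

lemma ordLess_subset: "|A| <o r \<Longrightarrow> B \<subseteq> A \<Longrightarrow> |B| <o r"
  by (rule ordLeq_ordLess_trans[OF card_of_mono1])

lemma ordLess_inj_on:
  assumes "|A| <o r" "inj_on f B" "f ` B \<subseteq> A"
  shows "|B| <o r"
proof -
  have "|B| \<le>o |A|" using assms(2,3) card_of_ordLeq[of B A] by blast
  then show ?thesis using assms(1) by (rule ordLeq_ordLess_trans)
qed

lemma ordLess_finite: "Cinfinite r \<Longrightarrow> finite A \<Longrightarrow> |A| <o r"
  unfolding cinfinite_def
  using finite_ordLess_infinite[of "|A|" r] card_of_Well_order[of A] card_order_on_well_order_on[of
      "Field r" r]
  by (simp add: Field_card_of)

lemma ordLess_UN: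
  assumes "Cinfinite r" "regularCard r" "|I| <o r" "\<And>i. i \<in> I \<Longrightarrow> |A i| <o r"
  shows "|\<Union>i\<in>I. A i| <o r"
  by (rule card_of_UNION_ordLess_infinite_Field_regularCard) (use assms in auto)

lemma ordLess_Times:
  assumes "Cinfinite r" "regularCard r" "|A| <o r" "|B| <o r"
  shows "|A \<times> B| <o r"
proof -
  have "stable r"
    using assms by (auto intro: regularCard_stable simp: cinfinite_def)
  then show ?thesis
    using assms(3,4) by (rule stable_elim)
qed

lemma ordLess_Un:
  assumes "Cinfinite r" "|A| <o r" "|B| <o r"
  shows "|A \<union> B| <o r"
  by (rule card_of_Un_ordLess_infinite_Field) (use assms in \<open>auto simp: cinfinite_def\<close>)

lemma inaccessible_Cinfinite: "inaccessible U \<Longrightarrow> Cinfinite |U|"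
  unfolding inaccessible_def cinfinite_def Field_card_of
  using ordLess_imp_ordLeq[of natLeq "|U|"] infinite_iff_natLeq_ordLeq[of U]
    card_of_card_order_on[of U] by simp

lemma inaccessible_regular: "inaccessible U \<Longrightarrow> regularCard |U|"
  unfolding inaccessible_def by blast

lemma small_image: "small U A \<Longrightarrow> small U (f ` A)"
  unfolding small_def by (rule ordLess_image)

lemma small_subset: "small U A \<Longrightarrow> B \<subseteq> A \<Longrightarrow> small U B"
  unfolding small_def by (rule ordLess_subset)

lemma small_inj_on: "small U A \<Longrightarrow> inj_on f B \<Longrightarrow> f ` B \<subseteq> A \<Longrightarrow> small U B"
  unfolding small_def by (rule ordLess_inj_on)

lemma small_finite: "inaccessible U \<Longrightarrow> finite A \<Longrightarrow> small U A"
  unfolding small_def by (rule ordLess_finite[OF inaccessible_Cinfinite])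

lemma small_UN:
  "inaccessible U \<Longrightarrow> small U I \<Longrightarrow> (\<And>i. i \<in> I \<Longrightarrow> small U (A i)) \<Longrightarrow> small U (\<Union>i\<in>I. A i)"
  unfolding small_def by (intro ordLess_UN inaccessible_Cinfinite inaccessible_regular)

lemma small_Times: "inaccessible U \<Longrightarrow> small U A \<Longrightarrow> small U B \<Longrightarrow> small U (A \<times> B)"
  unfolding small_def by (intro ordLess_Times inaccessible_Cinfinite inaccessible_regular)

lemma small_Un: "inaccessible U \<Longrightarrow> small U A \<Longrightarrow> small U B \<Longrightarrow> small U (A \<union> B)"
  unfolding small_def by (intro ordLess_Un inaccessible_Cinfinite)

text \<open>The bridge from index sets of any type to the type \<open>'u\<close>, in which
  \<open>cocomplete\<close> and \<open>directed_poset\<close> take their shapes.\<close>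

lemma small_bij_into:
  assumes "small U A"
  obtains \<phi> where "inj_on \<phi> A" "\<phi> ` A \<subseteq> U"
proof -
  have "|A| \<le>o |U|" using assms unfolding small_def by (rule ordLess_imp_ordLeq)
  then show thesis using that card_of_ordLeq[of A U] by blast
qed

text \<open>\<open>inaccessible\<close> bounds power sets only for sets over \<open>'u\<close>, so
  \<open>A\<close> is replaced by an injective image inside \<open>U\<close>.\<close>

lemma small_Pow:
  assumes "inaccessible U" "small U A" shows "small U (Pow A)"
proof -
  obtain \<phi> where \<phi>: "inj_on \<phi> A" "\<phi> ` A \<subseteq> U" by (rule small_bij_into[OF assms(2)])
  have "|\<phi> ` A| <o |U|" using assms(2) unfolding small_def by (rule ordLess_image)
  then have "small U (Pow (\<phi> ` A))" using assms(1) unfolding inaccessible_def small_def by blast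
  then show ?thesis
  proof (rule small_inj_on)
    show "inj_on ((`) \<phi>) (Pow A)" using \<phi>(1) by (rule inj_on_image_Pow)
  qed auto
qed

text \<open>An extensional function is determined by its graph, an element of
  \<open>Pow (A \<times> B)\<close>.\<close>

lemma small_PiE:
  assumes "inaccessible U" "small U A" "small U B" shows "small U (A \<rightarrow>\<^sub>E B)"
proof (rule small_inj_on)
  show "small U (Pow (A \<times> B))" using assms by (intro small_Pow small_Times)
  show "inj_on (\<lambda>f. {(a, f a) | a. a \<in> A}) (A \<rightarrow>\<^sub>E B)"
  proof (rule inj_onI)
    fix f g assume f: "f \<in> A \<rightarrow>\<^sub>E B" and g: "g \<in> A \<rightarrow>\<^sub>E B"
      and eq: "{(a, f a) | a. a \<in> A} = {(a, g a) | a. a \<in> A}"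
    show "f = g"
    proof (rule PiE_ext[OF f g])
      fix a assume "a \<in> A"
      then have "(a, f a) \<in> {(a, g a) | a. a \<in> A}" using eq by blast
      then show "f a = g a" by auto
    qed
  qed
qed auto

text \<open>Supplies two truth values for testing colimits in \<open>set_cat\<close> against
  predicates.\<close>

lemma inaccessible_two:
  assumes "inaccessible U"
  obtains u v where "u \<in> U" "v \<in> U" "u \<noteq> v"
proof -
  have "infinite U"
    using inaccessible_Cinfinite[OF assms] by (simp add: cinfinite_def Field_card_of)
  then obtain u where u: "u \<in> U" using infinite_imp_nonempty by blast
  have "infinite (U - {u})" using \<open>infinite U\<close> by simp
  then obtain v where "v \<in> U - {u}" using infinite_imp_nonempty by blast
  then show thesis using that u by blast
qed

section \<open>Regular cardinals\<close>

lemma regular_cardinalD: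
  assumes "regular_cardinal U \<kappa>"
  shows "Cinfinite \<kappa>" "regularCard \<kappa>" "\<kappa> <o |U|"
  using assms unfolding regular_cardinal_def by auto

lemma regular_cardinal_linear:
  assumes "regular_cardinal U \<kappa>" "regular_cardinal U \<mu>"
  shows "\<kappa> \<le>o \<mu> \<or> \<mu> \<le>o \<kappa>"
proof -
  have "Well_order \<kappa>" "Well_order \<mu>"
    using regular_cardinalD(1)[OF assms(1)] regular_cardinalD(1)[OF assms(2)]
    by (auto simp: card_order_on_well_order_on)
  then show ?thesis by (rule ordLeq_total)
qed

text \<open>Successors of infinite cardinals are regular, and the successor of \<open>|?Y|\<close>
  is at most \<open>|Pow ?Y|\<close>, which inaccessibility keeps below \<open>|U|\<close>.\<close>

lemma exists_regular_cardinal_above: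
  fixes U :: "'u set"
  assumes U: "inaccessible U" and \<kappa>: "regular_cardinal U \<kappa>" and X: "small U X"
  obtains \<mu> where "regular_cardinal U \<mu>" "\<kappa> \<le>o \<mu>" "|X| <o \<mu>"
proof -
  obtain \<phi> where \<phi>: "inj_on \<phi> X" "\<phi> ` X \<subseteq> U" by (rule small_bij_into[OF X])
  \<comment> \<open>Adjoining the field of \<kappa> makes the set infinite and puts \<kappa> below
    its successor cardinal.\<close>
  let ?Y = "\<phi> ` X \<union> Field \<kappa>"
  have \<kappa>': "Cinfinite \<kappa>" "\<kappa> <o |U|" using regular_cardinalD[OF \<kappa>] by auto
  have Y: "|?Y| <o |U|"
    using X ordLess_Field[OF \<kappa>'(2)] inaccessible_Cinfinite[OF U]
    unfolding small_def by (intro ordLess_Un ordLess_image) auto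
  have infY: "Cinfinite |?Y|"
    using \<kappa>'(1) by (simp add: cinfinite_def Field_card_of card_of_card_order_on)
  let ?s = "cardSuc |?Y|"
  have s: "Cinfinite ?s" "regularCard ?s"
    using infY by (rule Cinfinite_cardSuc, intro regularCard_cardSuc)
  have "?s \<le>o |Pow ?Y|"
    using cardSuc_least[OF card_of_Card_order card_of_Card_order card_of_Pow] .
  moreover have "|Pow ?Y| <o |U|" using small_Pow[OF U, of ?Y] Y unfolding small_def by blast
  ultimately have sU: "?s <o |U|" by (rule ordLeq_ordLess_trans)
  \<comment> \<open>\<open>cardSuc\<close> produces an order on \<open>'u set\<close>, while a
    regular cardinal has to be an order on \<open>'u\<close>; it is therefore represented by a
    subset \<open>B\<close> of \<open>U\<close> of the same cardinality.\<close>
  have fs: "|Field ?s| =o ?s" using s(1) card_of_Field_ordIso by blast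
  have "|Field ?s| <o |U|" using fs sU by (rule ordIso_ordLess_trans)
  then obtain B where B: "B \<subset> Field |U|" "|Field ?s| =o |B|" "|B| <o |U|"
    using internalize_card_of_ordLess[of "Field ?s" "|U|"] by blast
  let ?\<mu> = "|B|"
  have iso: "?s =o ?\<mu>" using ordIso_transitive[OF ordIso_symmetric[OF fs] B(2)] .
  have "regular_cardinal U ?\<mu>"
    unfolding regular_cardinal_def
    using Cinfinite_cong[OF iso s(1)] regularCard_ordIso[OF iso s] B(3) by blast
  moreover have lt: "|?Y| <o ?\<mu>"
    using cardSuc_greater[OF card_of_Card_order] iso by (rule ordLess_ordIso_trans)
  moreover have "\<kappa> \<le>o ?\<mu>"
  proof -
    have "\<kappa> =o |Field \<kappa>|" using \<kappa>'(1) card_of_Field_ordIso ordIso_symmetric by blast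
    moreover have "|Field \<kappa>| \<le>o |?Y|" by (rule card_of_mono1) blast
    ultimately have "\<kappa> \<le>o |?Y|" by (rule ordIso_ordLeq_trans)
    then show ?thesis using ordLeq_ordLess_trans[OF _ lt] ordLess_imp_ordLeq by blast
  qed
  moreover have "|X| <o ?\<mu>" using \<phi>(1) by (rule ordLess_inj_on[OF lt]) blast
  ultimately show thesis using that by blast
qed

section \<open>Categories and functors\<close>

context category
begin

lemma HomD:
  assumes "f \<in> Hom C a b"
  shows "f \<in> Arr C" "Dom C f = a" "Cod C f = b" "a \<in> Obj C" "b \<in> Obj C"
  using assms Dom_Obj Cod_Obj by (auto simp: Hom_def)

lemma Arr_Hom: "f \<in> Arr C \<Longrightarrow> f \<in> Hom C (Dom C f) (Cod C f)"
  by (simp add: Hom_def)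

end

lemma cfun_comp_simps [simp]:
  "a \<in> Obj C \<Longrightarrow> OMap (cfun_comp C G F) a = OMap G (OMap F a)"
  "f \<in> Arr C \<Longrightarrow> AMap (cfun_comp C G F) f = AMap G (AMap F f)"
  by (simp_all add: cfun_comp_def)

lemma id_fun_simps [simp]:
  "a \<in> Obj C \<Longrightarrow> OMap (id_fun C) a = a"
  "f \<in> Arr C \<Longrightarrow> AMap (id_fun C) f = f"
  by (simp_all add: id_fun_def)

lemma (in is_functor) AMap_Arr:
  "f \<in> Arr C \<Longrightarrow> AMap F f \<in> Arr D"
  using AMap_Hom[OF dom.Arr_Hom] cod.HomD(1) by blast

lemma cfun_eqI:
  assumes "is_functor C D F" "is_functor C D G"
    and "\<And>a. a \<in> Obj C \<Longrightarrow> OMap F a = OMap G a"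
    and "\<And>f. f \<in> Arr C \<Longrightarrow> AMap F f = AMap G f"
  shows "F = G"
proof -
  have "OMap F = OMap G"
    using assms by (intro extensionalityI[of _ "Obj C"]) (auto simp: is_functor.OMap_ext)
  moreover have "AMap F = AMap G"
    using assms by (intro extensionalityI[of _ "Arr C"]) (auto simp: is_functor.AMap_ext)
  ultimately show ?thesis by (cases F, cases G) simp
qed

lemma is_functor_id: "category C \<Longrightarrow> is_functor C C (id_fun C)"
proof -
  assume "category C"
  then interpret category C .
  show ?thesis
    by unfold_locales
      (auto simp: id_fun_def Ident_Hom HomD Comp_Hom intro: HomD(1)[OF Ident_Hom] HomD(1)[OF Comp_Hom])
qed

lemma is_functor_comp:
  assumes "is_functor A B F" "is_functor B C G"
  shows "is_functor A C (cfun_comp A G F)"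
proof -
  interpret F: is_functor A B F by fact
  interpret G: is_functor B C G by fact
  show ?thesis
  proof
    show "OMap (cfun_comp A G F) \<in> extensional (Obj A)" "AMap (cfun_comp A G F) \<in> extensional (Arr A)"
      by (auto simp: cfun_comp_def)
  next
    fix a assume "a \<in> Obj A"
    then show "OMap (cfun_comp A G F) a \<in> Obj C" by (simp add: F.OMap_Obj G.OMap_Obj)
  next
    fix f a b assume f: "f \<in> Hom A a b"
    then show "AMap (cfun_comp A G F) f \<in> Hom C (OMap (cfun_comp A G F) a) (OMap (cfun_comp A G F) b)"
      using F.dom.HomD[OF f] by (simp add: F.AMap_Hom G.AMap_Hom)
  next
    fix a assume "a \<in> Obj A"
    then show "AMap (cfun_comp A G F) (Ident A a) = Ident C (OMap (cfun_comp A G F) a)"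
      by (simp add: F.dom.HomD(1)[OF F.dom.Ident_Hom] F.AMap_Ident G.AMap_Ident F.OMap_Obj)
  next
    fix f a b g c assume fg: "f \<in> Hom A a b" "g \<in> Hom A b c"
    then show "AMap (cfun_comp A G F) (Comp A g f) =
      Comp C (AMap (cfun_comp A G F) g) (AMap (cfun_comp A G F) f)"
      using F.dom.HomD(1)[OF F.dom.Comp_Hom[OF fg]] F.dom.HomD(1)[OF fg(1)] F.dom.HomD(1)[OF fg(2)]
        G.AMap_Comp[OF F.AMap_Hom F.AMap_Hom, OF fg]
      by (simp add: F.AMap_Comp)
  qed
qed

section \<open>Colimits of graph diagrams\<close>

text \<open>
  Diagrams are indexed by directed graphs instead of categories: \<open>K\<close> is the set of vertices, \<open>X\<close>
  labels them with objects, and an edge \<open>(k, l, u) \<in> R\<close> carries the arrow \<open>u : X k \<rightarrow> X l\<close>.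
\<close>

definition gdiagram ::
  "('o, 'm, 'z) cat_scheme \<Rightarrow> 'i set \<Rightarrow> ('i \<Rightarrow> 'o) \<Rightarrow> ('i \<times> 'i \<times> 'm) set \<Rightarrow> bool" where
  "gdiagram C K X R \<longleftrightarrow> (\<forall>k\<in>K. X k \<in> Obj C) \<and>
    (\<forall>(k, l, u)\<in>R. k \<in> K \<and> l \<in> K \<and> u \<in> Hom C (X k) (X l))"

definition gcocone ::
  "('o, 'm, 'z) cat_scheme \<Rightarrow> 'i set \<Rightarrow> ('i \<Rightarrow> 'o) \<Rightarrow> ('i \<times> 'i \<times> 'm) set \<Rightarrow> 'o \<Rightarrow> ('i \<Rightarrow> 'm) \<Rightarrow> bool" where
  "gcocone C K X R c \<iota> \<longleftrightarrow> c \<in> Obj C \<and> (\<forall>k\<in>K. \<iota> k \<in> Hom C (X k) c) \<and>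
    (\<forall>(k, l, u)\<in>R. Comp C (\<iota> l) u = \<iota> k)"

definition gcolimit ::
  "('o, 'm, 'z) cat_scheme \<Rightarrow> 'i set \<Rightarrow> ('i \<Rightarrow> 'o) \<Rightarrow> ('i \<times> 'i \<times> 'm) set \<Rightarrow> 'o \<Rightarrow> ('i \<Rightarrow> 'm) \<Rightarrow> bool" where
  "gcolimit C K X R c \<iota> \<longleftrightarrow> gcocone C K X R c \<iota> \<and>
    (\<forall>c' \<iota>'. gcocone C K X R c' \<iota>' \<longrightarrow>
      (\<exists>!h. h \<in> Hom C c c' \<and> (\<forall>k\<in>K. Comp C h (\<iota> k) = \<iota>' k)))"

text \<open>Parallel arrows with the same image under \<open>G\<close> collapse to one edge. This is
  harmless, as they impose the same condition on cocones.\<close>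

definition edges ::
  "('i, 'k, 'y) cat_scheme \<Rightarrow> ('i, 'k, 'o, 'm) cfun \<Rightarrow> ('i \<times> 'i \<times> 'm) set" where
  "edges J G = {(i, j, AMap G u) | i j u. i \<in> Obj J \<and> j \<in> Obj J \<and> u \<in> Hom J i j}"

lemma is_cocone_iff_gcocone:
  "is_cocone J C G c \<iota> \<longleftrightarrow> gcocone C (Obj J) (OMap G) (edges J G) c \<iota>"
  unfolding is_cocone_def gcocone_def edges_def by blast

lemma is_colimit_iff_gcolimit:
  "is_colimit J C G c \<iota> \<longleftrightarrow> gcolimit C (Obj J) (OMap G) (edges J G) c \<iota>"
  unfolding is_colimit_def gcolimit_def is_cocone_iff_gcocone ..

lemma gdiagram_edges:
  assumes "is_functor J C G" shows "gdiagram C (Obj J) (OMap G) (edges J G)"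
proof -
  interpret is_functor J C G by fact
  show ?thesis unfolding gdiagram_def edges_def using OMap_Obj AMap_Hom by auto
qed

lemma gcoconeD:
  assumes "gcocone C K X R c \<iota>"
  shows "c \<in> Obj C" "k \<in> K \<Longrightarrow> \<iota> k \<in> Hom C (X k) c"
    "(k, l, u) \<in> R \<Longrightarrow> Comp C (\<iota> l) u = \<iota> k"
  using assms unfolding gcocone_def by auto

lemma gcolimit_gcocone: "gcolimit C K X R c \<iota> \<Longrightarrow> gcocone C K X R c \<iota>"
  unfolding gcolimit_def by blast

lemma gcolimit_factor:
  assumes "gcolimit C K X R c \<iota>" "gcocone C K X R c' \<iota>'"
  obtains h where "h \<in> Hom C c c'" "\<And>k. k \<in> K \<Longrightarrow> Comp C h (\<iota> k) = \<iota>' k"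
  using assms unfolding gcolimit_def by blast

lemma gcocone_cong:
  assumes "\<And>k. k \<in> K \<Longrightarrow> X k = X' k" "\<And>k. k \<in> K \<Longrightarrow> \<iota> k = \<iota>' k" "R \<subseteq> K \<times> K \<times> UNIV"
  shows "gcocone C K X R c \<iota> \<longleftrightarrow> gcocone C K X' R c \<iota>'"
proof -
  have "(\<forall>(k, l, u)\<in>R. Comp C (\<iota> l) u = \<iota> k) \<longleftrightarrow> (\<forall>(k, l, u)\<in>R. Comp C (\<iota>' l) u = \<iota>' k)"
  proof (rule ball_cong[OF refl])
    fix e assume "e \<in> R"
    moreover from this obtain k l u where "e = (k, l, u)" "k \<in> K" "l \<in> K" using assms(3) by blast
    ultimately show "(case e of (k, l, u) \<Rightarrow> Comp C (\<iota> l) u = \<iota> k) \<longleftrightarrow>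
      (case e of (k, l, u) \<Rightarrow> Comp C (\<iota>' l) u = \<iota>' k)" using assms(2) by simp
  qed
  then show ?thesis unfolding gcocone_def using assms(1,2) by simp
qed

lemma gdiagram_edge_subset: "gdiagram C K X R \<Longrightarrow> R \<subseteq> K \<times> K \<times> UNIV"
  unfolding gdiagram_def by fast

lemma gcolimit_cong:
  assumes "\<And>k. k \<in> K \<Longrightarrow> X k = X' k" "\<And>k. k \<in> K \<Longrightarrow> \<iota> k = \<iota>' k" "R \<subseteq> K \<times> K \<times> UNIV"
  shows "gcolimit C K X R c \<iota> \<longleftrightarrow> gcolimit C K X' R c \<iota>'"
  unfolding gcolimit_def using gcocone_cong[of K X X' \<iota> \<iota>' R C] gcocone_cong[of K X X' _ _ R C] assms
  by simp

lemma gcocone_relabel: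
  "gcocone C (\<phi> ` K) X ((\<lambda>(k, l, u). (\<phi> k, \<phi> l, u)) ` R) c \<iota> \<longleftrightarrow>
    gcocone C K (X \<circ> \<phi>) R c (\<iota> \<circ> \<phi>)"
  unfolding gcocone_def by (auto simp: split_beta)

text \<open>Injectivity lets a competing cocone over \<open>K\<close> be read, through
  \<open>inv_into\<close>, as a cocone over the relabelled graph; the conditions on the factoring
  arrow are then the same on both sides.\<close>

lemma gcolimit_relabel:
  assumes "inj_on \<phi> K" "R \<subseteq> K \<times> K \<times> UNIV"
  shows "gcolimit C (\<phi> ` K) X ((\<lambda>(k, l, u). (\<phi> k, \<phi> l, u)) ` R) c \<iota> \<longleftrightarrow>
    gcolimit C K (X \<circ> \<phi>) R c (\<iota> \<circ> \<phi>)" (is "gcolimit C ?K X ?R c \<iota> \<longleftrightarrow> _")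
proof
  assume L: "gcolimit C ?K X ?R c \<iota>"
  show "gcolimit C K (X \<circ> \<phi>) R c (\<iota> \<circ> \<phi>)"
    unfolding gcolimit_def
  proof (intro conjI allI impI)
    show "gcocone C K (X \<circ> \<phi>) R c (\<iota> \<circ> \<phi>)"
      using gcolimit_gcocone[OF L] unfolding gcocone_relabel .
    fix c' \<iota>' assume cc: "gcocone C K (X \<circ> \<phi>) R c' \<iota>'"
    let ?\<iota> = "\<lambda>x. \<iota>' (inv_into K \<phi> x)"
    have inv: "k \<in> K \<Longrightarrow> ?\<iota> (\<phi> k) = \<iota>' k" for k using assms(1) by simp
    have "gcocone C K (X \<circ> \<phi>) R c' (?\<iota> \<circ> \<phi>)"
      using cc gcocone_cong[of K "X \<circ> \<phi>" "X \<circ> \<phi>" \<iota>' "?\<iota> \<circ> \<phi>" R C c'] assms(2) inv by simp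
    then have "gcocone C ?K X ?R c' ?\<iota>" unfolding gcocone_relabel .
    then have "\<exists>!h. h \<in> Hom C c c' \<and> (\<forall>k\<in>?K. Comp C h (\<iota> k) = ?\<iota> k)"
      using L unfolding gcolimit_def by blast
    then show "\<exists>!h. h \<in> Hom C c c' \<and> (\<forall>k\<in>K. Comp C h ((\<iota> \<circ> \<phi>) k) = \<iota>' k)"
      using inv by simp
  qed
next
  assume L: "gcolimit C K (X \<circ> \<phi>) R c (\<iota> \<circ> \<phi>)"
  show "gcolimit C ?K X ?R c \<iota>"
    unfolding gcolimit_def
  proof (intro conjI allI impI)
    show "gcocone C ?K X ?R c \<iota>"
      using gcolimit_gcocone[OF L] unfolding gcocone_relabel .
    fix c' \<iota>' assume "gcocone C ?K X ?R c' \<iota>'"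
    then have "gcocone C K (X \<circ> \<phi>) R c' (\<iota>' \<circ> \<phi>)" unfolding gcocone_relabel .
    then have "\<exists>!h. h \<in> Hom C c c' \<and> (\<forall>k\<in>K. Comp C h ((\<iota> \<circ> \<phi>) k) = (\<iota>' \<circ> \<phi>) k)"
      using L unfolding gcolimit_def by blast
    then show "\<exists>!h. h \<in> Hom C c c' \<and> (\<forall>k\<in>?K. Comp C h (\<iota> k) = \<iota>' k)" by simp
  qed
qed

context category
begin

text \<open>Composing \<open>h\<close> with the legs gives a cocone on \<open>c'\<close>, and both
  arrows factor it. In short, the legs of a colimit are jointly epic.\<close>

lemma gcolimit_eqI:
  assumes "gcolimit C K X R c \<iota>" and h: "h \<in> Hom C c c'" and h': "h' \<in> Hom C c c'"
    and eq: "\<And>k. k \<in> K \<Longrightarrow> Comp C h (\<iota> k) = Comp C h' (\<iota> k)"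
    and R: "gdiagram C K X R"
  shows "h = h'"
proof -
  note cc = gcoconeD[OF gcolimit_gcocone[OF assms(1)]]
  have "gcocone C K X R c' (\<lambda>k. Comp C h (\<iota> k))"
    unfolding gcocone_def
  proof (intro conjI ballI; clarify?)
    show "c' \<in> Obj C" using HomD[OF h] by blast
    show "Comp C h (\<iota> k) \<in> Hom C (X k) c'" if "k \<in> K" for k using Comp_Hom[OF cc(2)[OF that] h] .
    fix k l u assume r: "(k, l, u) \<in> R"
    then have "l \<in> K" "u \<in> Hom C (X k) (X l)" using R unfolding gdiagram_def by auto
    then show "Comp C (Comp C h (\<iota> l)) u = Comp C h (\<iota> k)"
      using Comp_assoc[OF _ cc(2) h] cc(3)[OF r] by metis
  qed
  then have "\<exists>!g. g \<in> Hom C c c' \<and> (\<forall>k\<in>K. Comp C g (\<iota> k) = Comp C h (\<iota> k))"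
    using assms(1) unfolding gcolimit_def by blast
  then show ?thesis using h h' eq by metis
qed

lemma gcolimitI:
  assumes "gcocone C K X R c \<iota>"
    and "\<And>c' \<iota>'. gcocone C K X R c' \<iota>' \<Longrightarrow> \<exists>h. h \<in> Hom C c c' \<and> (\<forall>k\<in>K. Comp C h (\<iota> k) = \<iota>' k)"
    and "\<And>c' h h'. h \<in> Hom C c c' \<Longrightarrow> h' \<in> Hom C c c' \<Longrightarrow>
      (\<And>k. k \<in> K \<Longrightarrow> Comp C h (\<iota> k) = Comp C h' (\<iota> k)) \<Longrightarrow> h = h'"
  shows "gcolimit C K X R c \<iota>"
  unfolding gcolimit_def
proof (intro conjI allI impI)
  fix c' \<iota>' assume "gcocone C K X R c' \<iota>'"
  then obtain h where h: "h \<in> Hom C c c'" "\<forall>k\<in>K. Comp C h (\<iota> k) = \<iota>' k" using assms(2) by blast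
  show "\<exists>!h. h \<in> Hom C c c' \<and> (\<forall>k\<in>K. Comp C h (\<iota> k) = \<iota>' k)"
  proof (rule ex1I)
    show "h \<in> Hom C c c' \<and> (\<forall>k\<in>K. Comp C h (\<iota> k) = \<iota>' k)" using h by blast
    show "g = h" if "g \<in> Hom C c c' \<and> (\<forall>k\<in>K. Comp C g (\<iota> k) = \<iota>' k)" for g
      using assms(3)[of g c' h] that h by simp
  qed
qed (rule assms(1))

end

section \<open>Transport of small categories to the universe\<close>

text \<open>Carries the structure of \<open>J\<close> along injections of its objects and arrows
  into \<open>'u\<close>; \<open>inv_into\<close> decodes, and is meaningful only on the
  images.\<close>

definition transport_cat :: "('i \<Rightarrow> 'u) \<Rightarrow> ('k \<Rightarrow> 'u) \<Rightarrow> ('i, 'k, 'z) cat_scheme \<Rightarrow> ('u, 'u) cat" where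
  "transport_cat \<phi> \<psi> J =
    \<lparr>Obj = \<phi> ` Obj J, Arr = \<psi> ` Arr J,
     Dom = (\<lambda>f. \<phi> (Dom J (inv_into (Arr J) \<psi> f))),
     Cod = (\<lambda>f. \<phi> (Cod J (inv_into (Arr J) \<psi> f))),
     Ident = (\<lambda>a. \<psi> (Ident J (inv_into (Obj J) \<phi> a))),
     Comp = (\<lambda>g f. \<psi> (Comp J (inv_into (Arr J) \<psi> g) (inv_into (Arr J) \<psi> f)))\<rparr>"

definition transport_fun ::
  "('i \<Rightarrow> 'u) \<Rightarrow> ('k \<Rightarrow> 'u) \<Rightarrow> ('i, 'k, 'z) cat_scheme \<Rightarrow> ('i, 'k, 'o, 'm) cfun \<Rightarrow> ('u, 'u, 'o, 'm) cfun"
      where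
  "transport_fun \<phi> \<psi> J G =
    \<lparr>OMap = (\<lambda>a\<in>\<phi> ` Obj J. OMap G (inv_into (Obj J) \<phi> a)),
     AMap = (\<lambda>f\<in>\<psi> ` Arr J. AMap G (inv_into (Arr J) \<psi> f))\<rparr>"

context
  fixes J :: "('i, 'k, 'z) cat_scheme" and \<phi> :: "'i \<Rightarrow> 'u" and \<psi> :: "'k \<Rightarrow> 'u"
  assumes J: "category J" and \<phi>: "inj_on \<phi> (Obj J)" and \<psi>: "inj_on \<psi> (Arr J)"
begin

interpretation category J by (rule J)

lemma transport_cat_simps [simp]:
  "Obj (transport_cat \<phi> \<psi> J) = \<phi> ` Obj J"
  "Arr (transport_cat \<phi> \<psi> J) = \<psi> ` Arr J"
  "f \<in> Arr J \<Longrightarrow> Dom (transport_cat \<phi> \<psi> J) (\<psi> f) = \<phi> (Dom J f)"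
  "f \<in> Arr J \<Longrightarrow> Cod (transport_cat \<phi> \<psi> J) (\<psi> f) = \<phi> (Cod J f)"
  "a \<in> Obj J \<Longrightarrow> Ident (transport_cat \<phi> \<psi> J) (\<phi> a) = \<psi> (Ident J a)"
  "f \<in> Arr J \<Longrightarrow> g \<in> Arr J \<Longrightarrow> Comp (transport_cat \<phi> \<psi> J) (\<psi> g) (\<psi> f) = \<psi> (Comp J g f)"
  using \<phi> \<psi> by (simp_all add: transport_cat_def)

lemma Hom_transport_cat:
  assumes "a \<in> Obj J" "b \<in> Obj J"
  shows "Hom (transport_cat \<phi> \<psi> J) (\<phi> a) (\<phi> b) = \<psi> ` Hom J a b"
proof -
  have "Dom J f = a \<longleftrightarrow> \<phi> (Dom J f) = \<phi> a" "Cod J f = b \<longleftrightarrow> \<phi> (Cod J f) = \<phi> b" if "f \<in> Arr J" for f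
    using that assms \<phi> Dom_Obj Cod_Obj by (auto dest: inj_onD)
  then show ?thesis unfolding Hom_def by auto
qed

lemma Hom_transport_catE:
  assumes "g \<in> Hom (transport_cat \<phi> \<psi> J) x y"
  obtains a b f where "a \<in> Obj J" "b \<in> Obj J" "x = \<phi> a" "y = \<phi> b" "f \<in> Hom J a b" "g = \<psi> f"
proof -
  obtain f where f: "f \<in> Arr J" "g = \<psi> f" using assms by (auto simp: Hom_def)
  then have "x = \<phi> (Dom J f)" "y = \<phi> (Cod J f)" using assms by (auto simp: Hom_def)
  then show thesis using that[OF Dom_Obj Cod_Obj] f Arr_Hom by blast
qed

lemma category_transport: "category (transport_cat \<phi> \<psi> J)" (is "category ?J")
proof
  show "Dom ?J f \<in> Obj ?J" "Cod ?J f \<in> Obj ?J" if "f \<in> Arr ?J" for f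
    using that Dom_Obj Cod_Obj by auto
  show "Ident ?J a \<in> Hom ?J a a" if "a \<in> Obj ?J" for a
    using that Ident_Hom by (auto simp: Hom_transport_cat)
  show "Comp ?J g f \<in> Hom ?J a c" if fg: "f \<in> Hom ?J a b" "g \<in> Hom ?J b c" for f g a b c
  proof -
    obtain a' b' f' where *: "a' \<in> Obj J" "b' \<in> Obj J" "a = \<phi> a'" "b = \<phi> b'" "f' \<in> Hom J a' b'" "f = \<psi>
        f'"
      by (rule Hom_transport_catE[OF fg(1)])
    obtain b'' c' g' where **: "b'' \<in> Obj J" "c' \<in> Obj J" "b = \<phi> b''" "c = \<phi> c'" "g' \<in> Hom J b'' c'"
        "g = \<psi> g'"
      by (rule Hom_transport_catE[OF fg(2)])
    \<comment> \<open>Both arrows decode the middle object \<open>b\<close> on their own;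
      injectivity of \<phi> shows that they agree.\<close>
    have "b'' = b'" using * ** \<phi> by (auto dest: inj_onD)
    then show ?thesis using * ** Comp_Hom[of f' a' b' g' c'] HomD(1)[of f'] HomD(1)[of g']
      by (simp add: Hom_transport_cat)
  qed
  show "Comp ?J h (Comp ?J g f) = Comp ?J (Comp ?J h g) f"
    if fg: "f \<in> Hom ?J a b" "g \<in> Hom ?J b c" "h \<in> Hom ?J c d" for f g h a b c d
  proof -
    obtain a' b' f' where *: "a' \<in> Obj J" "b' \<in> Obj J" "a = \<phi> a'" "b = \<phi> b'" "f' \<in> Hom J a' b'" "f = \<psi>
        f'"
      by (rule Hom_transport_catE[OF fg(1)])
    obtain b'' c' g' where **: "b'' \<in> Obj J" "c' \<in> Obj J" "b = \<phi> b''" "c = \<phi> c'" "g' \<in> Hom J b'' c'"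
        "g = \<psi> g'"
      by (rule Hom_transport_catE[OF fg(2)])
    obtain c'' d' h' where ***: "c'' \<in> Obj J" "d' \<in> Obj J" "c = \<phi> c''" "d = \<phi> d'" "h' \<in> Hom J c'' d'"
        "h = \<psi> h'"
      by (rule Hom_transport_catE[OF fg(3)])
    have eq: "b'' = b'" "c'' = c'" using * ** *** \<phi> by (auto dest: inj_onD)
    have f: "f' \<in> Hom J a' b'" "g' \<in> Hom J b' c'" "h' \<in> Hom J c' d'" using * ** *** eq by auto
    note HomD(1)[OF f(1)] HomD(1)[OF f(2)] HomD(1)[OF f(3)]
      HomD(1)[OF Comp_Hom[OF f(1,2)]] HomD(1)[OF Comp_Hom[OF f(2,3)]]
    then show ?thesis using Comp_assoc[OF f] * ** *** by simp
  qed
  show "Comp ?J f (Ident ?J a) = f" "Comp ?J (Ident ?J b) f = f" if fg: "f \<in> Hom ?J a b" for f a b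
  proof -
    obtain a' b' f' where *: "a' \<in> Obj J" "b' \<in> Obj J" "a = \<phi> a'" "b = \<phi> b'" "f' \<in> Hom J a' b'" "f = \<psi>
        f'"
      by (rule Hom_transport_catE[OF fg(1)])
    have I: "Ident J a' \<in> Arr J" "Ident J b' \<in> Arr J" "f' \<in> Arr J"
      using * HomD(1)[OF Ident_Hom] HomD(1)[of f'] by auto
    have e: "Comp J f' (Ident J a') = f'" "Comp J (Ident J b') f' = f'"
      using * Comp_Ident Ident_Comp by auto
    show "Comp ?J f (Ident ?J a) = f" "Comp ?J (Ident ?J b) f = f"
      using * I e by simp_all
  qed
qed

lemma transport_fun_simps [simp]:
  "a \<in> Obj J \<Longrightarrow> OMap (transport_fun \<phi> \<psi> J G) (\<phi> a) = OMap G a"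
  "f \<in> Arr J \<Longrightarrow> AMap (transport_fun \<phi> \<psi> J G) (\<psi> f) = AMap G f"
  using \<phi> \<psi> by (simp_all add: transport_fun_def)

lemma is_functor_transport:
  assumes "is_functor J C G"
  shows "is_functor (transport_cat \<phi> \<psi> J) C (transport_fun \<phi> \<psi> J G)" (is "is_functor ?J C ?G")
proof -
  interpret G: is_functor J C G by fact
  interpret J': category ?J by (rule category_transport)
  show ?thesis
  proof
    show "OMap ?G \<in> extensional (Obj ?J)" "AMap ?G \<in> extensional (Arr ?J)"
      by (simp_all add: transport_fun_def)
    show "OMap ?G a \<in> Obj C" if "a \<in> Obj ?J" for a
      using that G.OMap_Obj by auto
    show "AMap ?G f \<in> Hom C (OMap ?G a) (OMap ?G b)" if f: "f \<in> Hom ?J a b" for f a b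
    proof -
      obtain a' b' f' where *: "a' \<in> Obj J" "b' \<in> Obj J" "a = \<phi> a'" "b = \<phi> b'" "f' \<in> Hom J a' b'" "f =
          \<psi> f'"
        by (rule Hom_transport_catE[OF f])
      then show ?thesis using G.AMap_Hom[OF *(5)] HomD(1)[OF *(5)] by simp
    qed
    show "AMap ?G (Ident ?J a) = Ident C (OMap ?G a)" if "a \<in> Obj ?J" for a
      using that G.AMap_Ident HomD(1)[OF Ident_Hom] by auto
    show "AMap ?G (Comp ?J g f) = Comp C (AMap ?G g) (AMap ?G f)"
      if fg: "f \<in> Hom ?J a b" "g \<in> Hom ?J b c" for f g a b c
    proof -
      obtain a' b' f' where *: "a' \<in> Obj J" "b' \<in> Obj J" "a = \<phi> a'" "b = \<phi> b'" "f' \<in> Hom J a' b'" "f =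
          \<psi> f'"
        by (rule Hom_transport_catE[OF fg(1)])
      obtain b'' c' g' where **: "b'' \<in> Obj J" "c' \<in> Obj J" "b = \<phi> b''" "c = \<phi> c'" "g' \<in> Hom J b'' c'"
          "g = \<psi> g'"
        by (rule Hom_transport_catE[OF fg(2)])
      have "b'' = b'" using * ** \<phi> by (auto dest: inj_onD)
      then show ?thesis
        using * ** G.AMap_Comp[of f' a' b' g' c'] HomD(1)[of f'] HomD(1)[of g'] HomD(1)[OF Comp_Hom,
            of f' a' b' g' c']
        by simp
    qed
  qed
qed

lemma edges_transport:
  "edges (transport_cat \<phi> \<psi> J) (transport_fun \<phi> \<psi> J G) =
    (\<lambda>(k, l, u). (\<phi> k, \<phi> l, u)) ` edges J G" (is "?L = ?R")
proof
  show "?L \<subseteq> ?R"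
  proof
    fix e assume "e \<in> ?L"
    then obtain i j u where e: "e = (i, j, AMap (transport_fun \<phi> \<psi> J G) u)"
      "u \<in> Hom (transport_cat \<phi> \<psi> J) i j" unfolding edges_def by blast
    obtain a b f where *: "a \<in> Obj J" "b \<in> Obj J" "i = \<phi> a" "j = \<phi> b" "f \<in> Hom J a b" "u = \<psi> f"
      by (rule Hom_transport_catE[OF e(2)])
    then have "(a, b, AMap G f) \<in> edges J G" unfolding edges_def by blast
    moreover have "e = (\<phi> a, \<phi> b, AMap G f)" using e * HomD(1)[OF *(5)] by simp
    ultimately show "e \<in> ?R" by force
  qed
  show "?R \<subseteq> ?L"
  proof
    fix e assume "e \<in> ?R"
    then obtain a b f where *: "a \<in> Obj J" "b \<in> Obj J" "f \<in> Hom J a b" "e = (\<phi> a, \<phi> b, AMap G f)"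
      unfolding edges_def by auto
    have "\<psi> f \<in> Hom (transport_cat \<phi> \<psi> J) (\<phi> a) (\<phi> b)" using * by (simp add: Hom_transport_cat)
    moreover have "e = (\<phi> a, \<phi> b, AMap (transport_fun \<phi> \<psi> J G) (\<psi> f))"
      using * HomD(1)[OF *(3)] by simp
    ultimately show "e \<in> ?L" unfolding edges_def using * by auto
  qed
qed

text \<open>Seen as a graph, the transported diagram is just the original one with renamed vertices,
  so \<open>gcolimit_relabel\<close> applies and composition in the shape never enters.\<close>

lemma is_colimit_transport:
  assumes G: "is_functor J C G"
  shows "is_colimit (transport_cat \<phi> \<psi> J) C (transport_fun \<phi> \<psi> J G) c \<iota> \<longleftrightarrow>
    is_colimit J C G c (\<iota> \<circ> \<phi>)"
proof -
  have R: "edges J G \<subseteq> Obj J \<times> Obj J \<times> UNIV"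
    using gdiagram_edge_subset[OF gdiagram_edges[OF G]] .
  show ?thesis
    unfolding is_colimit_iff_gcolimit edges_transport transport_cat_simps gcolimit_relabel[OF \<phi> R]
    by (rule gcolimit_cong[OF _ _ R]) auto
qed

end

section \<open>Graph colimits in cocomplete categories\<close>

text \<open>
  The subdivision of a graph: every edge \<open>e : k \<rightarrow> l\<close> becomes a span \<open>k \<leftarrow> e \<rightarrow> l\<close>.  It is a category
  without any composable pair of non-identities, and has the same cocones as the graph.
\<close>

definition subdiv_cat ::
  "'i set \<Rightarrow> ('i \<times> 'i \<times> 'm) set
    \<Rightarrow> ('i + 'i \<times> 'i \<times> 'm, ('i + 'i \<times> 'i \<times> 'm) + ('i \<times> 'i \<times> 'm) \<times> bool) cat" where
  "subdiv_cat K R =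
    \<lparr>Obj = Inl ` K \<union> Inr ` R,
     Arr = Inl ` (Inl ` K \<union> Inr ` R) \<union> Inr ` (R \<times> UNIV),
     Dom = (\<lambda>f. case f of Inl x \<Rightarrow> x | Inr (e, b) \<Rightarrow> Inr e),
     Cod = (\<lambda>f. case f of Inl x \<Rightarrow> x | Inr ((k, l, u), b) \<Rightarrow> Inl (if b then l else k)),
     Ident = Inl,
     Comp = (\<lambda>g f. case g of Inl _ \<Rightarrow> f | Inr _ \<Rightarrow> g)\<rparr>"

text \<open>The object of an edge \<open>(k, l, u)\<close> gets the value \<open>X k\<close>. Of its
  two arrows, the one marked \<open>False\<close> leads to \<open>k\<close> and becomes an identity,
  the one marked \<open>True\<close> leads to \<open>l\<close> and becomes \<open>u\<close>.\<close>

definition subdiv_fun ::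
  "('o, 'm, 'z) cat_scheme \<Rightarrow> 'i set \<Rightarrow> ('i \<Rightarrow> 'o) \<Rightarrow> ('i \<times> 'i \<times> 'm) set
    \<Rightarrow> ('i + 'i \<times> 'i \<times> 'm, ('i + 'i \<times> 'i \<times> 'm) + ('i \<times> 'i \<times> 'm) \<times> bool, 'o, 'm) cfun" where
  "subdiv_fun C K X R =
    \<lparr>OMap = (\<lambda>x\<in>Obj (subdiv_cat K R). case x of Inl k \<Rightarrow> X k | Inr (k, l, u) \<Rightarrow> X k),
     AMap = (\<lambda>f\<in>Arr (subdiv_cat K R).
       case f of Inl x \<Rightarrow> Ident C (case x of Inl k \<Rightarrow> X k | Inr (k, l, u) \<Rightarrow> X k)
       | Inr ((k, l, u), b) \<Rightarrow> (if b then u else Ident C (X k)))\<rparr>"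

lemma category_subdiv:
  assumes "R \<subseteq> K \<times> K \<times> UNIV" shows "category (subdiv_cat K R)"
  by (standard; use assms in \<open>auto simp: subdiv_cat_def Hom_def split: sum.splits if_splits\<close>)

lemma is_functor_subdiv:
  assumes "category C" "gdiagram C K X R"
  shows "is_functor (subdiv_cat K R) C (subdiv_fun C K X R)" (is "is_functor ?J C ?G")
proof -
  interpret category C by fact
  interpret J: category ?J using gdiagram_edge_subset[OF assms(2)] by (rule category_subdiv)
  have R: "k \<in> K" "l \<in> K" "u \<in> Hom C (X k) (X l)" if "(k, l, u) \<in> R" for k l u
    using assms(2) that unfolding gdiagram_def by auto
  have X: "X k \<in> Obj C" if "k \<in> K" for k using assms(2) that unfolding gdiagram_def by blast
  have II: "k \<in> K \<Longrightarrow> Comp C (Ident C (X k)) (Ident C (X k)) = Ident C (X k)"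
    "(k, l, u) \<in> R \<Longrightarrow> Comp C u (Ident C (X k)) = u"
    "(k, l, u) \<in> R \<Longrightarrow> Comp C (Ident C (X l)) u = u" for k l u
    using Comp_Ident[OF Ident_Hom[OF X]] Comp_Ident[OF R(3)] Ident_Comp[OF R(3)] by auto
  show ?thesis
  proof
    show "OMap ?G \<in> extensional (Obj ?J)" "AMap ?G \<in> extensional (Arr ?J)"
      by (simp_all add: subdiv_fun_def)
    show "OMap ?G a \<in> Obj C" if "a \<in> Obj ?J" for a
      using that X R by (auto simp: subdiv_fun_def subdiv_cat_def)
    show "AMap ?G f \<in> Hom C (OMap ?G a) (OMap ?G b)" if "f \<in> Hom ?J a b" for f a b
      using that X R Ident_Hom by (auto simp: subdiv_fun_def subdiv_cat_def Hom_def[of "\<lparr>Obj = _, Arr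
          = _, Dom = _, Cod = _, Ident = _, Comp = _\<rparr>"] split: if_splits)
    show "AMap ?G (Ident ?J a) = Ident C (OMap ?G a)" if "a \<in> Obj ?J" for a
      using that by (auto simp: subdiv_fun_def subdiv_cat_def)
    show "AMap ?G (Comp ?J g f) = Comp C (AMap ?G g) (AMap ?G f)"
      if "f \<in> Hom ?J a b" "g \<in> Hom ?J b c" for f g a b c
      using that X R Ident_Hom II
      by (auto simp: subdiv_fun_def subdiv_cat_def Hom_def[of "\<lparr>Obj = _, Arr = _, Dom = _, Cod = _,
          Ident = _, Comp = _\<rparr>"] split: if_splits)
  qed
qed

lemma subdiv_cat_simps [simp]:
  "Inl k \<in> Obj (subdiv_cat K R) \<longleftrightarrow> k \<in> K"
  "Inr e \<in> Obj (subdiv_cat K R) \<longleftrightarrow> e \<in> R"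
  by (auto simp: subdiv_cat_def)

text \<open>The identity side of each span forces the leg at the edge object to be the leg at the
  source vertex; the other side is then exactly the cocone condition of the edge.\<close>

lemma gcocone_subdiv:
  assumes C: "category C" and D: "gdiagram C K X R"
  shows "is_cocone (subdiv_cat K R) C (subdiv_fun C K X R) c \<iota> \<Longrightarrow> gcocone C K X R c (\<lambda>k. \<iota> (Inl k))"
    and "is_cocone (subdiv_cat K R) C (subdiv_fun C K X R) c \<iota> \<Longrightarrow> (k, l, u) \<in> R \<Longrightarrow> \<iota> (Inr (k, l, u)) = \<iota>
        (Inl k)"
    and "gcocone C K X R c \<iota>' \<Longrightarrow> is_cocone (subdiv_cat K R) C (subdiv_fun C K X R) c
      (\<lambda>x. case x of Inl k \<Rightarrow> \<iota>' k | Inr (k, l, u) \<Rightarrow> \<iota>' k)"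
proof -
  interpret category C by fact
  let ?J = "subdiv_cat K R" and ?G = "subdiv_fun C K X R"
  have R: "k \<in> K" "l \<in> K" "u \<in> Hom C (X k) (X l)" if "(k, l, u) \<in> R" for k l u
    using D that unfolding gdiagram_def by auto
  have O: "k \<in> K \<Longrightarrow> OMap ?G (Inl k) = X k" for k
    by (simp add: subdiv_fun_def)
  { assume cc: "is_cocone ?J C ?G c \<iota>"
    have hom: "\<iota> (Inl k) \<in> Hom C (X k) c" if "k \<in> K" for k
    proof -
      have "Inl k \<in> Obj ?J" using that by simp
      then have "\<iota> (Inl k) \<in> Hom C (OMap ?G (Inl k)) c" using cc unfolding is_cocone_def by blast
      then show ?thesis using O[OF that] by simp
    qed
    have e: "\<iota> (Inr (k, l, u)) = \<iota> (Inl k)" "Comp C (\<iota> (Inl l)) u = \<iota> (Inr (k, l, u))" if r: "(k, l,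
        u) \<in> R" for k l u
    proof -
      have 1: "Inr ((k, l, u), False) \<in> Hom ?J (Inr (k, l, u)) (Inl k)"
        and 2: "Inr ((k, l, u), True) \<in> Hom ?J (Inr (k, l, u)) (Inl l)"
        using r by (auto simp: Hom_def subdiv_cat_def)
      have A: "AMap ?G (Inr ((k, l, u), b)) = (if b then u else Ident C (X k))" for b
        using r by (simp add: subdiv_fun_def subdiv_cat_def)
      have "Comp C (\<iota> (Inl k)) (AMap ?G (Inr ((k, l, u), False))) = \<iota> (Inr (k, l, u))"
        using cc 1 r R[OF r] unfolding is_cocone_def by simp
      then show "\<iota> (Inr (k, l, u)) = \<iota> (Inl k)" using A Comp_Ident[OF hom] R[OF r] by simp
      have "Comp C (\<iota> (Inl l)) (AMap ?G (Inr ((k, l, u), True))) = \<iota> (Inr (k, l, u))"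
        using cc 2 r R[OF r] unfolding is_cocone_def by simp
      then show "Comp C (\<iota> (Inl l)) u = \<iota> (Inr (k, l, u))" using A by simp
    qed
    show "gcocone C K X R c (\<lambda>k. \<iota> (Inl k))"
      unfolding gcocone_def using cc hom e by (auto simp: is_cocone_def)
    show "(k, l, u) \<in> R \<Longrightarrow> \<iota> (Inr (k, l, u)) = \<iota> (Inl k)" using e by blast
  }
  assume cc: "gcocone C K X R c \<iota>'"
  show "is_cocone ?J C ?G c (\<lambda>x. case x of Inl k \<Rightarrow> \<iota>' k | Inr (k, l, u) \<Rightarrow> \<iota>' k)"
    unfolding is_cocone_def using gcoconeD[OF cc] R Comp_Ident[OF gcoconeD(2)[OF cc]]
    by (auto simp: subdiv_fun_def subdiv_cat_def Hom_def[of "\<lparr>Obj = _, Arr = _, Dom = _, Cod = _,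
        Ident = _, Comp = _\<rparr>"]
        intro: Comp_Ident split: if_splits)
qed

lemma gcolimit_subdiv:
  assumes C: "category C" and D: "gdiagram C K X R"
    and L: "is_colimit (subdiv_cat K R) C (subdiv_fun C K X R) c \<iota>"
  shows "gcolimit C K X R c (\<lambda>k. \<iota> (Inl k))"
proof -
  let ?J = "subdiv_cat K R"
  have cc: "is_cocone ?J C (subdiv_fun C K X R) c \<iota>" using L unfolding is_colimit_def by blast
  show ?thesis
    unfolding gcolimit_def
  proof (intro conjI allI impI)
    show "gcocone C K X R c (\<lambda>k. \<iota> (Inl k))" using gcocone_subdiv(1)[OF C D cc] .
    fix c' \<iota>' assume "gcocone C K X R c' \<iota>'"
    from gcocone_subdiv(3)[OF C D this]
    have ex: "\<exists>!h. h \<in> Hom C c c' \<and>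
      (\<forall>x\<in>Obj ?J. Comp C h (\<iota> x) = (case x of Inl k \<Rightarrow> \<iota>' k | Inr (k, l, u) \<Rightarrow> \<iota>' k))"
      using L unfolding is_colimit_def by blast
    \<comment> \<open>The legs at edge objects repeat legs at vertices, so they put no further
      condition on a factoring arrow.\<close>
    have "(\<forall>x\<in>Obj ?J. Comp C h (\<iota> x) = (case x of Inl k \<Rightarrow> \<iota>' k | Inr (k, l, u) \<Rightarrow> \<iota>' k)) \<longleftrightarrow>
      (\<forall>k\<in>K. Comp C h (\<iota> (Inl k)) = \<iota>' k)" (is "?A \<longleftrightarrow> ?B") for h
    proof
      show "?A \<Longrightarrow> ?B" by fastforce
      assume B: ?B
      show ?A
      proof
        fix x assume x: "x \<in> Obj ?J"
        show "Comp C h (\<iota> x) = (case x of Inl k \<Rightarrow> \<iota>' k | Inr (k, l, u) \<Rightarrow> \<iota>' k)"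
        proof (cases x)
          case (Inl k)
          then show ?thesis using B x by simp
        next
          case (Inr e)
          obtain k l u where e: "e = (k, l, u)" by (cases e)
          then have r: "(k, l, u) \<in> R" using x Inr by simp
          then have "k \<in> K" using gdiagram_edge_subset[OF D] by blast
          then show ?thesis using B gcocone_subdiv(2)[OF C D cc r] Inr e by simp
        qed
      qed
    qed
    with ex show "\<exists>!h. h \<in> Hom C c c' \<and> (\<forall>k\<in>K. Comp C h (\<iota> (Inl k)) = \<iota>' k)" by simp
  qed
qed

lemma small_category_transport:
  assumes "category J" "inj_on \<phi> (Obj J)" "inj_on \<psi> (Arr J)" "small U (Obj J)" "small U (Arr J)"
  shows "small_category U (transport_cat \<phi> \<psi> J)"
  unfolding small_category_def
  using category_transport[OF assms(1-3)] transport_cat_simps(1,2)[OF assms(1-3)] assms(4,5)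
  by (simp add: small_image)

text \<open>Subdivision turns the graph into a small category, and transport moves that category to
  the type \<open>'u\<close> to which \<open>cocomplete\<close> applies; neither changes the
  cocones.\<close>

lemma cocomplete_gcolimit:
  assumes U: "inaccessible U" and C: "category C" and co: "cocomplete U C"
    and D: "gdiagram C K X R" and K: "small U K" and R: "small U R"
  obtains c \<iota> where "gcolimit C K X R c \<iota>"
proof -
  let ?J = "subdiv_cat K R"
  have O: "small U (Obj ?J)" "small U (Arr ?J)"
    using K R small_finite[OF U finite_UNIV] unfolding subdiv_cat_def
    by (auto intro!: small_Un small_image small_Times U)
  obtain \<phi> where \<phi>: "inj_on \<phi> (Obj ?J)" "\<phi> ` Obj ?J \<subseteq> U" by (rule small_bij_into[OF O(1)])
  obtain \<psi> where \<psi>: "inj_on \<psi> (Arr ?J)" "\<psi> ` Arr ?J \<subseteq> U" by (rule small_bij_into[OF O(2)])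
  have J: "category ?J" using gdiagram_edge_subset[OF D] by (rule category_subdiv)
  have G: "is_functor ?J C (subdiv_fun C K X R)" using C D by (rule is_functor_subdiv)
  have "\<exists>c \<iota>. is_colimit (transport_cat \<phi> \<psi> ?J) C (transport_fun \<phi> \<psi> ?J (subdiv_fun C K X R)) c \<iota>"
    using co small_category_transport[OF J \<phi>(1) \<psi>(1) O] is_functor_transport[OF J \<phi>(1) \<psi>(1) G]
    unfolding cocomplete_def by blast
  then obtain c \<iota> where "is_colimit ?J C (subdiv_fun C K X R) c (\<iota> \<circ> \<phi>)"
    unfolding is_colimit_transport[OF J \<phi>(1) \<psi>(1) G] by blast
  then show thesis using that gcolimit_subdiv[OF C D] by blast
qed

section \<open>Directed posets\<close>

lemma directed_posetD:
  assumes "directed_poset U \<kappa> J"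
  shows "category J" "small U (Obj J)" "small U (Arr J)"
    "f \<in> Hom J i j \<Longrightarrow> g \<in> Hom J i j \<Longrightarrow> f = g"
    "S \<subseteq> Obj J \<Longrightarrow> |S| <o \<kappa> \<Longrightarrow> \<exists>u\<in>Obj J. \<forall>s\<in>S. Hom J s u \<noteq> {}"
  using assms unfolding directed_poset_def small_category_def by blast+

lemma directed_poset_two:
  assumes J: "directed_poset U \<kappa> J" and \<kappa>: "Cinfinite \<kappa>" and "i \<in> Obj J" "j \<in> Obj J"
  obtains k u v where "k \<in> Obj J" "u \<in> Hom J i k" "v \<in> Hom J j k"
proof -
  have "\<exists>u\<in>Obj J. \<forall>s\<in>{i, j}. Hom J s u \<noteq> {}"
    using assms by (intro directed_posetD(5)[OF J] ordLess_finite) auto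
  then show thesis using that by blast
qed

lemma directed_poset_mono:
  assumes "directed_poset U \<mu> J" "\<kappa> \<le>o \<mu>"
  shows "directed_poset U \<kappa> J"
  using assms ordLess_ordLeq_trans[of _ \<kappa> \<mu>] unfolding directed_poset_def by meson

text \<open>A larger index leaves fewer directed posets to test, since sets of fewer than \<kappa>
  elements also have fewer than \<mu>.\<close>

lemma preserves_directed_colimits_mono:
  assumes "preserves_directed_colimits U \<kappa> C D F" "\<kappa> \<le>o \<mu>"
  shows "preserves_directed_colimits U \<mu> C D F"
  using assms directed_poset_mono[of U \<mu> _ \<kappa>] unfolding preserves_directed_colimits_def by meson

section \<open>Presentable objects\<close>

lemma set_cat_simps [simp]:
  "Obj (set_cat U) = {X. small U X}"
  "Comp (set_cat U) (Y, Z, g) (X, Y', f) = (X, Z, compose X g f)"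
  by (simp_all add: set_cat_def)

lemma Hom_set_cat:
  assumes "small U X" "small U Y"
  shows "Hom (set_cat U) X Y = {(X, Y, f) | f. f \<in> X \<rightarrow>\<^sub>E Y}"
  using assms by (auto simp: Hom_def set_cat_def)

definition hom_map :: "('o, 'm, 'z) cat_scheme \<Rightarrow> 'o \<Rightarrow> 'o \<Rightarrow> 'm \<Rightarrow> 'm + 'u \<Rightarrow> 'm + 'u" where
  "hom_map C a x f = (\<lambda>g\<in>Inl ` Hom C a x. Inl (Comp C f (projl g)))"

context category
begin

lemma hom_fun_simps:
  "x \<in> Obj C \<Longrightarrow> OMap (hom_fun C a) x = Inl ` Hom C a x"
  "f \<in> Hom C x y \<Longrightarrow> AMap (hom_fun C a) f = (Inl ` Hom C a x, Inl ` Hom C a y, hom_map C a x f)"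
  by (auto simp: hom_fun_def hom_map_def Hom_def)

lemma hom_map_simps:
  "g \<in> Hom C a x \<Longrightarrow> hom_map C a x f (Inl g) = Inl (Comp C f g)"
  by (simp add: hom_map_def)

lemma hom_map_PiE:
  "f \<in> Hom C x y \<Longrightarrow> hom_map C a x f \<in> Inl ` Hom C a x \<rightarrow>\<^sub>E Inl ` Hom C a y"
  by (auto simp: hom_map_def intro: Comp_Hom)

text \<open>
  The two halves of the bijectivity of the canonical map from the colimit of \<open>Hom a (G j)\<close> to
  \<open>Hom a c\<close>.
\<close>

definition ess_factors ::
  "'o \<Rightarrow> ('i, 'k, 'y) cat_scheme \<Rightarrow> ('i, 'k, 'o, 'm) cfun \<Rightarrow> 'o \<Rightarrow> ('i \<Rightarrow> 'm) \<Rightarrow> bool" where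
  "ess_factors a J G c \<iota> \<longleftrightarrow>
    (\<forall>f\<in>Hom C a c. \<exists>j\<in>Obj J. \<exists>g\<in>Hom C a (OMap G j). f = Comp C (\<iota> j) g) \<and>
    (\<forall>j\<in>Obj J. \<forall>g\<in>Hom C a (OMap G j). \<forall>g'\<in>Hom C a (OMap G j).
      Comp C (\<iota> j) g = Comp C (\<iota> j) g' \<longrightarrow>
      (\<exists>k\<in>Obj J. \<exists>u\<in>Hom J j k. Comp C (AMap G u) g = Comp C (AMap G u) g'))"

lemma ess_factorsD1:
  assumes "ess_factors a J G c \<iota>" "f \<in> Hom C a c"
  obtains j g where "j \<in> Obj J" "g \<in> Hom C a (OMap G j)" "f = Comp C (\<iota> j) g"
  using assms unfolding ess_factors_def by blast

lemma ess_factorsD2: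
  assumes "ess_factors a J G c \<iota>" "j \<in> Obj J" "g \<in> Hom C a (OMap G j)" "g' \<in> Hom C a (OMap G j)"
    "Comp C (\<iota> j) g = Comp C (\<iota> j) g'"
  obtains k u where "k \<in> Obj J" "u \<in> Hom J j k" "Comp C (AMap G u) g = Comp C (AMap G u) g'"
  using assms unfolding ess_factors_def by blast

text \<open>Extends the uniqueness clause to arrows at different stages: pushed to a common upper
  bound they still agree after the leg, so they become equal at a later stage.\<close>

lemma ess_factors_two:
  assumes ef: "ess_factors a J G c \<iota>" and G: "is_functor J C G" and cc: "is_cocone J C G c \<iota>"
    and J: "directed_poset U \<kappa> J" and \<kappa>: "Cinfinite \<kappa>"
    and i: "i \<in> Obj J" "g \<in> Hom C a (OMap G i)" and j: "j \<in> Obj J" "g' \<in> Hom C a (OMap G j)"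
    and eq: "Comp C (\<iota> i) g = Comp C (\<iota> j) g'"
  obtains k u v where "k \<in> Obj J" "u \<in> Hom J i k" "v \<in> Hom J j k"
    "Comp C (AMap G u) g = Comp C (AMap G v) g'"
proof -
  interpret G: is_functor J C G by fact
  obtain k u v where k: "k \<in> Obj J" "u \<in> Hom J i k" "v \<in> Hom J j k"
    by (rule directed_poset_two[OF J \<kappa> i(1) j(1)])
  have \<iota>: "\<iota> k \<in> Hom C (OMap G k) c" using cc k unfolding is_cocone_def by blast
  have c: "Comp C (\<iota> k) (AMap G u) = \<iota> i" "Comp C (\<iota> k) (AMap G v) = \<iota> j"
    using cc k i(1) j(1) unfolding is_cocone_def by blast+
  note u = G.AMap_Hom[OF k(2)] and v = G.AMap_Hom[OF k(3)]
  have "Comp C (\<iota> k) (Comp C (AMap G u) g) = Comp C (\<iota> k) (Comp C (AMap G v) g')"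
    using Comp_assoc[OF i(2) u \<iota>] Comp_assoc[OF j(2) v \<iota>] c eq by simp
  then obtain l w where l: "l \<in> Obj J" "w \<in> Hom J k l"
    "Comp C (AMap G w) (Comp C (AMap G u) g) = Comp C (AMap G w) (Comp C (AMap G v) g')"
    by (rule ess_factorsD2[OF ef k(1) Comp_Hom[OF i(2) u] Comp_Hom[OF j(2) v]])
  note w = G.AMap_Hom[OF l(2)]
  have "Comp C (AMap G (Comp J w u)) g = Comp C (AMap G (Comp J w v)) g'"
    using l(3) Comp_assoc[OF i(2) u w] Comp_assoc[OF j(2) v w] G.AMap_Comp[OF k(2) l(2)]
        G.AMap_Comp[OF k(3) l(2)]
    by simp
  then show thesis using that[OF l(1)] G.dom.Comp_Hom k l by blast
qed

end

section \<open>Hom-functors and colimits of small sets\<close>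

lemma is_cocone_hom_fun:
  fixes U :: "'u set" and C :: "('o, 'm, 'z) cat_scheme"
  assumes ls: "locally_small U C" and G: "is_functor J C G" and cc: "is_cocone J C G c \<iota>"
    and a: "a \<in> Obj C"
  shows "is_cocone J (set_cat U) (cfun_comp J (hom_fun C a) G) (OMap (hom_fun C a) c)
      (\<lambda>j. AMap (hom_fun C a) (\<iota> j) :: ('m + 'u) set \<times> _)"
proof -
  interpret G: is_functor J C G by fact
  have c: "c \<in> Obj C" using cc unfolding is_cocone_def by blast
  have \<iota>: "\<iota> j \<in> Hom C (OMap G j) c" if "j \<in> Obj J" for j using cc that unfolding is_cocone_def by blast
  have s: "small U (Inl ` Hom C a x)" if "x \<in> Obj C" for x
    using ls a that unfolding locally_small_def by (intro small_image) blast
  let ?h = "hom_fun C a :: (_, _, ('m + 'u) set, _) cfun"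
  show ?thesis
    unfolding is_cocone_def
  proof (intro conjI ballI)
    show "OMap ?h c \<in> Obj (set_cat U)" using s[OF c] by (simp add: G.cod.hom_fun_simps c)
    show "AMap ?h (\<iota> j) \<in> Hom (set_cat U) (OMap (cfun_comp J ?h G) j) (OMap ?h c)"
      if j: "j \<in> Obj J" for j
      by (simp add: j c G.OMap_Obj Hom_set_cat s G.cod.hom_map_PiE[OF \<iota>[OF j]] G.cod.hom_fun_simps(1)
          G.cod.hom_fun_simps(2)[OF \<iota>[OF j]])
    fix i j u assume i: "i \<in> Obj J" and j: "j \<in> Obj J" and u: "u \<in> Hom J i j"
    note Gu = G.AMap_Hom[OF u]
    have e: "Comp C (\<iota> j) (AMap G u) = \<iota> i" using cc i j u unfolding is_cocone_def by blast
    have "compose (Inl ` Hom C a (OMap G i)) (hom_map C a (OMap G j) (\<iota> j)) (hom_map C a (OMap G i)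
        (AMap G u))
      = (hom_map C a (OMap G i) (\<iota> i) :: 'm + 'u \<Rightarrow> _)"
    proof (rule extensionalityI)
      fix y :: "'m + 'u" assume "y \<in> Inl ` Hom C a (OMap G i)"
      then obtain g where g: "y = Inl g" "g \<in> Hom C a (OMap G i)" by blast
      show "compose (Inl ` Hom C a (OMap G i)) (hom_map C a (OMap G j) (\<iota> j)) (hom_map C a (OMap G i)
          (AMap G u)) y
        = hom_map C a (OMap G i) (\<iota> i) y"
        using g G.cod.Comp_assoc[OF g(2) Gu \<iota>[OF j]] e
        by (simp add: compose_def G.cod.hom_map_simps G.cod.Comp_Hom[OF g(2) Gu])
    qed (simp_all add: hom_map_def)
    then show "Comp (set_cat U) (AMap ?h (\<iota> j)) (AMap (cfun_comp J ?h G) u) =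
      AMap ?h (\<iota> i)"
      by (simp add: G.dom.HomD(1)[OF u] G.cod.hom_fun_simps(2)[OF \<iota>[OF i]] G.cod.hom_fun_simps(2)[OF
          \<iota>[OF j]]
        G.cod.hom_fun_simps(2)[OF Gu])
  qed
qed

text \<open>Given a cocone of sets, the value at \<open>f\<close> has to be read off at a stage
  through which \<open>f\<close> factors. Existence of a factorization makes this total and forces
  uniqueness; \<open>ess_factors_two\<close> makes it well defined.\<close>

lemma ess_factors_imp_is_colimit:
  fixes U :: "'u set" and C :: "('o, 'm, 'z) cat_scheme"
  assumes ls: "locally_small U C" and G: "is_functor J C G" and cc: "is_cocone J C G c \<iota>"
    and a: "a \<in> Obj C" and J: "directed_poset U \<kappa> J" and \<kappa>: "Cinfinite \<kappa>"
    and ef: "category.ess_factors C a J G c \<iota>"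
  shows "is_colimit J (set_cat U) (cfun_comp J (hom_fun C a) G) (OMap (hom_fun C a) c)
      (\<lambda>j. AMap (hom_fun C a) (\<iota> j) :: ('m + 'u) set \<times> _)"
proof -
  interpret G: is_functor J C G by fact
  have c: "c \<in> Obj C" using cc unfolding is_cocone_def by blast
  have \<iota>: "\<iota> j \<in> Hom C (OMap G j) c" if "j \<in> Obj J" for j using cc that unfolding is_cocone_def by blast
  have s: "small U (Inl ` Hom C a x)" if "x \<in> Obj C" for x
    using ls a that unfolding locally_small_def by (intro small_image) blast
  let ?H = "\<lambda>x. Inl ` Hom C a x :: ('m + 'u) set"
  show ?thesis
    unfolding is_colimit_def
  proof (intro conjI allI impI)
    show "is_cocone J (set_cat U) (cfun_comp J (hom_fun C a) G) (OMap (hom_fun C a) c)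
      (\<lambda>j. AMap (hom_fun C a) (\<iota> j) :: ('m + 'u) set \<times> _)" using ls G cc a by (rule is_cocone_hom_fun)
    fix X :: "('m + 'u) set" and \<tau>
    assume \<tau>: "is_cocone J (set_cat U) (cfun_comp J (hom_fun C a) G) X \<tau>"
    have X: "small U X" using \<tau> unfolding is_cocone_def by simp
    have "\<exists>f. \<tau> j = (?H (OMap G j), X, f) \<and> f \<in> ?H (OMap G j) \<rightarrow>\<^sub>E X" if j: "j \<in> Obj J" for j
    proof -
      have "\<tau> j \<in> Hom (set_cat U) (?H (OMap G j)) X"
        using \<tau> j unfolding is_cocone_def by (simp add: G.cod.hom_fun_simps G.OMap_Obj)
      then show ?thesis using Hom_set_cat[OF s[OF G.OMap_Obj[OF j]] X] by blast
    qed
    then obtain t where t: "\<And>j. j \<in> Obj J \<Longrightarrow> \<tau> j = (?H (OMap G j), X, t j)"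
      "\<And>j. j \<in> Obj J \<Longrightarrow> t j \<in> ?H (OMap G j) \<rightarrow>\<^sub>E X" by metis
    have tG: "t j (Inl (Comp C (AMap G u) g)) = t i (Inl g)"
      if i: "i \<in> Obj J" and j: "j \<in> Obj J" and u: "u \<in> Hom J i j" and g: "g \<in> Hom C a (OMap G i)" for
          i j u g
    proof -
      note Gu = G.AMap_Hom[OF u]
      have "Comp (set_cat U) (\<tau> j) (AMap (cfun_comp J (hom_fun C a) G) u) = \<tau> i"
        using \<tau> i j u unfolding is_cocone_def by blast
      then have "compose (?H (OMap G i)) (t j) (hom_map C a (OMap G i) (AMap G u)) = t i"
        using t(1)[OF i] t(1)[OF j] by (simp add: G.dom.HomD(1)[OF u] G.cod.hom_fun_simps(2)[OF Gu])
      then show ?thesis using g G.cod.hom_map_simps[OF g]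
        by (metis (no_types, lifting) compose_eq imageI)
    qed
    have wd: "t i (Inl g) = t j (Inl g')"
      if i: "i \<in> Obj J" "g \<in> Hom C a (OMap G i)" and j: "j \<in> Obj J" "g' \<in> Hom C a (OMap G j)"
        and eq: "Comp C (\<iota> i) g = Comp C (\<iota> j) g'" for i j g g'
    proof -
      obtain k u v where k: "k \<in> Obj J" "u \<in> Hom J i k" "v \<in> Hom J j k"
        "Comp C (AMap G u) g = Comp C (AMap G v) g'"
        by (rule G.cod.ess_factors_two[OF ef G cc J \<kappa> i j eq])
      then show ?thesis using tG[OF i(1) k(1,2) i(2)] tG[OF j(1) k(1,3) j(2)] by simp
    qed
    \<comment> \<open>For an \<open>f\<close> without factorization any value will do, so that
      \<open>h\<close> can be chosen for all \<open>f\<close> at once; on \<open>Hom C a c\<close> a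
      factorization always exists.\<close>
    have "\<exists>x. \<forall>j\<in>Obj J. \<forall>g\<in>Hom C a (OMap G j). f = Comp C (\<iota> j) g \<longrightarrow> t j (Inl g) = x" for f
      using wd by metis
    then obtain h where h: "\<And>f j g. j \<in> Obj J \<Longrightarrow> g \<in> Hom C a (OMap G j) \<Longrightarrow> f = Comp C (\<iota> j) g \<Longrightarrow> t j (Inl
        g) = h f"
      by metis
    let ?h = "\<lambda>y\<in>?H c. h (projl y)"
    have hX: "?h \<in> ?H c \<rightarrow>\<^sub>E X"
    proof
      fix y assume "y \<in> ?H c"
      then obtain f where f: "y = Inl f" "f \<in> Hom C a c" by blast
      obtain j g where jg: "j \<in> Obj J" "g \<in> Hom C a (OMap G j)" "f = Comp C (\<iota> j) g"
        by (rule G.cod.ess_factorsD1[OF ef f(2)])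
      then have "h f \<in> X" using h[OF jg] PiE_mem[OF t(2)[OF jg(1)], of "Inl g"] jg(2) by auto
      then show "?h y \<in> X" using f by simp
    qed auto
    have key: "compose (?H (OMap G j)) k (hom_map C a (OMap G j) (\<iota> j)) = t j \<longleftrightarrow>
      (\<forall>g\<in>Hom C a (OMap G j). k (Inl (Comp C (\<iota> j) g)) = t j (Inl g))" (is "?l \<longleftrightarrow> ?r") if j: "j \<in> Obj
          J" for j k
    proof
      assume ?l
      then show ?r using G.cod.hom_map_simps by (metis (no_types, lifting) compose_eq imageI)
    next
      assume r: ?r
      show ?l
      proof (rule extensionalityI[of _ "?H (OMap G j)"])
        show "t j \<in> extensional (?H (OMap G j))" using t(2)[OF j] by (auto simp: PiE_def)
        fix y assume "y \<in> ?H (OMap G j)"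
        then show "compose (?H (OMap G j)) k (hom_map C a (OMap G j) (\<iota> j)) y = t j y"
          using r by (auto simp: compose_eq G.cod.hom_map_simps)
      qed simp
    qed
    show "\<exists>!k. k \<in> Hom (set_cat U) (OMap (hom_fun C a) c) X \<and>
      (\<forall>j\<in>Obj J. Comp (set_cat U) k (AMap (hom_fun C a) (\<iota> j)) = \<tau> j)"
    proof (rule ex1I)
      show "(?H c, X, ?h) \<in> Hom (set_cat U) (OMap (hom_fun C a) c) X \<and>
        (\<forall>j\<in>Obj J. Comp (set_cat U) (?H c, X, ?h) (AMap (hom_fun C a) (\<iota> j)) = \<tau> j)"
      proof (intro conjI ballI)
        show "(?H c, X, ?h) \<in> Hom (set_cat U) (OMap (hom_fun C a) c) X"
          using hX by (simp add: G.cod.hom_fun_simps c Hom_set_cat[OF s[OF c] X])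
        fix j assume j: "j \<in> Obj J"
        have "\<forall>g\<in>Hom C a (OMap G j). ?h (Inl (Comp C (\<iota> j) g)) = t j (Inl g)"
          using h[OF j] G.cod.Comp_Hom[OF _ \<iota>[OF j]] by auto
        then show "Comp (set_cat U) (?H c, X, ?h) (AMap (hom_fun C a) (\<iota> j)) = \<tau> j"
          using key[OF j] by (simp add: G.cod.hom_fun_simps(2)[OF \<iota>[OF j]] t(1)[OF j])
      qed
    next
      fix k assume k: "k \<in> Hom (set_cat U) (OMap (hom_fun C a) c) X \<and>
        (\<forall>j\<in>Obj J. Comp (set_cat U) k (AMap (hom_fun C a) (\<iota> j)) = \<tau> j)"
      then obtain k' where k': "k = (?H c, X, k')" "k' \<in> ?H c \<rightarrow>\<^sub>E X"
        using Hom_set_cat[OF s[OF c] X] by (auto simp: G.cod.hom_fun_simps c)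
      have k'': "k' (Inl (Comp C (\<iota> j) g)) = t j (Inl g)" if j: "j \<in> Obj J" "g \<in> Hom C a (OMap G j)"
          for j g
      proof -
        have "Comp (set_cat U) k (AMap (hom_fun C a) (\<iota> j)) = \<tau> j" using k j by blast
        then have "compose (?H (OMap G j)) k' (hom_map C a (OMap G j) (\<iota> j)) = t j"
          by (simp add: k' G.cod.hom_fun_simps(2)[OF \<iota>[OF j(1)]] t(1)[OF j(1)])
        then show ?thesis using key[OF j(1)] j(2) by blast
      qed
      have "k' = ?h"
      proof (rule PiE_ext[OF k'(2) hX])
        fix y assume "y \<in> ?H c"
        then obtain f where f: "y = Inl f" "f \<in> Hom C a c" by blast
        obtain j g where jg: "j \<in> Obj J" "g \<in> Hom C a (OMap G j)" "f = Comp C (\<iota> j) g"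
          by (rule G.cod.ess_factorsD1[OF ef f(2)])
        then show "k' y = ?h y" using k''[OF jg(1,2)] h[OF jg] f by simp
      qed
      then show "k = (?H c, X, ?h)" using k' by simp
    qed
  qed
qed

text \<open>Testing the universal property against a two-element set suffices. Maps into it are
  predicates: one predicate detects arrows that factor through a stage, another detects eventual
  equality with a given arrow.\<close>

lemma is_colimit_imp_ess_factors:
  fixes U :: "'u set" and C :: "('o, 'm, 'z) cat_scheme"
  assumes U: "inaccessible U"
    and ls: "locally_small U C" and G: "is_functor J C G" and cc: "is_cocone J C G c \<iota>"
    and a: "a \<in> Obj C" and J: "directed_poset U \<kappa> J" and \<kappa>: "Cinfinite \<kappa>"
    and col: "is_colimit J (set_cat U) (cfun_comp J (hom_fun C a) G) (OMap (hom_fun C a) c)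
      (\<lambda>j. AMap (hom_fun C a) (\<iota> j) :: ('m + 'u) set \<times> _)"
  shows "category.ess_factors C a J G c \<iota>"
proof -
  interpret G: is_functor J C G by fact
  have c: "c \<in> Obj C" using cc unfolding is_cocone_def by blast
  have \<iota>: "\<iota> j \<in> Hom C (OMap G j) c" if "j \<in> Obj J" for j using cc that unfolding is_cocone_def by blast
  have s: "small U (Inl ` Hom C a x)" if "x \<in> Obj C" for x
    using ls a that unfolding locally_small_def by (intro small_image) blast
  let ?H = "\<lambda>x. Inl ` Hom C a x :: ('m + 'u) set"
  obtain p q where pq: "p \<in> U" "q \<in> U" "p \<noteq> q" by (rule inaccessible_two[OF U])
  let ?B = "{Inr p, Inr q} :: ('m + 'u) set"
  have B: "small U ?B" by (rule small_finite[OF U]) simp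
  let ?val = "\<lambda>b. if b then Inr p else Inr q :: 'm + 'u"
  \<comment> \<open>A family of predicates invariant under the transition maps is a cocone into
    \<open>?B\<close>, and so comes from exactly one predicate on \<open>Hom C a c\<close>.\<close>
  have ex1: "\<exists>!k. k \<in> Hom (set_cat U) (?H c) ?B \<and>
      (\<forall>j\<in>Obj J. Comp (set_cat U) k (AMap (hom_fun C a) (\<iota> j)) = (?H (OMap G j), ?B, \<lambda>y\<in>?H (OMap G j).
          ?val (P j (projl y))))"
    if P: "\<And>i j u g. i \<in> Obj J \<Longrightarrow> j \<in> Obj J \<Longrightarrow> u \<in> Hom J i j \<Longrightarrow> g \<in> Hom C a (OMap G i) \<Longrightarrow>
        P j (Comp C (AMap G u) g) \<longleftrightarrow> P i g" for P
  proof -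
    let ?\<tau> = "\<lambda>j. (?H (OMap G j), ?B, \<lambda>y\<in>?H (OMap G j). ?val (P j (projl y)))"
    have "is_cocone J (set_cat U) (cfun_comp J (hom_fun C a) G) ?B ?\<tau>"
      unfolding is_cocone_def
    proof (intro conjI ballI)
      show "?B \<in> Obj (set_cat U)" using B by simp
      show "?\<tau> j \<in> Hom (set_cat U) (OMap (cfun_comp J (hom_fun C a) G) j) ?B" if j: "j \<in> Obj J" for j
        using j by (auto simp: G.cod.hom_fun_simps(1) G.OMap_Obj Hom_set_cat[OF s[OF G.OMap_Obj[OF j]]
            B])
      fix i j u assume i: "i \<in> Obj J" and j: "j \<in> Obj J" and u: "u \<in> Hom J i j"
      note Gu = G.AMap_Hom[OF u]
      have "compose (?H (OMap G i)) (\<lambda>y\<in>?H (OMap G j). ?val (P j (projl y))) (hom_map C a (OMap G i)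
          (AMap G u))
        = (\<lambda>y\<in>?H (OMap G i). ?val (P i (projl y)))"
      proof (rule extensionalityI[of _ "?H (OMap G i)"])
        fix y assume "y \<in> ?H (OMap G i)"
        then obtain g where g: "y = Inl g" "g \<in> Hom C a (OMap G i)" by blast
        show "compose (?H (OMap G i)) (\<lambda>y\<in>?H (OMap G j). ?val (P j (projl y))) (hom_map C a (OMap G i)
            (AMap G u)) y
          = (\<lambda>y\<in>?H (OMap G i). ?val (P i (projl y))) y"
          using g P[OF i j u g(2)] G.cod.Comp_Hom[OF g(2) Gu] by (simp add: compose_eq
              G.cod.hom_map_simps)
      qed simp_all
      then show "Comp (set_cat U) (?\<tau> j) (AMap (cfun_comp J (hom_fun C a) G) u) = ?\<tau> i"
        by (simp add: G.dom.HomD(1)[OF u] G.cod.hom_fun_simps(2)[OF Gu])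
    qed
    then show ?thesis using col unfolding is_colimit_def by (simp add: G.cod.hom_fun_simps(1) c)
  qed
  show ?thesis
    unfolding G.cod.ess_factors_def
  proof (intro conjI ballI impI)
    fix f assume f: "f \<in> Hom C a c"
    let ?S = "\<lambda>f. \<exists>j\<in>Obj J. \<exists>g\<in>Hom C a (OMap G j). f = Comp C (\<iota> j) g"
    let ?k = "\<lambda>Q. (?H c, ?B, \<lambda>y\<in>?H c. ?val (Q (projl y)))"
    have k: "?k Q \<in> Hom (set_cat U) (?H c) ?B \<and>
      (\<forall>j\<in>Obj J. Comp (set_cat U) (?k Q) (AMap (hom_fun C a) (\<iota> j)) = (?H (OMap G j), ?B, \<lambda>y\<in>?H (OMap
          G j). ?val True))"
      if Q: "\<And>f. ?S f \<Longrightarrow> Q f" for Q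
    proof (intro conjI ballI)
      show "?k Q \<in> Hom (set_cat U) (?H c) ?B" by (auto simp: Hom_set_cat[OF s[OF c] B])
      fix j assume j: "j \<in> Obj J"
      have "compose (?H (OMap G j)) (\<lambda>y\<in>?H c. ?val (Q (projl y))) (hom_map C a (OMap G j) (\<iota> j))
        = (\<lambda>y\<in>?H (OMap G j). ?val True)"
      proof (rule extensionalityI[of _ "?H (OMap G j)"])
        fix y assume "y \<in> ?H (OMap G j)"
        then obtain g where g: "y = Inl g" "g \<in> Hom C a (OMap G j)" by blast
        moreover have "Q (Comp C (\<iota> j) g)" using Q j g by blast
        ultimately show "compose (?H (OMap G j)) (\<lambda>y\<in>?H c. ?val (Q (projl y))) (hom_map C a (OMap G j)
            (\<iota> j)) y
          = (\<lambda>y\<in>?H (OMap G j). ?val True) y"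
          using G.cod.Comp_Hom[OF g(2) \<iota>[OF j]] by (simp add: compose_eq G.cod.hom_map_simps)
      qed simp_all
      then show "Comp (set_cat U) (?k Q) (AMap (hom_fun C a) (\<iota> j)) = (?H (OMap G j), ?B, \<lambda>y\<in>?H (OMap
          G j). ?val True)"
        by (simp add: G.cod.hom_fun_simps(2)[OF \<iota>[OF j]])
    qed
    \<comment> \<open>Being of the form \<open>Comp C (\<iota> j) g\<close> and being true cannot be
      told apart on the legs. Uniqueness makes the two predicates equal, so every arrow into
      \<open>c\<close> factors.\<close>
    have "?k ?S = ?k (\<lambda>_. True)" using ex1[of "\<lambda>_ _. True"] k[of ?S] k[of "\<lambda>_. True"] by blast
    then have "(\<lambda>y\<in>?H c. ?val (?S (projl y))) (Inl f) = (\<lambda>y\<in>?H c. ?val True) (Inl f)"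
      by (metis (no_types, lifting) Pair_inject)
    then show "?S f" using f pq(3) by (auto split: if_splits)
  next
    fix j g g' assume j: "j \<in> Obj J" and g: "g \<in> Hom C a (OMap G j)" and g': "g' \<in> Hom C a (OMap G j)"
      and eq: "Comp C (\<iota> j) g = Comp C (\<iota> j) g'"
    \<comment> \<open>\<open>?P k h\<close> says that \<open>h\<close>, given at stage
      \<open>k\<close>, eventually agrees with \<open>g\<close>. It holds for \<open>g\<close>
      itself; as its value depends only on the image in the colimit, it must hold for
      \<open>g'\<close> as well.\<close>
    let ?P = "\<lambda>k h. \<exists>l\<in>Obj J. \<exists>u\<in>Hom J k l. \<exists>v\<in>Hom J j l. Comp C (AMap G u) h = Comp C (AMap G v) g"
    have P: "?P k (Comp C (AMap G w) h) \<longleftrightarrow> ?P i h"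
      if i: "i \<in> Obj J" and k: "k \<in> Obj J" and w: "w \<in> Hom J i k" and h: "h \<in> Hom C a (OMap G i)" for
          i k w h
    proof
      assume "?P k (Comp C (AMap G w) h)"
      then obtain l u v where l: "l \<in> Obj J" "u \<in> Hom J k l" "v \<in> Hom J j l"
        "Comp C (AMap G u) (Comp C (AMap G w) h) = Comp C (AMap G v) g" by blast
      then have "Comp C (AMap G (Comp J u w)) h = Comp C (AMap G v) g"
        using G.cod.Comp_assoc[OF h G.AMap_Hom[OF w] G.AMap_Hom[OF l(2)]] G.AMap_Comp[OF w l(2)] by simp
      then show "?P i h" using l(1,3) G.dom.Comp_Hom[OF w l(2)] by blast
    next
      assume "?P i h"
      then obtain l u v where l: "l \<in> Obj J" "u \<in> Hom J i l" "v \<in> Hom J j l"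
        "Comp C (AMap G u) h = Comp C (AMap G v) g" by blast
      \<comment> \<open>The stage \<open>l\<close> of agreement need not lie above \<open>k\<close>.
        At an upper bound of both, the two routes from \<open>i\<close> coincide because the shape
        is a poset.\<close>
      obtain m x y where m: "m \<in> Obj J" "x \<in> Hom J l m" "y \<in> Hom J k m"
        by (rule directed_poset_two[OF J \<kappa> l(1) k])
      have xy: "Comp J x u = Comp J y w"
        using directed_posetD(4)[OF J] G.dom.Comp_Hom[OF l(2) m(2)] G.dom.Comp_Hom[OF w m(3)] by blast
      have "Comp C (AMap G y) (Comp C (AMap G w) h) = Comp C (AMap G (Comp J y w)) h"
        using G.cod.Comp_assoc[OF h G.AMap_Hom[OF w] G.AMap_Hom[OF m(3)]] G.AMap_Comp[OF w m(3)] by simp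
      also have "\<dots> = Comp C (AMap G x) (Comp C (AMap G u) h)"
        using G.cod.Comp_assoc[OF h G.AMap_Hom[OF l(2)] G.AMap_Hom[OF m(2)]] G.AMap_Comp[OF l(2) m(2)]
            xy by simp
      also have "\<dots> = Comp C (AMap G (Comp J x v)) g"
        using G.cod.Comp_assoc[OF g G.AMap_Hom[OF l(3)] G.AMap_Hom[OF m(2)]] G.AMap_Comp[OF l(3) m(2)]
            l(4) by simp
      finally show "?P k (Comp C (AMap G w) h)" using m G.dom.Comp_Hom[OF l(3) m(2)] by blast
    qed
    from ex1[of ?P, OF P]
    obtain k where k: "k \<in> Hom (set_cat U) (?H c) ?B"
      "\<And>i. i \<in> Obj J \<Longrightarrow> Comp (set_cat U) k (AMap (hom_fun C a) (\<iota> i)) =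
        (?H (OMap G i), ?B, \<lambda>y\<in>?H (OMap G i). ?val (?P i (projl y)))" by blast
    obtain k' where k': "k = (?H c, ?B, k')"
      using k(1) Hom_set_cat[OF s[OF c] B] by blast
    have kk: "compose (?H (OMap G j)) k' (hom_map C a (OMap G j) (\<iota> j)) = (\<lambda>y\<in>?H (OMap G j). ?val (?P
        j (projl y)))"
      using k(2)[OF j] by (simp add: k' G.cod.hom_fun_simps(2)[OF \<iota>[OF j]])
    have kv: "k' (Inl (Comp C (\<iota> j) h)) = ?val (?P j h)" if h: "h \<in> Hom C a (OMap G j)" for h
      using fun_cong[OF kk, of "Inl h"] h by (simp add: compose_eq G.cod.hom_map_simps)
    have "?P j g" using G.dom.Ident_Hom[OF j] j by blast
    then have "?P j g'" using kv[OF g] kv[OF g'] eq pq(3) by (auto split: if_splits)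
    then obtain l u v where l: "l \<in> Obj J" "u \<in> Hom J j l" "v \<in> Hom J j l"
      "Comp C (AMap G u) g' = Comp C (AMap G v) g" by blast
    then have "u = v" using directed_posetD(4)[OF J] by blast
    then show "\<exists>k\<in>Obj J. \<exists>u\<in>Hom J j k. Comp C (AMap G u) g = Comp C (AMap G u) g'"
      using l by metis
  qed
qed

lemma presentable_iff:
  assumes U: "inaccessible U" and C: "category C" and ls: "locally_small U C" and \<kappa>: "Cinfinite \<kappa>"
  shows "presentable U \<kappa> C a \<longleftrightarrow> a \<in> Obj C \<and> (\<forall>J G c \<iota>. directed_poset U \<kappa> J \<and> is_functor J C G \<and>
    is_colimit J C G c \<iota> \<longrightarrow> category.ess_factors C a J G c \<iota>)"
proof -
  have "is_colimit J (set_cat U) (cfun_comp J (hom_fun C a) G) (OMap (hom_fun C a) c)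
      (\<lambda>j. AMap (hom_fun C a) (\<iota> j) :: (_ + 'a) set \<times> _) \<longleftrightarrow> category.ess_factors C a J G c \<iota>"
    if "a \<in> Obj C" "directed_poset U \<kappa> J" "is_functor J C G" "is_colimit J C G c \<iota>" for J G c \<iota>
  proof -
    have cc: "is_cocone J C G c \<iota>" using that(4) unfolding is_colimit_def by blast
    show ?thesis
      using ess_factors_imp_is_colimit[OF ls that(3) cc that(1,2) \<kappa>]
        is_colimit_imp_ess_factors[OF U ls that(3) cc that(1,2) \<kappa>] by blast
  qed
  then show ?thesis unfolding presentable_def preserves_directed_colimits_def by meson
qed

text \<open>Colimits of fewer than \<mu> vertices and edges interact well with \<mu>-directed ones:
  the factorizations at the vertices, and the equations along the edges, can each be collected at a
  single stage.\<close>

lemma ess_factors_gcolimit: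
  assumes C: "category C" and b: "gcolimit C K X R b \<beta>" and D: "gdiagram C K X R"
    and K: "|K| <o \<mu>" and R: "|R| <o \<mu>" and \<mu>: "Cinfinite \<mu>"
    and J: "directed_poset U \<mu> J" and G: "is_functor J C G" and cc: "is_cocone J C G c \<iota>"
    and ef: "\<And>k. k \<in> K \<Longrightarrow> category.ess_factors C (X k) J G c \<iota>"
  shows "category.ess_factors C b J G c \<iota>"
proof -
  interpret G: is_functor J C G by fact
  have \<iota>: "\<iota> j \<in> Hom C (OMap G j) c" if "j \<in> Obj J" for j using cc that unfolding is_cocone_def by blast
  have \<iota>G: "Comp C (\<iota> j) (AMap G u) = \<iota> i" if "i \<in> Obj J" "j \<in> Obj J" "u \<in> Hom J i j" for i j u
    using cc that unfolding is_cocone_def by blast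
  have \<iota>G': "Comp C (\<iota> j) (Comp C (AMap G u) g) = Comp C (\<iota> i) g"
    if "i \<in> Obj J" "j \<in> Obj J" "u \<in> Hom J i j" "g \<in> Hom C a (OMap G i)" for i j u g a
    using G.cod.Comp_assoc[OF that(4) G.AMap_Hom[OF that(3)] \<iota>[OF that(2)]] \<iota>G[OF that(1-3)] by simp
  have GG: "Comp C (AMap G v) (Comp C (AMap G u) g) = Comp C (AMap G (Comp J v u)) g"
    if "u \<in> Hom J i j" "v \<in> Hom J j l" "g \<in> Hom C a (OMap G i)" for i j l u v g a
    using G.cod.Comp_assoc[OF that(3) G.AMap_Hom[OF that(1)] G.AMap_Hom[OF that(2)]]
      G.AMap_Comp[OF that(1,2)] by simp
  note \<beta> = gcoconeD(2)[OF gcolimit_gcocone[OF b]]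
  note \<beta>R = gcoconeD(3)[OF gcolimit_gcocone[OF b]]
  have Rk: "k \<in> K" "l \<in> K" "u \<in> Hom C (X k) (X l)" if "(k, l, u) \<in> R" for k l u
    using D that unfolding gdiagram_def by auto
  show ?thesis
    unfolding G.cod.ess_factors_def
  proof (intro conjI ballI impI)
    fix f assume f: "f \<in> Hom C b c"
    have "\<exists>j g. j \<in> Obj J \<and> g \<in> Hom C (X k) (OMap G j) \<and> Comp C f (\<beta> k) = Comp C (\<iota> j) g" if k: "k \<in>
        K" for k
      using G.cod.ess_factorsD1[OF ef[OF k] G.cod.Comp_Hom[OF \<beta>[OF k] f]] by metis
    then obtain j g where jg: "\<And>k. k \<in> K \<Longrightarrow> j k \<in> Obj J"
      "\<And>k. k \<in> K \<Longrightarrow> g k \<in> Hom C (X k) (OMap G (j k))"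
      "\<And>k. k \<in> K \<Longrightarrow> Comp C f (\<beta> k) = Comp C (\<iota> (j k)) (g k)" by metis
    \<comment> \<open>One factorization has been chosen per vertex; as there are fewer than \<mu> of
      them, a single stage \<open>m\<close> lies above all.\<close>
    have "\<exists>m\<in>Obj J. \<forall>s\<in>j ` K. Hom J s m \<noteq> {}"
      using jg(1) by (intro directed_posetD(5)[OF J] ordLess_image K) blast
    then obtain m where "m \<in> Obj J" "\<forall>k\<in>K. \<exists>u. u \<in> Hom J (j k) m" by (auto simp: ex_in_conv)
    then obtain u where m: "m \<in> Obj J" "\<And>k. k \<in> K \<Longrightarrow> u k \<in> Hom J (j k) m" by metis
    define g' where "g' k = Comp C (AMap G (u k)) (g k)" for k
    have g': "g' k \<in> Hom C (X k) (OMap G m)" "Comp C (\<iota> m) (g' k) = Comp C f (\<beta> k)" if "k \<in> K" for k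
      using G.cod.Comp_Hom[OF jg(2) G.AMap_Hom[OF m(2)]] \<iota>G'[OF jg(1) m(1) m(2) jg(2)] jg(3) that
      unfolding g'_def by auto
    \<comment> \<open>At stage \<open>m\<close> the arrows \<open>g' k\<close> need not yet form a
      cocone: the equation of an edge holds only after \<open>\<iota> m\<close>, hence at a later
      stage depending on the edge.\<close>
    have "\<exists>n w. n \<in> Obj J \<and> w \<in> Hom J m n \<and>
        (case e of (k, l, v) \<Rightarrow> Comp C (AMap G w) (Comp C (g' l) v) = Comp C (AMap G w) (g' k))" if e:
            "e \<in> R" for e
    proof -
      obtain k l v where eq: "e = (k, l, v)" by (cases e)
      note r = Rk[OF e[unfolded eq]]
      have h: "Comp C (g' l) v \<in> Hom C (X k) (OMap G m)" using G.cod.Comp_Hom[OF r(3) g'(1)[OF r(2)]] .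
      have "Comp C (\<iota> m) (Comp C (g' l) v) = Comp C (Comp C f (\<beta> l)) v"
        using G.cod.Comp_assoc[OF r(3) g'(1)[OF r(2)] \<iota>[OF m(1)]] g'(2)[OF r(2)] by simp
      also have "\<dots> = Comp C f (\<beta> k)"
        using G.cod.Comp_assoc[OF r(3) \<beta>[OF r(2)] f] \<beta>R[OF e[unfolded eq]] by simp
      finally have "Comp C (\<iota> m) (Comp C (g' l) v) = Comp C (\<iota> m) (g' k)" using g'(2)[OF r(1)] by simp
      then obtain n w where "n \<in> Obj J" "w \<in> Hom J m n"
        "Comp C (AMap G w) (Comp C (g' l) v) = Comp C (AMap G w) (g' k)"
        by (rule G.cod.ess_factorsD2[OF ef[OF r(1)] m(1) h g'(1)[OF r(1)]])
      then show ?thesis unfolding eq prod.case by blast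
    qed
    then obtain n w where nw: "\<And>e. e \<in> R \<Longrightarrow> n e \<in> Obj J" "\<And>e. e \<in> R \<Longrightarrow> w e \<in> Hom J m (n e)"
      "\<And>e. e \<in> R \<Longrightarrow> (case e of (k, l, v) \<Rightarrow> Comp C (AMap G (w e)) (Comp C (g' l) v) = Comp C (AMap G (w
          e)) (g' k))"
      by metis
    have "\<exists>q\<in>Obj J. \<forall>s\<in>n ` R \<union> {m}. Hom J s q \<noteq> {}"
      using nw(1) m(1) by (intro directed_posetD(5)[OF J] ordLess_Un ordLess_image ordLess_finite \<mu> R)
          auto
    then obtain q where "q \<in> Obj J" "Hom J m q \<noteq> {}" "\<forall>e\<in>R. Hom J (n e) q \<noteq> {}" by auto
    then obtain x where "q \<in> Obj J" "x \<in> Hom J m q" "\<forall>e\<in>R. \<exists>y. y \<in> Hom J (n e) q" by fast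
    then obtain y where q: "q \<in> Obj J" "x \<in> Hom J m q" "\<And>e. e \<in> R \<Longrightarrow> y e \<in> Hom J (n e) q" by metis
    define h where "h k = Comp C (AMap G x) (g' k)" for k
    have h: "h k \<in> Hom C (X k) (OMap G q)" if "k \<in> K" for k
      unfolding h_def using G.cod.Comp_Hom[OF g'(1)[OF that] G.AMap_Hom[OF q(2)]] .
    have "gcocone C K X R (OMap G q) h"
      unfolding gcocone_def
    proof (intro conjI ballI; clarify?)
      show "OMap G q \<in> Obj C" using G.OMap_Obj q(1) .
      show "h k \<in> Hom C (X k) (OMap G q)" if "k \<in> K" for k using h that .
      fix k l v assume e: "(k, l, v) \<in> R"
      let ?e = "(k, l, v)"
      note r = Rk[OF e]
      have h': "Comp C (g' l) v \<in> Hom C (X k) (OMap G m)" using G.cod.Comp_Hom[OF r(3) g'(1)[OF r(2)]] .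
      \<comment> \<open>Arrows in a poset being unique, the passage from \<open>m\<close> to
        \<open>q\<close> runs through the stage at which this particular edge equation already
        holds.\<close>
      have x: "x = Comp J (y ?e) (w ?e)"
        using directed_posetD(4)[OF J] q(2) G.dom.Comp_Hom[OF nw(2)[OF e] q(3)[OF e]] by blast
      have "Comp C (h l) v = Comp C (AMap G x) (Comp C (g' l) v)"
        unfolding h_def using G.cod.Comp_assoc[OF r(3) g'(1)[OF r(2)] G.AMap_Hom[OF q(2)]] by simp
      also have "\<dots> = Comp C (AMap G (y ?e)) (Comp C (AMap G (w ?e)) (Comp C (g' l) v))"
        using GG[OF nw(2)[OF e] q(3)[OF e] h'] x by simp
      also have "\<dots> = Comp C (AMap G (y ?e)) (Comp C (AMap G (w ?e)) (g' k))" using nw(3)[OF e] by simp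
      also have "\<dots> = h k"
        unfolding h_def using GG[OF nw(2)[OF e] q(3)[OF e] g'(1)[OF r(1)]] x by simp
      finally show "Comp C (h l) v = h k" .
    qed
    then obtain z where z: "z \<in> Hom C b (OMap G q)" "\<And>k. k \<in> K \<Longrightarrow> Comp C z (\<beta> k) = h k"
      by (rule gcolimit_factor[OF b]) blast
    have "f = Comp C (\<iota> q) z"
    proof (rule G.cod.gcolimit_eqI[OF b f G.cod.Comp_Hom[OF z(1) \<iota>[OF q(1)]] _ D])
      fix k assume k: "k \<in> K"
      have "Comp C (Comp C (\<iota> q) z) (\<beta> k) = Comp C (\<iota> q) (h k)"
        using G.cod.Comp_assoc[OF \<beta>[OF k] z(1) \<iota>[OF q(1)]] z(2)[OF k] by simp
      also have "\<dots> = Comp C f (\<beta> k)"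
        unfolding h_def using \<iota>G'[OF m(1) q(1,2) g'(1)[OF k]] g'(2)[OF k] by simp
      finally show "Comp C f (\<beta> k) = Comp C (Comp C (\<iota> q) z) (\<beta> k)" by simp
    qed
    then show "\<exists>j\<in>Obj J. \<exists>g\<in>Hom C b (OMap G j). f = Comp C (\<iota> j) g" using q(1) z(1) by blast
  next
    fix j g g' assume j: "j \<in> Obj J" and g: "g \<in> Hom C b (OMap G j)" and g': "g' \<in> Hom C b (OMap G j)"
      and eq: "Comp C (\<iota> j) g = Comp C (\<iota> j) g'"
    \<comment> \<open>For uniqueness, each vertex has a stage equalizing the composites with its
      leg. An upper bound equalizes them for all vertices, and the legs are jointly epic.\<close>
    have "\<exists>n w. n \<in> Obj J \<and> w \<in> Hom J j n \<and>
        Comp C (AMap G w) (Comp C g (\<beta> k)) = Comp C (AMap G w) (Comp C g' (\<beta> k))" if k: "k \<in> K" for k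
    proof -
      have "Comp C (\<iota> j) (Comp C g (\<beta> k)) = Comp C (\<iota> j) (Comp C g' (\<beta> k))"
        using G.cod.Comp_assoc[OF \<beta>[OF k] g \<iota>[OF j]] G.cod.Comp_assoc[OF \<beta>[OF k] g' \<iota>[OF j]] eq by simp
      then obtain n w where "n \<in> Obj J" "w \<in> Hom J j n"
        "Comp C (AMap G w) (Comp C g (\<beta> k)) = Comp C (AMap G w) (Comp C g' (\<beta> k))"
        by (rule G.cod.ess_factorsD2[OF ef[OF k] j G.cod.Comp_Hom[OF \<beta>[OF k] g] G.cod.Comp_Hom[OF \<beta>[OF
            k] g']])
      then show ?thesis by blast
    qed
    then obtain n w where nw: "\<And>k. k \<in> K \<Longrightarrow> n k \<in> Obj J" "\<And>k. k \<in> K \<Longrightarrow> w k \<in> Hom J j (n k)"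
      "\<And>k. k \<in> K \<Longrightarrow> Comp C (AMap G (w k)) (Comp C g (\<beta> k)) = Comp C (AMap G (w k)) (Comp C g' (\<beta> k))"
          by metis
    have "\<exists>q\<in>Obj J. \<forall>s\<in>n ` K \<union> {j}. Hom J s q \<noteq> {}"
      using nw(1) j by (intro directed_posetD(5)[OF J] ordLess_Un ordLess_image ordLess_finite \<mu> K) auto
    then obtain q where "q \<in> Obj J" "Hom J j q \<noteq> {}" "\<forall>k\<in>K. Hom J (n k) q \<noteq> {}" by auto
    then obtain x where "q \<in> Obj J" "x \<in> Hom J j q" "\<forall>k\<in>K. \<exists>y. y \<in> Hom J (n k) q" by fast
    then obtain y where q: "q \<in> Obj J" "x \<in> Hom J j q" "\<And>k. k \<in> K \<Longrightarrow> y k \<in> Hom J (n k) q" by metis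
    note Gx = G.AMap_Hom[OF q(2)]
    have "Comp C (AMap G x) g = Comp C (AMap G x) g'"
    proof (rule G.cod.gcolimit_eqI[OF b G.cod.Comp_Hom[OF g Gx] G.cod.Comp_Hom[OF g' Gx] _ D])
      fix k assume k: "k \<in> K"
      have x: "x = Comp J (y k) (w k)"
        using directed_posetD(4)[OF J] q(2) G.dom.Comp_Hom[OF nw(2)[OF k] q(3)[OF k]] by blast
      have "Comp C (AMap G x) (Comp C g (\<beta> k)) = Comp C (AMap G x) (Comp C g' (\<beta> k))"
        using GG[OF nw(2)[OF k] q(3)[OF k] G.cod.Comp_Hom[OF \<beta>[OF k] g]]
          GG[OF nw(2)[OF k] q(3)[OF k] G.cod.Comp_Hom[OF \<beta>[OF k] g']] nw(3)[OF k] x by simp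
      then show "Comp C (Comp C (AMap G x) g) (\<beta> k) = Comp C (Comp C (AMap G x) g') (\<beta> k)"
        using G.cod.Comp_assoc[OF \<beta>[OF k] g Gx] G.cod.Comp_assoc[OF \<beta>[OF k] g' Gx] by simp
    qed
    then show "\<exists>k\<in>Obj J. \<exists>u\<in>Hom J j k. Comp C (AMap G u) g = Comp C (AMap G u) g'"
      using q by blast
  qed
qed

text \<open>Serves twice: it makes the colimits of \<mu>-small diagrams eligible as generators at
  \<mu>, and it bounds the presentability rank of objects given as small colimits.\<close>

lemma presentable_gcolimit:
  assumes U: "inaccessible U" and C: "category C" and ls: "locally_small U C" and \<mu>: "Cinfinite \<mu>"
    and b: "gcolimit C K X R b \<beta>" and D: "gdiagram C K X R"
    and K: "|K| <o \<mu>" and R: "|R| <o \<mu>"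
    and X: "\<And>k. k \<in> K \<Longrightarrow> presentable U \<mu> C (X k)"
  shows "presentable U \<mu> C b"
  unfolding presentable_iff[OF U C ls \<mu>]
proof (intro conjI allI impI)
  show "b \<in> Obj C" using gcoconeD(1)[OF gcolimit_gcocone[OF b]] .
  fix J G c \<iota> assume *: "directed_poset U \<mu> J \<and> is_functor J C G \<and> is_colimit J C G c \<iota>"
  show "category.ess_factors C b J G c \<iota>"
  proof (rule ess_factors_gcolimit[OF C b D K R \<mu>])
    show "directed_poset U \<mu> J" "is_functor J C G" "is_cocone J C G c \<iota>"
      using * unfolding is_colimit_def by blast+
    show "category.ess_factors C (X k) J G c \<iota>" if "k \<in> K" for k
      using X[OF that] * unfolding presentable_iff[OF U C ls \<mu>] by blast
  qed
qed

lemma presentable_mono: "presentable U \<kappa> C a \<Longrightarrow> \<kappa> \<le>o \<mu> \<Longrightarrow> presentable U \<mu> C a"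
  unfolding presentable_def using preserves_directed_colimits_mono by blast

lemma gcocone_mono: "gcocone C T X R' c \<iota> \<Longrightarrow> S \<subseteq> T \<Longrightarrow> R \<subseteq> R' \<Longrightarrow> gcocone C S X R c \<iota>"
  unfolding gcocone_def by fast

section \<open>Raising the index of accessibility\<close>

definition subset_cat :: "'a set set \<Rightarrow> ('a set, 'a set \<times> 'a set) cat" where
  "subset_cat P =
    \<lparr>Obj = P, Arr = {(S, T). S \<in> P \<and> T \<in> P \<and> S \<subseteq> T}, Dom = fst, Cod = snd,
     Ident = (\<lambda>S. (S, S)), Comp = (\<lambda>g f. (fst f, snd g))\<rparr>"

lemma subset_cat_simps [simp]:
  "Obj (subset_cat P) = P"
  "Arr (subset_cat P) = {(S, T). S \<in> P \<and> T \<in> P \<and> S \<subseteq> T}"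
  "Ident (subset_cat P) S = (S, S)"
  "Comp (subset_cat P) g f = (fst f, snd g)"
  by (simp_all add: subset_cat_def)

lemma Hom_subset_cat:
  "Hom (subset_cat P) S T = (if S \<in> P \<and> T \<in> P \<and> S \<subseteq> T then {(S, T)} else {})"
  by (auto simp: Hom_def subset_cat_def)

lemma category_subset_cat: "category (subset_cat P)"
  by standard (auto simp: Hom_subset_cat split: if_splits, auto simp: subset_cat_def)

text \<open>A set of codes is decoded by \<open>inv_into\<close>, bounded by inclusion with
  \<open>dir\<close>, and the bound is encoded again; antisymmetry is that of inclusion.\<close>

lemma directed_poset_transport_subset:
  assumes U: "inaccessible U" and P: "small U P" and \<phi>: "inj_on \<phi> P" and \<psi>: "inj_on \<psi> (Arr (subset_cat
      P))"
    and dir: "\<And>Q. Q \<subseteq> P \<Longrightarrow> |Q| <o \<mu> \<Longrightarrow> \<exists>T\<in>P. \<forall>S\<in>Q. S \<subseteq> T"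
  shows "directed_poset U \<mu> (transport_cat \<phi> \<psi> (subset_cat P))"
proof -
  let ?J = "subset_cat P"
  have \<phi>': "inj_on \<phi> (Obj ?J)" using \<phi> by simp
  note tr = category_subset_cat \<phi>' \<psi>
  have "small U (P \<times> P)" using U P by (intro small_Times)
  then have A: "small U (Arr ?J)" by (rule small_subset) auto
  show ?thesis
    unfolding directed_poset_def
  proof (intro conjI allI impI ballI)
    show "small_category U (transport_cat \<phi> \<psi> ?J)"
      using P A by (intro small_category_transport tr) simp_all
    show "f = g" if f: "f \<in> Hom (transport_cat \<phi> \<psi> ?J) i j" and g: "g \<in> Hom (transport_cat \<phi> \<psi> ?J) i
        j" for f g i j
    proof -
      obtain S T f' where *: "S \<in> Obj ?J" "T \<in> Obj ?J" "i = \<phi> S" "j = \<phi> T" "f' \<in> Hom ?J S T" "f = \<psi> f'"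
        by (rule Hom_transport_catE[OF tr f])
      obtain S' T' g' where **: "S' \<in> Obj ?J" "T' \<in> Obj ?J" "i = \<phi> S'" "j = \<phi> T'" "g' \<in> Hom ?J S' T'"
          "g = \<psi> g'"
        by (rule Hom_transport_catE[OF tr g])
      have "S = S'" "T = T'" using * ** \<phi> by (auto dest: inj_onD)
      then show ?thesis using * ** by (simp add: Hom_subset_cat split: if_splits)
    qed
    show "i = j" if h: "Hom (transport_cat \<phi> \<psi> ?J) i j \<noteq> {} \<and> Hom (transport_cat \<phi> \<psi> ?J) j i \<noteq> {}" for
        i j
    proof -
      obtain f g where f: "f \<in> Hom (transport_cat \<phi> \<psi> ?J) i j" and g: "g \<in> Hom (transport_cat \<phi> \<psi> ?J)
          j i"
        using h by blast
      obtain S T f' where *: "S \<in> Obj ?J" "T \<in> Obj ?J" "i = \<phi> S" "j = \<phi> T" "f' \<in> Hom ?J S T" "f = \<psi> f'"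
        by (rule Hom_transport_catE[OF tr f])
      obtain T' S' g' where **: "T' \<in> Obj ?J" "S' \<in> Obj ?J" "j = \<phi> T'" "i = \<phi> S'" "g' \<in> Hom ?J T' S'"
          "g = \<psi> g'"
        by (rule Hom_transport_catE[OF tr g])
      have "S = S'" "T = T'" using * ** \<phi> by (auto dest: inj_onD)
      then have "S = T" using *(5) **(5) by (simp add: Hom_subset_cat split: if_splits)
      then show ?thesis using * by simp
    qed
    fix Q assume Q: "Q \<subseteq> Obj (transport_cat \<phi> \<psi> ?J)" "|Q| <o \<mu>"
    have Q': "Q \<subseteq> \<phi> ` P" using Q(1) by (simp add: transport_cat_simps[OF tr])
    let ?Q = "inv_into P \<phi> ` Q"
    have inv: "inv_into P \<phi> i \<in> P" "\<phi> (inv_into P \<phi> i) = i" if "i \<in> Q" for i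
      using that Q' inv_into_into[of i \<phi> P] f_inv_into_f[of i \<phi> P] by auto
    have "\<exists>T\<in>P. \<forall>S\<in>?Q. S \<subseteq> T" using inv(1) Q(2) by (intro dir ordLess_image) auto
    then obtain T where T: "T \<in> P" "\<forall>S\<in>?Q. S \<subseteq> T" by blast
    show "\<exists>u\<in>Obj (transport_cat \<phi> \<psi> ?J). \<forall>s\<in>Q. Hom (transport_cat \<phi> \<psi> ?J) s u \<noteq> {}"
    proof (intro bexI ballI)
      show "\<phi> T \<in> Obj (transport_cat \<phi> \<psi> ?J)" using T(1) by (simp add: transport_cat_simps[OF tr])
      fix i assume i: "i \<in> Q"
      have "Hom (transport_cat \<phi> \<psi> ?J) (\<phi> (inv_into P \<phi> i)) (\<phi> T) \<noteq> {}"
        using T inv(1)[OF i] i by (subst Hom_transport_cat[OF tr]) (auto simp: Hom_subset_cat)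
      then show "Hom (transport_cat \<phi> \<psi> ?J) i (\<phi> T) \<noteq> {}" using inv(2)[OF i] by simp
    qed
  qed
qed

text \<open>The full subdiagram spanned by \<open>S\<close>. Taking all arrows between its vertices
  makes it monotone in \<open>S\<close>, which induces the arrows between the colimits of
  subdiagrams.\<close>

definition full_edges :: "('i, 'k, 'y) cat_scheme \<Rightarrow> ('i, 'k, 'o, 'm) cfun \<Rightarrow> 'i set \<Rightarrow> ('i \<times> 'i \<times> 'm)
    set" where
  "full_edges J G S = {(i, j, AMap G u) | i j u. i \<in> S \<and> j \<in> S \<and> u \<in> Hom J i j}"

text \<open>
  To be applied to the set \<open>P\<close> of all sets of fewer than \<open>\<mu>\<close> vertices, which is \<open>\<mu>\<close>-directed by
  regularity of \<open>\<mu>\<close>.  Cocompleteness makes it unnecessary that the subdiagrams be directed.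
\<close>

lemma colimit_of_subdiagram_colimits:
  fixes b :: "'i set \<Rightarrow> 'o" and \<beta> :: "'i set \<Rightarrow> 'i \<Rightarrow> 'm"
  assumes G: "is_functor J C G" and x: "is_colimit J C G x \<iota>"
    and P: "P \<subseteq> Pow (Obj J)" and P2: "\<And>i j. i \<in> Obj J \<Longrightarrow> j \<in> Obj J \<Longrightarrow> {i, j} \<in> P"
    and b: "\<And>S. S \<in> P \<Longrightarrow> gcolimit C S (OMap G) (full_edges J G S) (b S) (\<beta> S)"
  obtains H \<gamma> where "is_functor (subset_cat P) C H" "\<And>S. S \<in> P \<Longrightarrow> OMap H S = b S"
    "is_colimit (subset_cat P) C H x \<gamma>"
proof -
  interpret G: is_functor J C G by fact
  have gd: "gdiagram C S (OMap G) (full_edges J G S)" if "S \<in> P" for S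
    using that P G.OMap_Obj G.AMap_Hom unfolding gdiagram_def full_edges_def by auto
  have cc: "is_cocone J C G x \<iota>" using x unfolding is_colimit_def by blast
  have gJ: "gcolimit C (Obj J) (OMap G) (edges J G) x \<iota>" using x unfolding is_colimit_iff_gcolimit .
  note \<iota> = gcoconeD[OF gcolimit_gcocone[OF gJ]]
  note \<beta> = gcoconeD[OF gcolimit_gcocone[OF b]]
  have sub: "full_edges J G S \<subseteq> full_edges J G T" if "S \<subseteq> T" for S T
    using that unfolding full_edges_def by auto
  have sub': "full_edges J G S \<subseteq> edges J G" if "S \<in> P" for S
  proof -
    have "S \<subseteq> Obj J" using that P by blast
    then show ?thesis unfolding full_edges_def edges_def by auto
  qed
  \<comment> \<open>The colimit cocone of the larger subdiagram restricts to the smaller one;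
    factoring it gives the arrow \<open>b S \<rightarrow> b T\<close>.\<close>
  have "\<exists>h. h \<in> Hom C (b S) (b T) \<and> (\<forall>k\<in>S. Comp C h (\<beta> S k) = \<beta> T k)"
    if "S \<in> P" "T \<in> P" "S \<subseteq> T" for S T
  proof -
    have "gcocone C S (OMap G) (full_edges J G S) (b T) (\<beta> T)"
      using gcolimit_gcocone[OF b[OF that(2)]] that(3) sub[OF that(3)] by (rule gcocone_mono)
    then show ?thesis using gcolimit_factor[OF b[OF that(1)]] by metis
  qed
  then obtain h where h: "\<And>S T. S \<in> P \<Longrightarrow> T \<in> P \<Longrightarrow> S \<subseteq> T \<Longrightarrow> h S T \<in> Hom C (b S) (b T)"
    "\<And>S T k. S \<in> P \<Longrightarrow> T \<in> P \<Longrightarrow> S \<subseteq> T \<Longrightarrow> k \<in> S \<Longrightarrow> Comp C (h S T) (\<beta> S k) = \<beta> T k" by metis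
  have "\<exists>g. g \<in> Hom C (b S) x \<and> (\<forall>k\<in>S. Comp C g (\<beta> S k) = \<iota> k)" if "S \<in> P" for S
  proof -
    have "gcocone C S (OMap G) (full_edges J G S) x \<iota>"
      using gcolimit_gcocone[OF gJ] _ sub'[OF that] by (rule gcocone_mono) (use that P in blast)
    then show ?thesis using gcolimit_factor[OF b[OF that(1)]] by metis
  qed
  then obtain \<gamma> where \<gamma>: "\<And>S. S \<in> P \<Longrightarrow> \<gamma> S \<in> Hom C (b S) x"
    "\<And>S k. S \<in> P \<Longrightarrow> k \<in> S \<Longrightarrow> Comp C (\<gamma> S) (\<beta> S k) = \<iota> k" by metis
  define H where "H = \<lparr>OMap = (\<lambda>S\<in>P. b S), AMap = (\<lambda>f\<in>Arr (subset_cat P). h (fst f) (snd f))\<rparr>"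
  have HO: "OMap H S = b S" if "S \<in> P" for S using that by (simp add: H_def)
  have HA: "AMap H (S, T) = h S T" if "S \<in> P" "T \<in> P" "S \<subseteq> T" for S T using that by (simp add: H_def)
  have hI: "h S S = Ident C (b S)" if S: "S \<in> P" for S
    by (rule G.cod.gcolimit_eqI[OF b[OF S] h(1)[OF S S] _ _ gd[OF S]])
      (use S G.cod.Ident_Hom[OF \<beta>(1)[OF S]] G.cod.Ident_Comp[OF \<beta>(2)[OF S]] h(2)[OF S S] in auto)
  have hC: "h S W = Comp C (h T W) (h S T)" if S: "S \<in> P" "T \<in> P" "W \<in> P" "S \<subseteq> T" "T \<subseteq> W" for S T W
  proof (rule G.cod.gcolimit_eqI[OF b[OF S(1)] _ _ _ gd[OF S(1)]])
    have SW: "S \<subseteq> W" using S by blast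
    show "h S W \<in> Hom C (b S) (b W)" using h(1) S SW by blast
    show "Comp C (h T W) (h S T) \<in> Hom C (b S) (b W)" using h(1) S G.cod.Comp_Hom by blast
    fix k assume k: "k \<in> S"
    then have "Comp C (Comp C (h T W) (h S T)) (\<beta> S k) = \<beta> W k"
      using G.cod.Comp_assoc[OF \<beta>(2)[OF S(1) k] h(1)[OF S(1,2,4)] h(1)[OF S(2,3,5)]] h(2)[OF S(1,2,4) k]
        h(2)[OF S(2,3,5)] S(4) by auto
    then show "Comp C (h S W) (\<beta> S k) = Comp C (Comp C (h T W) (h S T)) (\<beta> S k)"
      using h(2)[OF S(1,3) SW k] by simp
  qed
  interpret P: category "subset_cat P" by (rule category_subset_cat)
  have H: "is_functor (subset_cat P) C H"
  proof
    show "OMap H \<in> extensional (Obj (subset_cat P))" "AMap H \<in> extensional (Arr (subset_cat P))"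
      by (simp_all add: H_def)
    show "OMap H S \<in> Obj C" if "S \<in> Obj (subset_cat P)" for S using that HO \<beta>(1) by simp
    show "AMap H f \<in> Hom C (OMap H S) (OMap H T)" if "f \<in> Hom (subset_cat P) S T" for f S T
      using that h(1) HO HA by (simp add: Hom_subset_cat split: if_splits)
    show "AMap H (Ident (subset_cat P) S) = Ident C (OMap H S)" if "S \<in> Obj (subset_cat P)" for S
      using that HA HO hI by simp
    show "AMap H (Comp (subset_cat P) g f) = Comp C (AMap H g) (AMap H f)"
      if "f \<in> Hom (subset_cat P) S T" "g \<in> Hom (subset_cat P) T W" for f g S T W
    proof -
      have *: "S \<in> P" "T \<in> P" "W \<in> P" "S \<subseteq> T" "T \<subseteq> W" "f = (S, T)" "g = (T, W)"
        using that by (auto simp: Hom_subset_cat split: if_splits)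
      then have "S \<subseteq> W" by blast
      then show ?thesis using * HA hC[OF *(1-5)] by simp
    qed
  qed
  have "is_colimit (subset_cat P) C H x \<gamma>"
    unfolding is_colimit_iff_gcolimit
  proof (rule G.cod.gcolimitI)
    show "gcocone C (Obj (subset_cat P)) (OMap H) (edges (subset_cat P) H) x \<gamma>"
      unfolding is_cocone_iff_gcocone[symmetric] is_cocone_def
    proof (intro conjI ballI)
      show "x \<in> Obj C" using \<iota>(1) .
      show "\<gamma> S \<in> Hom C (OMap H S) x" if "S \<in> Obj (subset_cat P)" for S using that \<gamma>(1) HO by simp
      fix S T u assume "u \<in> Hom (subset_cat P) S T"
      then have *: "S \<in> P" "T \<in> P" "S \<subseteq> T" "u = (S, T)" by (auto simp: Hom_subset_cat split: if_splits)
      have "Comp C (\<gamma> T) (h S T) = \<gamma> S"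
      proof (rule G.cod.gcolimit_eqI[OF b[OF *(1)] G.cod.Comp_Hom[OF h(1)[OF *(1-3)] \<gamma>(1)[OF *(2)]]
          \<gamma>(1)[OF *(1)] _ gd[OF *(1)]])
        fix k assume k: "k \<in> S"
        then show "Comp C (Comp C (\<gamma> T) (h S T)) (\<beta> S k) = Comp C (\<gamma> S) (\<beta> S k)"
          using G.cod.Comp_assoc[OF \<beta>(2)[OF *(1) k] h(1)[OF *(1-3)] \<gamma>(1)[OF *(2)]] h(2)[OF *(1-3) k]
            \<gamma>(2)[OF *(1) k] \<gamma>(2)[OF *(2), of k] *(3) by auto
      qed
      then show "Comp C (\<gamma> T) (AMap H u) = \<gamma> S" using HA * by simp
    qed
  next
    fix y \<tau> assume "gcocone C (Obj (subset_cat P)) (OMap H) (edges (subset_cat P) H) y \<tau>"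
    then have t: "is_cocone (subset_cat P) C H y \<tau>" unfolding is_cocone_iff_gcocone .
    have \<tau>: "\<tau> S \<in> Hom C (b S) y" if "S \<in> P" for S using t that HO unfolding is_cocone_def by auto
    have \<tau>h: "Comp C (\<tau> T) (h S T) = \<tau> S" if "S \<in> P" "T \<in> P" "S \<subseteq> T" for S T
    proof -
      have "(S, T) \<in> Hom (subset_cat P) S T" using that by (simp add: Hom_subset_cat)
      then have "Comp C (\<tau> T) (AMap H (S, T)) = \<tau> S" using t that unfolding is_cocone_def by simp
      then show ?thesis using HA that by simp
    qed
    have \<tau>\<beta>: "Comp C (\<tau> T) (\<beta> T k) = Comp C (\<tau> S) (\<beta> S k)" if ST: "S \<in> P" "T \<in> P" "S \<subseteq> T" and k: "k \<in>
        S" for S T k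
      using G.cod.Comp_assoc[OF \<beta>(2)[OF ST(1) k] h(1)[OF ST] \<tau>[OF ST(2)]] h(2)[OF ST k] \<tau>h[OF ST] by
          simp
    have P1: "{k} \<in> P" if "k \<in> Obj J" for k using P2[OF that that] by simp
    \<comment> \<open>A vertex of \<open>J\<close> is seen through the singleton subdiagram, which
      lies in \<open>P\<close> by \<open>P2\<close> with equal arguments; by
      \<open>\<iota>'S\<close> any other member of \<open>P\<close> containing \<open>k\<close>
      gives the same leg.\<close>
    define \<iota>' where "\<iota>' k = Comp C (\<tau> {k}) (\<beta> {k} k)" for k
    have \<iota>'S: "Comp C (\<tau> S) (\<beta> S k) = \<iota>' k" if "S \<in> P" "k \<in> S" for S k
      unfolding \<iota>'_def using that P by (intro \<tau>\<beta> P1) auto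
    have "gcocone C (Obj J) (OMap G) (edges J G) y \<iota>'"
      unfolding gcocone_def
    proof (intro conjI ballI; clarify?)
      show "y \<in> Obj C" using t unfolding is_cocone_def by blast
      show "\<iota>' k \<in> Hom C (OMap G k) y" if "k \<in> Obj J" for k
        unfolding \<iota>'_def using G.cod.Comp_Hom[OF \<beta>(2)[OF P1[OF that]] \<tau>[OF P1[OF that]]] by simp
      fix i j v assume "(i, j, v) \<in> edges J G"
      then obtain u where u: "i \<in> Obj J" "j \<in> Obj J" "u \<in> Hom J i j" "v = AMap G u" unfolding
          edges_def by blast
      \<comment> \<open>Both ends of the edge lie in one member of \<open>P\<close>, so its cocone
        condition is already contained in a subdiagram.\<close>
      let ?S = "{i, j}"
      have S: "?S \<in> P" using P2 u by blast
      have "(i, j, v) \<in> full_edges J G ?S" using u unfolding full_edges_def by blast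
      then have e: "Comp C (\<beta> ?S j) v = \<beta> ?S i" by (rule \<beta>(3)[OF S])
      have j: "j \<in> ?S" by simp
      have "Comp C (\<iota>' j) v = Comp C (Comp C (\<tau> ?S) (\<beta> ?S j)) v" using \<iota>'S[OF S j] by simp
      also have "\<dots> = Comp C (\<tau> ?S) (\<beta> ?S i)"
        using G.cod.Comp_assoc[OF G.AMap_Hom[OF u(3)] \<beta>(2)[OF S j] \<tau>[OF S]] e u(4) by simp
      also have "\<dots> = \<iota>' i" using \<iota>'S[OF S, of i] by simp
      finally show "Comp C (\<iota>' j) v = \<iota>' i" .
    qed
    then obtain f where f: "f \<in> Hom C x y" "\<And>k. k \<in> Obj J \<Longrightarrow> Comp C f (\<iota> k) = \<iota>' k"
      by (rule gcolimit_factor[OF gJ]) blast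
    have "Comp C f (\<gamma> S) = \<tau> S" if S: "S \<in> P" for S
    proof (rule G.cod.gcolimit_eqI[OF b[OF S] G.cod.Comp_Hom[OF \<gamma>(1)[OF S] f(1)] \<tau>[OF S] _ gd[OF S]])
      fix k assume k: "k \<in> S"
      have kJ: "k \<in> Obj J" using k S P by blast
      show "Comp C (Comp C f (\<gamma> S)) (\<beta> S k) = Comp C (\<tau> S) (\<beta> S k)"
        using G.cod.Comp_assoc[OF \<beta>(2)[OF S k] \<gamma>(1)[OF S] f(1)] \<gamma>(2)[OF S k] f(2)[OF kJ] \<iota>'S[OF S k]
            by simp
    qed
    then show "\<exists>h. h \<in> Hom C x y \<and> (\<forall>S\<in>Obj (subset_cat P). Comp C h (\<gamma> S) = \<tau> S)" using f(1) by auto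
  next
    fix y f g assume f: "f \<in> Hom C x y" and g: "g \<in> Hom C x y"
      and eq: "\<And>S. S \<in> Obj (subset_cat P) \<Longrightarrow> Comp C f (\<gamma> S) = Comp C g (\<gamma> S)"
    show "f = g"
    proof (rule G.cod.gcolimit_eqI[OF gJ f g _ gdiagram_edges[OF G]])
      fix k assume k: "k \<in> Obj J"
      \<comment> \<open>Each leg \<open>\<iota> k\<close> passes through
        \<open>\<gamma> {k}\<close>, so the legs \<gamma> inherit joint epicness.\<close>
      have S: "{k} \<in> P" using P2[OF k k] by simp
      note \<beta>k = \<beta>(2)[OF S, of k, simplified]
      show "Comp C f (\<iota> k) = Comp C g (\<iota> k)"
        using G.cod.Comp_assoc[OF \<beta>k \<gamma>(1)[OF S] f] G.cod.Comp_assoc[OF \<beta>k \<gamma>(1)[OF S] g]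
          \<gamma>(2)[OF S, of k] eq[of "{k}"] S by simp
    qed
  qed
  then show thesis using that H HO by blast
qed

lemma accessible_atE:
  assumes "accessible_at U \<kappa> C"
  obtains A where "small U A" "\<forall>a\<in>A. presentable U \<kappa> C a"
    "\<forall>x\<in>Obj C. \<exists>J G \<iota>. directed_poset U \<kappa> J \<and> is_functor J C G \<and>
      OMap G ` Obj J \<subseteq> A \<and> is_colimit J C G x \<iota>"
  using assms unfolding accessible_at_def by (elim conjE exE) (rule that)

lemma accessible_atI:
  assumes "category C" "locally_small U C" "has_directed_colimits U \<kappa> C"
    "small U A" "\<And>a. a \<in> A \<Longrightarrow> presentable U \<kappa> C a"
    "\<And>x. x \<in> Obj C \<Longrightarrow> \<exists>J G \<iota>. directed_poset U \<kappa> J \<and> is_functor J C G \<and>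
      OMap G ` Obj J \<subseteq> A \<and> is_colimit J C G x \<iota>"
  shows "accessible_at U \<kappa> C"
  unfolding accessible_at_def by (intro conjI exI[of _ A] ballI assms)

lemma accessible_atD:
  assumes "accessible_at U \<kappa> C"
  shows "category C" "locally_small U C"
  using assms unfolding accessible_at_def by simp_all

text \<open>A poset has at most one arrow between two vertices, so an edge is determined by its
  endpoints and the edges embed into \<open>S \<times> S\<close>.\<close>

lemma ordLess_full_edges:
  assumes J: "directed_poset U \<kappa> J" and \<mu>: "regular_cardinal U \<mu>" and S: "|S| <o \<mu>"
  shows "|full_edges J G S| <o \<mu>"
proof (rule ordLess_inj_on)
  show "|S \<times> S| <o \<mu>" by (rule ordLess_Times[OF regular_cardinalD(1,2)[OF \<mu>] S S])
  show "inj_on (\<lambda>(i, j, v). (i, j)) (full_edges J G S)"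
  proof (rule inj_onI)
    fix e e' assume "e \<in> full_edges J G S" "e' \<in> full_edges J G S"
      and eq: "(\<lambda>(i, j, v). (i, j)) e = (\<lambda>(i, j, v). (i, j)) e'"
    then obtain i j u i' j' u' where "e = (i, j, AMap G u)" "u \<in> Hom J i j"
      "e' = (i', j', AMap G u')" "u' \<in> Hom J i' j'" unfolding full_edges_def by auto
    then show "e = e'" using eq directed_posetD(4)[OF J, of u i j u'] by simp
  qed
  show "(\<lambda>(i, j, v). (i, j)) ` full_edges J G S \<subseteq> S \<times> S" unfolding full_edges_def by auto
qed

lemma small_below_regular: "regular_cardinal U \<mu> \<Longrightarrow> |S| <o \<mu> \<Longrightarrow> small U S"
  unfolding small_def using regular_cardinalD(3) ordLess_transitive by blast

lemma small_Hom_family: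
  assumes U: "inaccessible U" and ls: "locally_small U C" and A: "small U A" "A \<subseteq> Obj C"
  shows "small U (\<Union>a\<in>A. \<Union>b\<in>A. Hom C a b)"
proof (intro small_UN U A(1))
  fix a b assume "a \<in> A" "b \<in> A"
  then have "a \<in> Obj C" "b \<in> Obj C" using A(2) by auto
  then show "small U (Hom C a b)" using ls unfolding locally_small_def by blast
qed

text \<open>
  Up to relabelling of the vertices there is only a small set of diagrams of fewer than \<open>\<mu>\<close> vertices
  and edges in a small full subcategory, so the colimits of all of them can be found in a small set.
\<close>

lemma exists_small_set_of_colimits:
  fixes U :: "'u set" and A :: "'o set" and C :: "('o, 'm, 'z) cat_scheme"
  assumes U: "inaccessible U" and C: "category C" and ls: "locally_small U C" and co: "cocomplete U C"
    and \<mu>: "regular_cardinal U \<mu>" and A: "small U A" "A \<subseteq> Obj C"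
    and pres: "\<And>a. a \<in> A \<Longrightarrow> presentable U \<mu> C a"
  obtains B where "small U B" "\<And>b. b \<in> B \<Longrightarrow> presentable U \<mu> C b"
    "\<And>(S :: 'i set) X R. gdiagram C S X R \<Longrightarrow> X ` S \<subseteq> A \<Longrightarrow> |S| <o \<mu> \<Longrightarrow> |R| <o \<mu> \<Longrightarrow>
      \<exists>b\<in>B. \<exists>\<beta>. gcolimit C S X R b \<beta>"
proof -
  note \<mu>' = regular_cardinalD[OF \<mu>]
  \<comment> \<open>Every diagram with fewer than \<mu> vertices can be relabelled so that its
    vertices lie in this one small set.\<close>
  define M where "M = Field \<mu>"
  define AA where "AA = (\<Union>a\<in>A. \<Union>b\<in>A. Hom C a b)"
  have AA: "small U AA" unfolding AA_def using U ls A by (rule small_Hom_family)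
  have M: "small U M" unfolding M_def small_def using \<mu>'(3) by (rule ordLess_Field)
  define codes where "codes = {(K, X, R). K \<subseteq> M \<and> X \<in> K \<rightarrow>\<^sub>E A \<and> R \<subseteq> K \<times> K \<times> AA \<and>
    |K| <o \<mu> \<and> |R| <o \<mu> \<and> gdiagram C K X R}"
  have "small U (\<Union>K\<in>Pow M. {K} \<times> (K \<rightarrow>\<^sub>E A) \<times> Pow (K \<times> K \<times> AA))"
  proof (rule small_UN[OF U small_Pow[OF U M]])
    fix K assume "K \<in> Pow M"
    then have K: "small U K" using M small_subset by auto
    show "small U ({K} \<times> (K \<rightarrow>\<^sub>E A) \<times> Pow (K \<times> K \<times> AA))"
      using small_Times[OF U small_finite[OF U, of "{K}"] small_Times[OF U small_PiE[OF U K A(1)]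
        small_Pow[OF U small_Times[OF U K small_Times[OF U K AA]]]]] by simp
  qed
  then have codes: "small U codes" by (rule small_subset) (auto simp: codes_def)
  \<comment> \<open>One colimit object is chosen for each coded diagram; as the codes form a small
    set, so does \<open>B\<close>.\<close>
  define B where "B = (\<lambda>(K, X, R). SOME b. \<exists>\<beta>. gcolimit C K X R b \<beta>) ` codes"
  have col: "\<exists>\<beta>. gcolimit C K X R (SOME b. \<exists>\<beta>. gcolimit C K X R b \<beta>) \<beta>" if "(K, X, R) \<in> codes" for K X R
  proof -
    have *: "gdiagram C K X R" "|K| <o \<mu>" "|R| <o \<mu>" using that unfolding codes_def by auto
    obtain b \<beta> where "gcolimit C K X R b \<beta>"
      by (rule cocomplete_gcolimit[OF U C co *(1) small_below_regular[OF \<mu> *(2)]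
          small_below_regular[OF \<mu> *(3)]])
    then have "\<exists>b \<beta>. gcolimit C K X R b \<beta>" by blast
    then show ?thesis by (rule someI_ex)
  qed
  show thesis
  proof
    show "small U B" unfolding B_def using codes by (rule small_image)
    show "presentable U \<mu> C b" if "b \<in> B" for b
    proof -
      obtain K X R where c: "(K, X, R) \<in> codes" "b = (SOME b. \<exists>\<beta>. gcolimit C K X R b \<beta>)"
        using \<open>b \<in> B\<close> unfolding B_def by auto
      have *: "gdiagram C K X R" "|K| <o \<mu>" "|R| <o \<mu>" "X \<in> K \<rightarrow>\<^sub>E A" using c(1) unfolding codes_def by
          auto
      obtain \<beta> where "gcolimit C K X R b \<beta>" using col[OF c(1)] c(2) by blast
      then show ?thesis
        by (rule presentable_gcolimit[OF U C ls \<mu>'(1) _ *(1-3)]) (rule pres[OF PiE_mem[OF *(4)]])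
    qed
    fix S :: "'i set" and X R
    assume gd: "gdiagram C S X R" and X: "X ` S \<subseteq> A" and S: "|S| <o \<mu>" and R: "|R| <o \<mu>"
    \<comment> \<open>The given diagram, whose vertices may have any type, is copied along an
      injection into \<open>M\<close>. The copy is a code, and relabelling takes its chosen colimit
      back.\<close>
    have "|S| \<le>o |M|"
      using S ordLess_imp_ordLeq ordLeq_ordIso_trans[OF _ ordIso_symmetric[OF card_of_Field_ordIso]]
          \<mu>'(1)
      unfolding M_def by blast
    then obtain e where e: "inj_on e S" "e ` S \<subseteq> M" using card_of_ordLeq[of S M] by blast
    define X' where "X' = (\<lambda>k\<in>e ` S. X (inv_into S e k))"
    define R' where "R' = (\<lambda>(k, l, u). (e k, e l, u)) ` R"
    have X': "X' (e k) = X k" if "k \<in> S" for k using that e(1) by (simp add: X'_def)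
    have Rk: "k \<in> S" "l \<in> S" "u \<in> Hom C (X k) (X l)" if "(k, l, u) \<in> R" for k l u
      using gd that unfolding gdiagram_def by auto
    have RS: "R \<subseteq> S \<times> S \<times> UNIV" using gdiagram_edge_subset[OF gd] .
    have "gdiagram C (e ` S) X' R'"
      using gd X' Rk unfolding gdiagram_def R'_def by auto
    moreover have "R' \<subseteq> e ` S \<times> e ` S \<times> AA"
    proof
      fix r assume "r \<in> R'"
      then obtain k l u where r: "(k, l, u) \<in> R" "r = (e k, e l, u)" unfolding R'_def by auto
      have "X k \<in> A" "X l \<in> A" using Rk[OF r(1)] X by auto
      then show "r \<in> e ` S \<times> e ` S \<times> AA" using Rk[OF r(1)] r(2) unfolding AA_def by auto
    qed
    moreover have "X' \<in> e ` S \<rightarrow>\<^sub>E A" using X X' unfolding X'_def by auto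
    ultimately have code: "(e ` S, X', R') \<in> codes"
      using e(2) ordLess_image[OF S, of e] ordLess_image[OF R] unfolding codes_def R'_def by auto
    define b where "b = (SOME b. \<exists>\<beta>. gcolimit C (e ` S) X' R' b \<beta>)"
    have "b \<in> B" unfolding B_def b_def by (rule image_eqI[OF _ code]) simp
    moreover obtain \<beta> where "gcolimit C (e ` S) X' R' b \<beta>" using col[OF code] unfolding b_def by (rule
        exE)
    ultimately have b: "b \<in> B" "gcolimit C (e ` S) X' R' b \<beta>" .
    have "gcolimit C S (X' \<circ> e) R b (\<beta> \<circ> e)" using b(2) unfolding R'_def gcolimit_relabel[OF e(1) RS] .
    moreover have "gcolimit C S (X' \<circ> e) R b (\<beta> \<circ> e) \<longleftrightarrow> gcolimit C S X R b (\<beta> \<circ> e)"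
      by (rule gcolimit_cong[OF _ refl RS]) (simp add: X')
    ultimately have "gcolimit C S X R b (\<beta> \<circ> e)" by (rule iffD1[rotated])
    then show "\<exists>b\<in>B. \<exists>\<beta>. gcolimit C S X R b \<beta>" using b(1) by blast
  qed
qed

lemma is_colimit_imp_Obj: "is_colimit J C G x \<iota> \<Longrightarrow> x \<in> Obj C"
  unfolding is_colimit_def is_cocone_def by blast

text \<open>A \<kappa>-directed presentation of \<open>x\<close> by objects of \<open>A\<close> is
  regrouped into the colimits of all its subdiagrams with fewer than \<mu> vertices. These lie in
  the small set \<open>B\<close> of \<mu>-presentable objects. Using arbitrary vertex sets, directed
  or not, avoids the sharp inequality: unions of fewer than \<mu> of them stay admissible by
  regularity alone.\<close>

lemma cocomplete_accessible_at_mono: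
  fixes U :: "'u set" and C :: "('o, 'm, 'z) cat_scheme"
  assumes U: "inaccessible U" and co: "cocomplete U C" and acc: "accessible_at U \<kappa> C"
    and \<kappa>: "regular_cardinal U \<kappa>" and \<mu>: "regular_cardinal U \<mu>" and le: "\<kappa> \<le>o \<mu>"
  shows "accessible_at U \<mu> C"
proof -
  note \<mu>' = regular_cardinalD[OF \<mu>]
  note C = accessible_atD(1)[OF acc] and ls = accessible_atD(2)[OF acc]
  obtain A where A: "small U A" "\<forall>a\<in>A. presentable U \<kappa> C a"
    "\<forall>x\<in>Obj C. \<exists>J G \<iota>. directed_poset U \<kappa> J \<and> is_functor J C G \<and> OMap G ` Obj J \<subseteq> A \<and> is_colimit J C G
        x \<iota>"
    by (rule accessible_atE[OF acc])
  have AO: "A \<subseteq> Obj C" using A(2) unfolding presentable_def by auto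
  have pres: "presentable U \<mu> C a" if "a \<in> A" for a using presentable_mono[OF bspec[OF A(2) that] le] .
  obtain B where B: "small U B" "\<And>b. b \<in> B \<Longrightarrow> presentable U \<mu> C b"
    "\<And>(S :: 'u set) X R. gdiagram C S X R \<Longrightarrow> X ` S \<subseteq> A \<Longrightarrow> |S| <o \<mu> \<Longrightarrow> |R| <o \<mu> \<Longrightarrow>
      \<exists>b\<in>B. \<exists>\<beta>. gcolimit C S X R b \<beta>"
    by (rule exists_small_set_of_colimits[OF U C ls co \<mu> A(1) AO pres]) blast+
  have "\<exists>J G \<iota>. directed_poset U \<mu> J \<and> is_functor J C G \<and> OMap G ` Obj J \<subseteq> B \<and> is_colimit J C G x \<iota>"
    if x: "x \<in> Obj C" for x
  proof -
    obtain J G \<iota> where J: "directed_poset U \<kappa> J" and G: "is_functor J C G" and GA: "OMap G ` Obj J \<subseteq> A"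
      and col: "is_colimit J C G x \<iota>" using bspec[OF A(3) x] by (elim exE conjE) (rule that)
    interpret G: is_functor J C G by fact
    define P where "P = {S. S \<subseteq> Obj J \<and> |S| <o \<mu>}"
    have gd: "gdiagram C S (OMap G) (full_edges J G S)" if "S \<in> P" for S
      using that G.OMap_Obj G.AMap_Hom unfolding gdiagram_def full_edges_def P_def by auto
    have "\<exists>b \<beta>. b \<in> B \<and> gcolimit C S (OMap G) (full_edges J G S) b \<beta>" if S: "S \<in> P" for S
    proof -
      have "|S| <o \<mu>" "OMap G ` S \<subseteq> A" using S GA unfolding P_def by auto
      then show ?thesis using B(3)[OF gd[OF S]] ordLess_full_edges[OF J \<mu>] by blast
    qed
    then obtain b \<beta> where b: "\<And>S. S \<in> P \<Longrightarrow> b S \<in> B"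
      "\<And>S. S \<in> P \<Longrightarrow> gcolimit C S (OMap G) (full_edges J G S) (b S) (\<beta> S)" by metis
    have P: "P \<subseteq> Pow (Obj J)" unfolding P_def by blast
    have P2: "{i, j} \<in> P" if "i \<in> Obj J" "j \<in> Obj J" for i j
      unfolding P_def using that ordLess_finite[OF \<mu>'(1), of "{i, j}"] by simp
    obtain H \<gamma> where H: "is_functor (subset_cat P) C H" "\<And>S. S \<in> P \<Longrightarrow> OMap H S = b S"
      "is_colimit (subset_cat P) C H x \<gamma>"
      by (rule colimit_of_subdiagram_colimits[OF G col P P2 b(2)]) blast+
    have sP: "small U P"
      using small_subset[OF small_Pow[OF U directed_posetD(2)[OF J]] P] .
    have sP2: "small U (Arr (subset_cat P))"
      by (rule small_subset[OF small_Times[OF U sP sP]]) auto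
    obtain \<phi> where \<phi>: "inj_on \<phi> P" "\<phi> ` P \<subseteq> U" by (rule small_bij_into[OF sP])
    obtain \<psi> where \<psi>: "inj_on \<psi> (Arr (subset_cat P))" "\<psi> ` Arr (subset_cat P) \<subseteq> U"
      by (rule small_bij_into[OF sP2])
    have \<phi>': "inj_on \<phi> (Obj (subset_cat P))" using \<phi>(1) by simp
    note tr = category_subset_cat \<phi>' \<psi>(1)
    let ?J = "transport_cat \<phi> \<psi> (subset_cat P)" and ?H = "transport_fun \<phi> \<psi> (subset_cat P) H"
    have "directed_poset U \<mu> ?J"
    proof (rule directed_poset_transport_subset[OF U sP \<phi>(1) \<psi>(1)])
      fix Q assume Q: "Q \<subseteq> P" "|Q| <o \<mu>"
      have "|\<Union>S\<in>Q. S| <o \<mu>"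
        using Q unfolding P_def by (intro ordLess_UN \<mu>') auto
      then have "\<Union>Q \<in> P" using Q(1) unfolding P_def by auto
      then show "\<exists>T\<in>P. \<forall>S\<in>Q. S \<subseteq> T" by blast
    qed
    moreover have "is_functor ?J C ?H" using tr H(1) by (rule is_functor_transport)
    moreover have "OMap ?H ` Obj ?J \<subseteq> B"
      using b(1) H(2) by (auto simp: transport_cat_simps[OF tr] transport_fun_simps[OF tr])
    moreover have "is_colimit ?J C ?H x (\<gamma> \<circ> inv_into P \<phi>)"
    proof -
      have "edges (subset_cat P) H \<subseteq> Obj (subset_cat P) \<times> Obj (subset_cat P) \<times> UNIV"
        using gdiagram_edge_subset[OF gdiagram_edges[OF H(1)]] .
      from gcolimit_cong[OF _ _ this, of "OMap H" "OMap H" \<gamma> "\<gamma> \<circ> inv_into P \<phi> \<circ> \<phi>" C x]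
      have "is_colimit (subset_cat P) C H x (\<gamma> \<circ> inv_into P \<phi> \<circ> \<phi>)"
        using H(3) \<phi>(1) unfolding is_colimit_iff_gcolimit by simp
      then show ?thesis unfolding is_colimit_transport[OF tr H(1)] .
    qed
    ultimately show ?thesis by blast
  qed
  moreover have "has_directed_colimits U \<mu> C"
    using co unfolding has_directed_colimits_def cocomplete_def directed_poset_def
    by simp
  ultimately show ?thesis by (intro accessible_atI[OF C ls _ B(1,2)])
qed

text \<open>Each \<open>x\<close> is a small colimit of \<kappa>-presentable objects. Once \<mu>
  exceeds the size of all the diagrams used, these are \<mu>-small colimits of \<mu>-presentable
  objects.\<close>

lemma exists_presentability_rank:
  fixes U :: "'u set" and C :: "('o, 'm, 'z) cat_scheme"
  assumes U: "inaccessible U" and acc: "accessible_at U \<kappa> C" and \<kappa>: "regular_cardinal U \<kappa>"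
    and X: "small U X" "X \<subseteq> Obj C"
  obtains \<mu> where "regular_cardinal U \<mu>" "\<kappa> \<le>o \<mu>" "\<And>x. x \<in> X \<Longrightarrow> presentable U \<mu> C x"
proof -
  note C = accessible_atD(1)[OF acc] and ls = accessible_atD(2)[OF acc]
  obtain A where A: "small U A" "\<forall>a\<in>A. presentable U \<kappa> C a"
    "\<forall>x\<in>Obj C. \<exists>J G \<iota>. directed_poset U \<kappa> J \<and> is_functor J C G \<and> OMap G ` Obj J \<subseteq> A \<and> is_colimit J C G
        x \<iota>"
    by (rule accessible_atE[OF acc])
  have "\<exists>J G \<iota>. directed_poset U \<kappa> J \<and> is_functor J C G \<and> OMap G ` Obj J \<subseteq> A \<and> is_colimit J C G x \<iota>"
    if "x \<in> X" for x by (rule bspec[OF A(3) subsetD[OF X(2) that]])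
  then obtain J G \<iota> where J: "\<And>x. x \<in> X \<Longrightarrow> directed_poset U \<kappa> (J x)"
    "\<And>x. x \<in> X \<Longrightarrow> is_functor (J x) C (G x)" "\<And>x. x \<in> X \<Longrightarrow> OMap (G x) ` Obj (J x) \<subseteq> A"
    "\<And>x. x \<in> X \<Longrightarrow> is_colimit (J x) C (G x) x (\<iota> x)" by metis
  \<comment> \<open>Collects the objects and arrows of all chosen shapes, so that one cardinal
    bounds them simultaneously.\<close>
  let ?S = "(\<Union>x\<in>X. Obj (J x)) \<union> (\<Union>x\<in>X. Arr (J x))"
  have S: "small U ?S"
    by (intro small_Un small_UN U X(1) directed_posetD(2)[OF J(1)] directed_posetD(3)[OF J(1)])
  obtain \<mu> where \<mu>: "regular_cardinal U \<mu>" "\<kappa> \<le>o \<mu>" "|?S| <o \<mu>"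
    by (rule exists_regular_cardinal_above[OF U \<kappa> S])
  have "presentable U \<mu> C x" if x: "x \<in> X" for x
  proof (rule presentable_gcolimit[OF U C ls regular_cardinalD(1)[OF \<mu>(1)]])
    show "gcolimit C (Obj (J x)) (OMap (G x)) (edges (J x) (G x)) x (\<iota> x)"
      using J(4)[OF x] unfolding is_colimit_iff_gcolimit .
    show "gdiagram C (Obj (J x)) (OMap (G x)) (edges (J x) (G x))"
      using J(2)[OF x] by (rule gdiagram_edges)
    show "|Obj (J x)| <o \<mu>" by (rule ordLess_subset[OF \<mu>(3)]) (use x in blast)
    have "|Arr (J x)| <o \<mu>" by (rule ordLess_subset[OF \<mu>(3)]) (use x in blast)
    then have "|(\<lambda>u. (Dom (J x) u, Cod (J x) u, AMap (G x) u)) ` Arr (J x)| <o \<mu>" by (rule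
        ordLess_image)
    then show "|edges (J x) (G x)| <o \<mu>"
      by (rule ordLess_subset) (auto simp: edges_def Hom_def)
    show "presentable U \<mu> C (OMap (G x) k)" if "k \<in> Obj (J x)" for k
      by (rule presentable_mono[OF bspec[OF A(2)] \<mu>(2)]) (use J(3)[OF x] that in blast)
  qed
  then show thesis using that \<mu> by blast
qed

section \<open>Pointwise left Kan extensions\<close>

text \<open>
  The comma category \<open>p / d\<close> restricted to objects of \<open>A\<close>, as a graph labelled by \<open>f\<close>.
\<close>

definition comma_obj ::
  "('o2, 'm2, 'z2) cat_scheme \<Rightarrow> 'o1 set \<Rightarrow> ('o1, 'm1, 'o2, 'm2) cfun \<Rightarrow> 'o2 \<Rightarrow> ('o1 \<times> 'm2) set" where
  "comma_obj D A p d = {(a, g). a \<in> A \<and> g \<in> Hom D (OMap p a) d}"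

text \<open>A morphism of the comma category is given by \<open>u\<close> and its target
  \<open>(b, g)\<close>; the commuting triangle then dictates the source, and is built into the
  vertex instead of being imposed as an equation.\<close>

definition comma_edges ::
  "('o1, 'm1, 'z1) cat_scheme \<Rightarrow> ('o2, 'm2, 'z2) cat_scheme \<Rightarrow> 'o1 set \<Rightarrow> ('o1, 'm1, 'o2, 'm2) cfun
    \<Rightarrow> ('o1, 'm1, 'o3, 'm3) cfun \<Rightarrow> 'o2 \<Rightarrow> (('o1 \<times> 'm2) \<times> ('o1 \<times> 'm2) \<times> 'm3) set" where
  "comma_edges C D A p f d = {((a, Comp D g (AMap p u)), (b, g), AMap f u) | a b g u.
    a \<in> A \<and> b \<in> A \<and> u \<in> Hom C a b \<and> g \<in> Hom D (OMap p b) d}"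

lemma gdiagram_comma:
  assumes p: "is_functor C D p" and f: "is_functor C E f" and A: "A \<subseteq> Obj C"
  shows "gdiagram E (comma_obj D A p d) (\<lambda>k. OMap f (fst k)) (comma_edges C D A p f d)"
proof -
  interpret p: is_functor C D p by fact
  interpret f: is_functor C E f by fact
  show ?thesis
    unfolding gdiagram_def comma_obj_def comma_edges_def
    using A f.OMap_Obj f.AMap_Hom p.cod.Comp_Hom[OF p.AMap_Hom] by auto
qed

lemma small_comma_obj:
  assumes U: "inaccessible U" and p: "is_functor C D p" and A: "small U A" "A \<subseteq> Obj C"
    and ls: "locally_small U D" and d: "d \<in> Obj D"
  shows "small U (comma_obj D A p d)"
proof -
  interpret p: is_functor C D p by fact
  have "small U (\<Union>a\<in>A. {a} \<times> Hom D (OMap p a) d)"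
  proof (rule small_UN[OF U A(1)])
    fix a assume "a \<in> A"
    then have "a \<in> Obj C" using A(2) by blast
    then have "OMap p a \<in> Obj D" by (rule p.OMap_Obj)
    then have "small U (Hom D (OMap p a) d)" using ls d unfolding locally_small_def by blast
    then show "small U ({a} \<times> Hom D (OMap p a) d)"
      by (rule small_Times[OF U small_finite[OF U, of "{a}"], simplified])
  qed
  then show ?thesis by (rule small_subset) (auto simp: comma_obj_def)
qed

lemma small_comma_edges:
  assumes U: "inaccessible U" and p: "is_functor C D p" and A: "small U A" "A \<subseteq> Obj C"
    and lsC: "locally_small U C" and ls: "locally_small U D" and d: "d \<in> Obj D"
  shows "small U (comma_edges C D A p f d)"
proof -
  let ?K = "comma_obj D A p d"
  let ?H = "\<Union>a\<in>A. \<Union>b\<in>A. Hom C a b"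
  interpret p: is_functor C D p by fact
  have K: "small U ?K" using U p A ls d by (rule small_comma_obj)
  have H: "small U ?H" using U lsC A by (rule small_Hom_family)
  have "small U (?K \<times> ?K \<times> AMap f ` ?H)"
    by (rule small_Times[OF U K small_Times[OF U K small_image[OF H]]])
  then show ?thesis
    by (rule small_subset)
      (auto simp: comma_edges_def comma_obj_def intro: p.cod.Comp_Hom[OF p.AMap_Hom])
qed

text \<open>
  A functor preserving the colimit by which \<open>x\<close> is built from presentable objects in \<open>A\<close> also
  preserves the canonical colimit over all arrows from \<open>A\<close> to \<open>x\<close>: these factor through the former.
\<close>

lemma canonical_gcolimit:
  assumes f: "is_functor C E f" and G: "is_functor J C G" and GA: "OMap G ` Obj J \<subseteq> A" and A: "A \<subseteq> Obj
      C"
    and x: "is_colimit J C G x \<iota>" and fx: "is_colimit J E (cfun_comp J f G) (OMap f x) (\<lambda>j. AMap f (\<iota>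
        j))"
    and ef: "\<And>a. a \<in> A \<Longrightarrow> category.ess_factors C a J G x \<iota>"
  shows "gcolimit E (comma_obj C A (id_fun C) x) (\<lambda>k. OMap f (fst k)) (comma_edges C C A (id_fun C) f x)
    (OMap f x) (\<lambda>k. AMap f (snd k))"
proof -
  interpret f: is_functor C E f by fact
  interpret G: is_functor J C G by fact
  have cc: "is_cocone J C G x \<iota>" using x unfolding is_colimit_def by (rule conjunct1)
  have xO: "x \<in> Obj C" using x by (rule is_colimit_imp_Obj)
  have \<iota>: "\<iota> j \<in> Hom C (OMap G j) x" if "j \<in> Obj J" for j using cc that unfolding is_cocone_def by blast
  have \<iota>G: "Comp C (\<iota> j) (AMap G u) = \<iota> i" if "i \<in> Obj J" "j \<in> Obj J" "u \<in> Hom J i j" for i j u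
    using cc that unfolding is_cocone_def by blast
  have KI: "(a, g) \<in> comma_obj C A (id_fun C) x \<longleftrightarrow> a \<in> A \<and> g \<in> Hom C a x" for a g
    using A by (auto simp: comma_obj_def)
  have RI: "((a, Comp C g u), (b, g), AMap f u) \<in> comma_edges C C A (id_fun C) f x"
    if "a \<in> A" "b \<in> A" "u \<in> Hom C a b" "g \<in> Hom C b x" for a b g u
  proof -
    have id: "OMap (id_fun C) b = b" "AMap (id_fun C) u = u" using that A f.dom.HomD(1)[OF that(3)] by
        auto
    have "g \<in> Hom C (OMap (id_fun C) b) x" using that(4) id(1) by simp
    then have "((a, Comp C g (AMap (id_fun C) u)), (b, g), AMap f u) \<in> comma_edges C C A (id_fun C) f x"
      unfolding comma_edges_def using that(1-3) by blast
    then show ?thesis unfolding id(2) .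
  qed
  \<comment> \<open>The given presentation of \<open>x\<close> sits inside the canonical diagram:
    the leg \<open>\<iota> j\<close> is itself a vertex. A cocone on the canonical diagram therefore
    restricts to one on \<open>f \<circ> G\<close>.\<close>
  have JA: "j \<in> Obj J \<Longrightarrow> (OMap G j, \<iota> j) \<in> comma_obj C A (id_fun C) x" for j
    using GA \<iota> unfolding KI by blast
  have gfx: "gcolimit E (Obj J) (OMap (cfun_comp J f G)) (edges J (cfun_comp J f G)) (OMap f x) (\<lambda>j.
      AMap f (\<iota> j))"
    using fx unfolding is_colimit_iff_gcolimit .
  show ?thesis
  proof (rule f.cod.gcolimitI)
    show "gcocone E (comma_obj C A (id_fun C) x) (\<lambda>k. OMap f (fst k)) (comma_edges C C A (id_fun C) f x)
      (OMap f x) (\<lambda>k. AMap f (snd k))"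
      unfolding gcocone_def
    proof (intro conjI ballI; clarify?)
      show "OMap f x \<in> Obj E" using xO by (rule f.OMap_Obj)
      show "AMap f (snd (a, g)) \<in> Hom E (OMap f (fst (a, g))) (OMap f x)"
        if "(a, g) \<in> comma_obj C A (id_fun C) x" for a g
        using that f.AMap_Hom unfolding KI by simp
      fix a g b g' v assume "((a, g), (b, g'), v) \<in> comma_edges C C A (id_fun C) f x"
      then obtain u where u: "a \<in> A" "b \<in> A" "u \<in> Hom C a b" "g' \<in> Hom C (OMap (id_fun C) b) x"
        "g = Comp C g' (AMap (id_fun C) u)" "v = AMap f u" unfolding comma_edges_def by blast
      have "OMap (id_fun C) b = b" "AMap (id_fun C) u = u" using u A f.dom.HomD(1)[OF u(3)] by auto
      then show "Comp E (AMap f (snd (b, g'))) v = AMap f (snd (a, g))"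
        using f.AMap_Comp[OF u(3), of g' x] u by simp
    qed
  next
    fix y \<tau> assume t: "gcocone E (comma_obj C A (id_fun C) x) (\<lambda>k. OMap f (fst k)) (comma_edges C C A
        (id_fun C) f x) y \<tau>"
    note \<tau> = gcoconeD[OF t]
    have "is_cocone J E (cfun_comp J f G) y (\<lambda>j. \<tau> (OMap G j, \<iota> j))"
      unfolding is_cocone_def
    proof (intro conjI ballI)
      show "y \<in> Obj E" using \<tau>(1) .
      show "\<tau> (OMap G j, \<iota> j) \<in> Hom E (OMap (cfun_comp J f G) j) y" if "j \<in> Obj J" for j
        using \<tau>(2)[OF JA[OF that]] that by simp
      fix i j u assume *: "i \<in> Obj J" "j \<in> Obj J" "u \<in> Hom J i j"
      have "OMap G i \<in> A" "OMap G j \<in> A" using GA * by auto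
      from RI[OF this G.AMap_Hom[OF *(3)] \<iota>[OF *(2)]]
      have "((OMap G i, \<iota> i), (OMap G j, \<iota> j), AMap f (AMap G u)) \<in> comma_edges C C A (id_fun C) f x"
        unfolding \<iota>G[OF *] .
      then show "Comp E (\<tau> (OMap G j, \<iota> j)) (AMap (cfun_comp J f G) u) = \<tau> (OMap G i, \<iota> i)"
        using \<tau>(3) G.dom.HomD(1)[OF *(3)] by simp
    qed
    then have "gcocone E (Obj J) (OMap (cfun_comp J f G)) (edges J (cfun_comp J f G)) y (\<lambda>j. \<tau> (OMap G
        j, \<iota> j))"
      unfolding is_cocone_iff_gcocone .
    then obtain h where h: "h \<in> Hom E (OMap f x) y" "\<And>j. j \<in> Obj J \<Longrightarrow> Comp E h (AMap f (\<iota> j)) = \<tau> (OMap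
        G j, \<iota> j)"
      by (rule gcolimit_factor[OF gfx]) blast
    \<comment> \<open>A factorization of \<open>g\<close> through \<open>\<iota> j\<close> is an
      edge from \<open>(a, g)\<close> to the vertex of \<open>\<iota> j\<close>, where the equation
      is already known.\<close>
    have "Comp E h (AMap f g) = \<tau> (a, g)" if ag: "a \<in> A" "g \<in> Hom C a x" for a g
    proof -
      obtain j u where u: "j \<in> Obj J" "u \<in> Hom C a (OMap G j)" "g = Comp C (\<iota> j) u"
        by (rule f.dom.ess_factorsD1[OF ef[OF ag(1)] ag(2)])
      have "OMap G j \<in> A" using GA u by auto
      from RI[OF ag(1) this u(2) \<iota>[OF u(1)]]
      have "Comp E (\<tau> (OMap G j, \<iota> j)) (AMap f u) = \<tau> (a, g)" using \<tau>(3) u(3) by blast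
      then show ?thesis
        using f.cod.Comp_assoc[OF f.AMap_Hom[OF u(2)] f.AMap_Hom[OF \<iota>[OF u(1)]] h(1)] h(2)[OF u(1)]
          f.AMap_Comp[OF u(2) \<iota>[OF u(1)]] u(3) by simp
    qed
    then show "\<exists>h. h \<in> Hom E (OMap f x) y \<and> (\<forall>k\<in>comma_obj C A (id_fun C) x. Comp E h (AMap f (snd k))
        = \<tau> k)"
      using h(1) KI by auto
  next
    fix y h h' assume h: "h \<in> Hom E (OMap f x) y" "h' \<in> Hom E (OMap f x) y"
      and eq: "\<And>k. k \<in> comma_obj C A (id_fun C) x \<Longrightarrow> Comp E h (AMap f (snd k)) = Comp E h' (AMap f (snd
          k))"
    show "h = h'"
    proof (rule f.cod.gcolimit_eqI[OF gfx h _ gdiagram_edges[OF is_functor_comp[OF G f]]])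
      fix j assume "j \<in> Obj J"
      then show "Comp E h (AMap f (\<iota> j)) = Comp E h' (AMap f (\<iota> j))" using eq[OF JA] by simp
    qed
  qed
qed

text \<open>Taking the comma diagram for \<open>id_fun C\<close>, \<open>canonical\<close> says that
  \<open>f\<close> is the pointwise extension of its restriction to the full subcategory on
  \<open>A\<close>. Extending \<open>f\<close> along \<open>p\<close> then amounts to extending that
  restriction along the restriction of \<open>p\<close>, and the objects \<open>Lo d\<close> with
  legs \<open>incl d\<close> are the pointwise formula for the latter.\<close>

locale pointwise_lan = p: is_functor C D p + f: is_functor C E f
  for C :: "('o1, 'm1, 'z1) cat_scheme" and D :: "('o2, 'm2, 'z2) cat_scheme"
    and E :: "('o3, 'm3, 'z3) cat_scheme" and p f +
  fixes A :: "'o1 set" and Lo :: "'o2 \<Rightarrow> 'o3" and incl :: "'o2 \<Rightarrow> 'o1 \<times> 'm2 \<Rightarrow> 'm3"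
  assumes A: "A \<subseteq> Obj C"
    and canonical: "x \<in> Obj C \<Longrightarrow> gcolimit E (comma_obj C A (id_fun C) x) (\<lambda>k. OMap f (fst k))
      (comma_edges C C A (id_fun C) f x) (OMap f x) (\<lambda>k. AMap f (snd k))"
    and Lo: "d \<in> Obj D \<Longrightarrow> gcolimit E (comma_obj D A p d) (\<lambda>k. OMap f (fst k))
      (comma_edges C D A p f d) (Lo d) (incl d)"
begin

section \<open>Calculus of the legs and of the canonical colimits\<close>

lemma AO: "a \<in> A \<Longrightarrow> a \<in> Obj C" using A by blast

lemma Lo_Obj: "d \<in> Obj D \<Longrightarrow> Lo d \<in> Obj E"
  using gcoconeD(1)[OF gcolimit_gcocone[OF Lo]] .

lemma incl_Hom: "a \<in> A \<Longrightarrow> g \<in> Hom D (OMap p a) d \<Longrightarrow> incl d (a, g) \<in> Hom E (OMap f a) (Lo d)"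
  using gcoconeD(2)[OF gcolimit_gcocone[OF Lo], of d "(a, g)"] p.cod.HomD(5)[of g]
  by (simp add: comma_obj_def)

lemma incl_edge:
  assumes "a \<in> A" "b \<in> A" "u \<in> Hom C a b" "g \<in> Hom D (OMap p b) d"
  shows "Comp E (incl d (b, g)) (AMap f u) = incl d (a, Comp D g (AMap p u))"
proof (rule gcoconeD(3)[OF gcolimit_gcocone[OF Lo]])
  show "d \<in> Obj D" using p.cod.HomD(5)[OF assms(4)] .
  show "((a, Comp D g (AMap p u)), (b, g), AMap f u) \<in> comma_edges C D A p f d"
    unfolding comma_edges_def using assms by blast
qed

lemma incl_eqI:
  assumes "d \<in> Obj D" "h \<in> Hom E (Lo d) y" "h' \<in> Hom E (Lo d) y"
    and eq: "\<And>a g. a \<in> A \<Longrightarrow> g \<in> Hom D (OMap p a) d \<Longrightarrow> Comp E h (incl d (a, g)) = Comp E h' (incl d (a,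
        g))"
  shows "h = h'"
proof (rule f.cod.gcolimit_eqI[OF Lo[OF assms(1)] assms(2,3) _ gdiagram_comma[OF p.is_functor_axioms
    f.is_functor_axioms A]])
  fix k assume "k \<in> comma_obj D A p d"
  then show "Comp E h (incl d k) = Comp E h' (incl d k)" using eq unfolding comma_obj_def by blast
qed

lemma incl_factor:
  assumes "d \<in> Obj D" "y \<in> Obj E"
    and \<tau>: "\<And>a g. a \<in> A \<Longrightarrow> g \<in> Hom D (OMap p a) d \<Longrightarrow> \<tau> a g \<in> Hom E (OMap f a) y"
    and \<tau>u: "\<And>a b u g. a \<in> A \<Longrightarrow> b \<in> A \<Longrightarrow> u \<in> Hom C a b \<Longrightarrow> g \<in> Hom D (OMap p b) d \<Longrightarrow>
      Comp E (\<tau> b g) (AMap f u) = \<tau> a (Comp D g (AMap p u))"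
  shows "\<exists>h. h \<in> Hom E (Lo d) y \<and>
    (\<forall>a\<in>A. \<forall>g\<in>Hom D (OMap p a) d. Comp E h (incl d (a, g)) = \<tau> a g)"
proof -
  have "gcocone E (comma_obj D A p d) (\<lambda>k. OMap f (fst k)) (comma_edges C D A p f d) y (\<lambda>k. \<tau> (fst k)
      (snd k))"
    unfolding gcocone_def comma_obj_def comma_edges_def using assms(2) \<tau> \<tau>u by auto
  then obtain h where h: "h \<in> Hom E (Lo d) y" "\<And>k. k \<in> comma_obj D A p d \<Longrightarrow> Comp E h (incl d k) = \<tau>
      (fst k) (snd k)"
    by (rule gcolimit_factor[OF Lo[OF assms(1)]]) blast
  have "\<forall>a\<in>A. \<forall>g\<in>Hom D (OMap p a) d. Comp E h (incl d (a, g)) = \<tau> a g"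
    using h(2) unfolding comma_obj_def by simp
  then show ?thesis using h(1) by blast
qed

lemma canonical_eqI:
  assumes "x \<in> Obj C" "h \<in> Hom E (OMap f x) y" "h' \<in> Hom E (OMap f x) y"
    and eq: "\<And>a g. a \<in> A \<Longrightarrow> g \<in> Hom C a x \<Longrightarrow> Comp E h (AMap f g) = Comp E h' (AMap f g)"
  shows "h = h'"
proof (rule f.cod.gcolimit_eqI[OF canonical[OF assms(1)] assms(2,3) _
    gdiagram_comma[OF is_functor_id[OF p.dom.category_axioms] f.is_functor_axioms A]])
  fix k assume "k \<in> comma_obj C A (id_fun C) x"
  then have "fst k \<in> A" "snd k \<in> Hom C (fst k) x" using AO unfolding comma_obj_def by auto
  then show "Comp E h (AMap f (snd k)) = Comp E h' (AMap f (snd k))" by (rule eq)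
qed

lemma canonical_factor:
  assumes "x \<in> Obj C" "y \<in> Obj E"
    and \<tau>: "\<And>a g. a \<in> A \<Longrightarrow> g \<in> Hom C a x \<Longrightarrow> \<tau> a g \<in> Hom E (OMap f a) y"
    and \<tau>u: "\<And>a b u g. a \<in> A \<Longrightarrow> b \<in> A \<Longrightarrow> u \<in> Hom C a b \<Longrightarrow> g \<in> Hom C b x \<Longrightarrow>
      Comp E (\<tau> b g) (AMap f u) = \<tau> a (Comp C g u)"
  shows "\<exists>h. h \<in> Hom E (OMap f x) y \<and>
    (\<forall>a\<in>A. \<forall>g\<in>Hom C a x. Comp E h (AMap f g) = \<tau> a g)"
proof -
  have "gcocone E (comma_obj C A (id_fun C) x) (\<lambda>k. OMap f (fst k)) (comma_edges C C A (id_fun C) f x)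
      y (\<lambda>k. \<tau> (fst k) (snd k))"
    unfolding gcocone_def comma_obj_def comma_edges_def using assms(2) \<tau> \<tau>u AO p.dom.HomD(1) by auto
  then obtain h where h: "h \<in> Hom E (OMap f x) y"
    "\<And>k. k \<in> comma_obj C A (id_fun C) x \<Longrightarrow> Comp E h (AMap f (snd k)) = \<tau> (fst k) (snd k)"
    by (rule gcolimit_factor[OF canonical[OF assms(1)]]) blast
  have "\<forall>a\<in>A. \<forall>g\<in>Hom C a x. Comp E h (AMap f g) = \<tau> a g"
  proof (intro ballI)
    fix a g assume "a \<in> A" "g \<in> Hom C a x"
    then have "(a, g) \<in> comma_obj C A (id_fun C) x" using AO by (simp add: comma_obj_def)
    from h(2)[OF this] show "Comp E h (AMap f g) = \<tau> a g" by simp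
  qed
  then show ?thesis using h(1) by blast
qed

text \<open>Composition with \<open>h\<close> sends vertices and edges over \<open>d\<close> to
  vertices and edges over \<open>d'\<close>, so the legs at \<open>d'\<close> restrict to a cocone
  over \<open>d\<close>.\<close>

lemma Lan_arrow_exists:
  assumes h: "h \<in> Hom D d d'"
  shows "\<exists>l. l \<in> Hom E (Lo d) (Lo d') \<and>
    (\<forall>a\<in>A. \<forall>g\<in>Hom D (OMap p a) d. Comp E l (incl d (a, g)) = incl d' (a, Comp D h g))"
proof (rule incl_factor)
  show "d \<in> Obj D" "Lo d' \<in> Obj E" using p.cod.HomD[OF h] Lo_Obj by auto
  show "incl d' (a, Comp D h g) \<in> Hom E (OMap f a) (Lo d')" if "a \<in> A" "g \<in> Hom D (OMap p a) d" for a g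
    using incl_Hom[OF that(1) p.cod.Comp_Hom[OF that(2) h]] .
  show "Comp E (incl d' (b, Comp D h g)) (AMap f u) = incl d' (a, Comp D h (Comp D g (AMap p u)))"
    if "a \<in> A" "b \<in> A" "u \<in> Hom C a b" "g \<in> Hom D (OMap p b) d" for a b u g
    using incl_edge[OF that(1-3) p.cod.Comp_Hom[OF that(4) h]] p.cod.Comp_assoc[OF p.AMap_Hom[OF
        that(3)] that(4) h]
    by simp
qed

definition L_arr :: "'m2 \<Rightarrow> 'm3" where
  "L_arr h = (SOME l. l \<in> Hom E (Lo (Dom D h)) (Lo (Cod D h)) \<and>
    (\<forall>a\<in>A. \<forall>g\<in>Hom D (OMap p a) (Dom D h). Comp E l (incl (Dom D h) (a, g)) = incl (Cod D h) (a, Comp D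
        h g)))"

definition L :: "('o2, 'm2, 'o3, 'm3) cfun" where
  "L = \<lparr>OMap = (\<lambda>d\<in>Obj D. Lo d), AMap = (\<lambda>h\<in>Arr D. L_arr h)\<rparr>"

lemma L_simps:
  "d \<in> Obj D \<Longrightarrow> OMap L d = Lo d"
  "h \<in> Arr D \<Longrightarrow> AMap L h = L_arr h"
  by (simp_all add: L_def)

lemma L_arr:
  assumes "h \<in> Hom D d d'"
  shows "L_arr h \<in> Hom E (Lo d) (Lo d')"
    "a \<in> A \<Longrightarrow> g \<in> Hom D (OMap p a) d \<Longrightarrow> Comp E (L_arr h) (incl d (a, g)) = incl d' (a, Comp D h g)"
  using someI_ex[OF Lan_arrow_exists[OF assms]] p.cod.HomD(2,3)[OF assms] unfolding L_arr_def by
      simp_all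

lemma is_functor_L: "is_functor D E L"
proof
  show "OMap L \<in> extensional (Obj D)" "AMap L \<in> extensional (Arr D)" by (simp_all add: L_def)
  show "OMap L d \<in> Obj E" if "d \<in> Obj D" for d using that by (simp add: L_simps Lo_Obj)
  show "AMap L h \<in> Hom E (OMap L d) (OMap L d')" if "h \<in> Hom D d d'" for h d d'
    using L_arr(1)[OF that] p.cod.HomD[OF that] by (simp add: L_simps)
  show "AMap L (Ident D d) = Ident E (OMap L d)" if d: "d \<in> Obj D" for d
  proof -
    note I = p.cod.Ident_Hom[OF d]
    have "L_arr (Ident D d) = Ident E (Lo d)"
    proof (rule incl_eqI[OF d L_arr(1)[OF I] f.cod.Ident_Hom[OF Lo_Obj[OF d]]])
      fix a g assume ag: "a \<in> A" "g \<in> Hom D (OMap p a) d"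
      show "Comp E (L_arr (Ident D d)) (incl d (a, g)) = Comp E (Ident E (Lo d)) (incl d (a, g))"
        using L_arr(2)[OF I ag] p.cod.Ident_Comp[OF ag(2)] f.cod.Ident_Comp[OF incl_Hom[OF ag]] by simp
    qed
    then show ?thesis using d p.cod.HomD(1)[OF I] by (simp add: L_simps)
  qed
  show "AMap L (Comp D k h) = Comp E (AMap L k) (AMap L h)" if h: "h \<in> Hom D d d'" and k: "k \<in> Hom D
      d' d''"
    for h k d d' d''
  proof -
    note kh = p.cod.Comp_Hom[OF h k]
    have d: "d \<in> Obj D" using p.cod.HomD[OF h] by blast
    have "L_arr (Comp D k h) = Comp E (L_arr k) (L_arr h)"
    proof (rule incl_eqI[OF d L_arr(1)[OF kh] f.cod.Comp_Hom[OF L_arr(1)[OF h] L_arr(1)[OF k]]])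
      fix a g assume ag: "a \<in> A" "g \<in> Hom D (OMap p a) d"
      have hg: "Comp D h g \<in> Hom D (OMap p a) d'" using p.cod.Comp_Hom[OF ag(2) h] .
      have "Comp E (Comp E (L_arr k) (L_arr h)) (incl d (a, g)) = incl d'' (a, Comp D k (Comp D h g))"
        using f.cod.Comp_assoc[OF incl_Hom[OF ag] L_arr(1)[OF h] L_arr(1)[OF k]] L_arr(2)[OF h ag]
          L_arr(2)[OF k ag(1) hg] by simp
      then show "Comp E (L_arr (Comp D k h)) (incl d (a, g)) = Comp E (Comp E (L_arr k) (L_arr h))
          (incl d (a, g))"
        using L_arr(2)[OF kh ag] p.cod.Comp_assoc[OF ag(2) h k] by simp
    qed
    then show ?thesis using p.cod.HomD(1)[OF kh] p.cod.HomD(1)[OF h] p.cod.HomD(1)[OF k] by (simp add: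
        L_simps)
  qed
qed

text \<open>Applying \<open>p\<close> maps the canonical diagram of \<open>x\<close> into the comma
  diagram of \<open>p x\<close>; the unit is the induced arrow between the colimits.\<close>

lemma unit_exists:
  assumes x: "x \<in> Obj C"
  shows "\<exists>e. e \<in> Hom E (OMap f x) (Lo (OMap p x)) \<and>
    (\<forall>a\<in>A. \<forall>g\<in>Hom C a x. Comp E e (AMap f g) = incl (OMap p x) (a, AMap p g))"
proof (rule canonical_factor[OF x Lo_Obj[OF p.OMap_Obj[OF x]]])
  show "incl (OMap p x) (a, AMap p g) \<in> Hom E (OMap f a) (Lo (OMap p x))" if "a \<in> A" "g \<in> Hom C a x"
      for a g
    using incl_Hom[OF that(1) p.AMap_Hom[OF that(2)]] .
  show "Comp E (incl (OMap p x) (b, AMap p g)) (AMap f u) = incl (OMap p x) (a, AMap p (Comp C g u))"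
    if "a \<in> A" "b \<in> A" "u \<in> Hom C a b" "g \<in> Hom C b x" for a b u g
    using incl_edge[OF that(1-3) p.AMap_Hom[OF that(4)]] p.AMap_Comp[OF that(3,4)] by simp
qed

definition unit :: "'o1 \<Rightarrow> 'm3" where
  "unit = (\<lambda>x\<in>Obj C. SOME e. e \<in> Hom E (OMap f x) (Lo (OMap p x)) \<and>
    (\<forall>a\<in>A. \<forall>g\<in>Hom C a x. Comp E e (AMap f g) = incl (OMap p x) (a, AMap p g)))"

lemma unit_props:
  assumes "x \<in> Obj C"
  shows "unit x \<in> Hom E (OMap f x) (Lo (OMap p x))"
    "a \<in> A \<Longrightarrow> g \<in> Hom C a x \<Longrightarrow> Comp E (unit x) (AMap f g) = incl (OMap p x) (a, AMap p g)"
  using someI_ex[OF unit_exists[OF assms]] assms unfolding unit_def by simp_all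

text \<open>The vertex \<open>(a, Ident C a)\<close> of the canonical diagram determines
  \<open>unit a\<close>. Consequently every leg \<open>incl d (a, g)\<close> is \<open>L g\<close>
  after \<open>unit a\<close>, which later pins down transformations out of
  \<open>L\<close>.\<close>

lemma unit_at_A:
  assumes a: "a \<in> A" shows "unit a = incl (OMap p a) (a, Ident D (OMap p a))"
proof -
  note aC = AO[OF a]
  show ?thesis
    using unit_props(2)[OF aC a p.dom.Ident_Hom[OF aC]] f.AMap_Ident[OF aC] p.AMap_Ident[OF aC]
      f.cod.Comp_Ident[OF unit_props(1)[OF aC]] by simp
qed

lemma nat_trans_unit: "nat_trans C E f (cfun_comp C L p) unit"
proof -
  interpret Lp: is_functor C E "cfun_comp C L p" using p.is_functor_axioms is_functor_L by (rule
      is_functor_comp)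
  show ?thesis
  proof
    show "unit \<in> extensional (Obj C)" by (simp add: unit_def)
    show "unit x \<in> Hom E (OMap f x) (OMap (cfun_comp C L p) x)" if "x \<in> Obj C" for x
      using unit_props(1)[OF that] that by (simp add: L_simps p.OMap_Obj)
    fix h x y assume h: "h \<in> Hom C x y"
    note xy = p.dom.HomD[OF h]
    note ph = p.AMap_Hom[OF h]
    have "Comp E (unit y) (AMap f h) = Comp E (L_arr (AMap p h)) (unit x)"
    proof (rule canonical_eqI[OF xy(4)])
      show "Comp E (unit y) (AMap f h) \<in> Hom E (OMap f x) (Lo (OMap p y))"
        using f.cod.Comp_Hom[OF f.AMap_Hom[OF h] unit_props(1)[OF xy(5)]] .
      show "Comp E (L_arr (AMap p h)) (unit x) \<in> Hom E (OMap f x) (Lo (OMap p y))"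
        using f.cod.Comp_Hom[OF unit_props(1)[OF xy(4)] L_arr(1)[OF ph]] .
      fix a g assume ag: "a \<in> A" "g \<in> Hom C a x"
      have "Comp E (Comp E (unit y) (AMap f h)) (AMap f g) = incl (OMap p y) (a, AMap p (Comp C h g))"
        using f.cod.Comp_assoc[OF f.AMap_Hom[OF ag(2)] f.AMap_Hom[OF h] unit_props(1)[OF xy(5)]]
          f.AMap_Comp[OF ag(2) h] unit_props(2)[OF xy(5) ag(1) p.dom.Comp_Hom[OF ag(2) h]] by simp
      moreover have "Comp E (Comp E (L_arr (AMap p h)) (unit x)) (AMap f g) = incl (OMap p y) (a, AMap
          p (Comp C h g))"
        using f.cod.Comp_assoc[OF f.AMap_Hom[OF ag(2)] unit_props(1)[OF xy(4)] L_arr(1)[OF ph]]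
          unit_props(2)[OF xy(4) ag] L_arr(2)[OF ph ag(1) p.AMap_Hom[OF ag(2)]] p.AMap_Comp[OF ag(2)
              h] by simp
      ultimately show "Comp E (Comp E (unit y) (AMap f h)) (AMap f g) =
        Comp E (Comp E (L_arr (AMap p h)) (unit x)) (AMap f g)" by simp
    qed
    then show "Comp E (unit y) (AMap f h) = Comp E (AMap (cfun_comp C L p) h) (unit x)"
      using xy(1) p.cod.HomD(1)[OF ph] by (simp add: L_simps)
  qed
qed

text \<open>On the leg at \<open>(a, g)\<close> a transformation with mate \<sigma> has to be
  \<open>R g\<close> after \<open>\<sigma> a\<close>. This determines it, and naturality of \<sigma>
  shows that the prescription is a cocone.\<close>

lemma left_kan_extension_L: "left_kan_extension C D E p f L unit"
  unfolding left_kan_extension_def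
proof (intro conjI allI impI)
  show "is_functor C D p" "is_functor C E f" "is_functor D E L" "nat_trans C E f (cfun_comp C L p) unit"
    using p.is_functor_axioms f.is_functor_axioms is_functor_L nat_trans_unit by auto
  fix R \<sigma> assume R\<sigma>: "is_functor D E R \<and> nat_trans C E f (cfun_comp C R p) \<sigma>"
  interpret R: is_functor D E R using R\<sigma> by blast
  interpret \<sigma>: nat_trans C E f "cfun_comp C R p" \<sigma> using R\<sigma> by blast
  have \<sigma>: "\<sigma> x \<in> Hom E (OMap f x) (OMap R (OMap p x))" if "x \<in> Obj C" for x using \<sigma>.comp_Hom[OF that]
      that by simp
  have \<sigma>n: "Comp E (\<sigma> y) (AMap f h) = Comp E (AMap R (AMap p h)) (\<sigma> x)" if "h \<in> Hom C x y" for h x y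
    using \<sigma>.naturality[OF that] p.dom.HomD(1)[OF that] by simp
  \<comment> \<open>The component at \<open>d\<close> is induced by the arrows
    \<open>R g \<circ> \<sigma> a\<close>; compatibility with an edge \<open>u\<close> is naturality
    of \<sigma> at \<open>u\<close>.\<close>
  have "\<exists>t. t \<in> Hom E (Lo d) (OMap R d) \<and>
    (\<forall>a\<in>A. \<forall>g\<in>Hom D (OMap p a) d. Comp E t (incl d (a, g)) = Comp E (AMap R g) (\<sigma> a))" if d: "d \<in> Obj
        D" for d
  proof (rule incl_factor[OF d R.OMap_Obj[OF d]])
    show "Comp E (AMap R g) (\<sigma> a) \<in> Hom E (OMap f a) (OMap R d)" if "a \<in> A" "g \<in> Hom D (OMap p a) d"
        for a g
      using f.cod.Comp_Hom[OF \<sigma>[OF AO[OF that(1)]] R.AMap_Hom[OF that(2)]] .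
    show "Comp E (Comp E (AMap R g) (\<sigma> b)) (AMap f u) = Comp E (AMap R (Comp D g (AMap p u))) (\<sigma> a)"
      if *: "a \<in> A" "b \<in> A" "u \<in> Hom C a b" "g \<in> Hom D (OMap p b) d" for a b u g
      using f.cod.Comp_assoc[OF f.AMap_Hom[OF *(3)] \<sigma>[OF AO[OF *(2)]] R.AMap_Hom[OF *(4)]] \<sigma>n[OF *(3)]
        f.cod.Comp_assoc[OF \<sigma>[OF AO[OF *(1)]] R.AMap_Hom[OF p.AMap_Hom[OF *(3)]] R.AMap_Hom[OF *(4)]]
        R.AMap_Comp[OF p.AMap_Hom[OF *(3)] *(4)] by simp
  qed
  then obtain t where t: "\<And>d. d \<in> Obj D \<Longrightarrow> t d \<in> Hom E (Lo d) (OMap R d)"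
    "\<And>d a g. d \<in> Obj D \<Longrightarrow> a \<in> A \<Longrightarrow> g \<in> Hom D (OMap p a) d \<Longrightarrow> Comp E (t d) (incl d (a, g)) = Comp E (AMap
        R g) (\<sigma> a)"
    by metis
  let ?t = "\<lambda>d\<in>Obj D. t d"
  show "\<exists>!\<tau>. nat_trans D E L R \<tau> \<and> vcomp C E (whisker_right C \<tau> p) unit = \<sigma>"
  proof (rule ex1I)
    interpret L: is_functor D E L by (rule is_functor_L)
    have "nat_trans D E L R ?t"
    proof
      show "?t \<in> extensional (Obj D)" by simp
      show "?t d \<in> Hom E (OMap L d) (OMap R d)" if "d \<in> Obj D" for d using t(1)[OF that] that by (simp
          add: L_simps)
      fix h d d' assume h: "h \<in> Hom D d d'"
      note dd = p.cod.HomD[OF h]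
      have "Comp E (t d') (L_arr h) = Comp E (AMap R h) (t d)"
      proof (rule incl_eqI[OF dd(4) f.cod.Comp_Hom[OF L_arr(1)[OF h] t(1)[OF dd(5)]] f.cod.Comp_Hom[OF
          t(1)[OF dd(4)] R.AMap_Hom[OF h]]])
        fix a g assume ag: "a \<in> A" "g \<in> Hom D (OMap p a) d"
        show "Comp E (Comp E (t d') (L_arr h)) (incl d (a, g)) = Comp E (Comp E (AMap R h) (t d))
            (incl d (a, g))"
          using f.cod.Comp_assoc[OF incl_Hom[OF ag] L_arr(1)[OF h] t(1)[OF dd(5)]] L_arr(2)[OF h ag]
            t(2)[OF dd(5) ag(1) p.cod.Comp_Hom[OF ag(2) h]] t(2)[OF dd(4) ag]
            f.cod.Comp_assoc[OF incl_Hom[OF ag] t(1)[OF dd(4)] R.AMap_Hom[OF h]]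
            f.cod.Comp_assoc[OF \<sigma>[OF AO[OF ag(1)]] R.AMap_Hom[OF ag(2)] R.AMap_Hom[OF h]]
            R.AMap_Comp[OF ag(2) h] by simp
      qed
      then show "Comp E (?t d') (AMap L h) = Comp E (AMap R h) (?t d)" using dd by (simp add: L_simps)
    qed
    moreover have "vcomp C E (whisker_right C ?t p) unit = \<sigma>"
    proof (rule extensionalityI[OF _ \<sigma>.comp_ext])
      show "vcomp C E (whisker_right C ?t p) unit \<in> extensional (Obj C)" by (simp add: vcomp_def)
      fix x assume x: "x \<in> Obj C"
      note px = p.OMap_Obj[OF x]
      \<comment> \<open>The equation is checked after each \<open>f g\<close> with
        \<open>g : a \<rightarrow> x\<close> and \<open>a \<in> A\<close>; these arrows are jointly
        epic by the canonical colimit.\<close>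
      have "Comp E (t (OMap p x)) (unit x) = \<sigma> x"
      proof (rule canonical_eqI[OF x f.cod.Comp_Hom[OF unit_props(1)[OF x] t(1)[OF px]] \<sigma>[OF x]])
        fix a g assume ag: "a \<in> A" "g \<in> Hom C a x"
        show "Comp E (Comp E (t (OMap p x)) (unit x)) (AMap f g) = Comp E (\<sigma> x) (AMap f g)"
          using f.cod.Comp_assoc[OF f.AMap_Hom[OF ag(2)] unit_props(1)[OF x] t(1)[OF px]]
              unit_props(2)[OF x ag]
            t(2)[OF px ag(1) p.AMap_Hom[OF ag(2)]] \<sigma>n[OF ag(2)] by simp
      qed
      then show "vcomp C E (whisker_right C ?t p) unit x = \<sigma> x"
        using x px by (simp add: vcomp_def whisker_right_def)
    qed
    ultimately show "nat_trans D E L R ?t \<and> vcomp C E (whisker_right C ?t p) unit = \<sigma>" by blast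
    fix \<tau> assume \<tau>': "nat_trans D E L R \<tau> \<and> vcomp C E (whisker_right C \<tau> p) unit = \<sigma>"
    interpret \<tau>: nat_trans D E L R \<tau> using \<tau>' by blast
    have \<tau>H: "\<tau> d \<in> Hom E (Lo d) (OMap R d)" if "d \<in> Obj D" for d using \<tau>.comp_Hom[OF that] that by
        (simp add: L_simps)
    have \<tau>\<sigma>: "Comp E (\<tau> (OMap p x)) (unit x) = \<sigma> x" if "x \<in> Obj C" for x
    proof -
      have "vcomp C E (whisker_right C \<tau> p) unit x = \<sigma> x" using \<tau>' by simp
      then show ?thesis using that by (simp add: vcomp_def whisker_right_def)
    qed
    show "\<tau> = ?t"
    proof (rule extensionalityI[OF \<tau>.comp_ext])
      fix d assume d: "d \<in> Obj D"
      have "\<tau> d = t d"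
      proof (rule incl_eqI[OF d \<tau>H[OF d] t(1)[OF d]])
        fix a g assume ag: "a \<in> A" "g \<in> Hom D (OMap p a) d"
        note aC = AO[OF ag(1)]
        note I = p.cod.Ident_Hom[OF p.OMap_Obj[OF aC]]
        \<comment> \<open>Written this way, the leg can be moved past \<tau> by naturality at
          \<open>g\<close>, which leaves the prescribed value of \<tau> after the unit at
          \<open>a\<close>.\<close>
        have 1: "incl d (a, g) = Comp E (AMap L g) (unit a)"
          using L_arr(2)[OF ag(2,1) I] p.cod.Comp_Ident[OF ag(2)] p.cod.HomD(1)[OF ag(2)]
          by (simp add: L_simps unit_at_A[OF ag(1)])
        have ua: "unit a \<in> Hom E (OMap f a) (OMap L (OMap p a))"
          using unit_props(1)[OF aC] p.OMap_Obj[OF aC] by (simp add: L_simps)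
        have \<tau>a: "\<tau> (OMap p a) \<in> Hom E (OMap L (OMap p a)) (OMap R (OMap p a))"
          using \<tau>.comp_Hom[OF p.OMap_Obj[OF aC]] .
        have "Comp E (\<tau> d) (incl d (a, g)) = Comp E (Comp E (AMap R g) (\<tau> (OMap p a))) (unit a)"
          unfolding 1 using f.cod.Comp_assoc[OF ua L.AMap_Hom[OF ag(2)] \<tau>.comp_Hom[OF d]]
              \<tau>.naturality[OF ag(2)] by simp
        also have "\<dots> = Comp E (AMap R g) (\<sigma> a)"
          using f.cod.Comp_assoc[OF ua \<tau>a R.AMap_Hom[OF ag(2)]] \<tau>\<sigma>[OF aC] by simp
        finally show "Comp E (\<tau> d) (incl d (a, g)) = Comp E (t d) (incl d (a, g))" using t(2)[OF d ag]
            by simp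
      qed
      then show "\<tau> d = ?t d" using d by simp
    qed simp
  qed
qed

section \<open>Preservation of directed colimits by the pointwise extension\<close>

lemma L_preserves_colimit:
  assumes J: "directed_poset U \<mu> J" and \<mu>: "Cinfinite \<mu>" and G: "is_functor J D G" and c: "is_colimit
      J D G c \<iota>"
    and ef: "\<And>a. a \<in> A \<Longrightarrow> category.ess_factors D (OMap p a) J G c \<iota>"
  shows "is_colimit J E (cfun_comp J L G) (OMap L c) (\<lambda>j. AMap L (\<iota> j))"
proof -
  interpret G: is_functor J D G by fact
  interpret L: is_functor D E L by (rule is_functor_L)
  have cc: "is_cocone J D G c \<iota>" using c unfolding is_colimit_def by (rule conjunct1)
  have cO: "c \<in> Obj D" using c by (rule is_colimit_imp_Obj)
  have \<iota>: "\<iota> j \<in> Hom D (OMap G j) c" if "j \<in> Obj J" for j using cc that unfolding is_cocone_def by blast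
  have \<iota>G: "Comp D (\<iota> j) (AMap G u) = \<iota> i" if "i \<in> Obj J" "j \<in> Obj J" "u \<in> Hom J i j" for i j u
    using cc that unfolding is_cocone_def by blast
  have Lj: "OMap (cfun_comp J L G) j = Lo (OMap G j)" if "j \<in> Obj J" for j
    using that G.OMap_Obj by (simp add: L_simps)
  have L\<iota>: "AMap L (\<iota> j) = L_arr (\<iota> j)" if "j \<in> Obj J" for j
    using p.cod.HomD(1)[OF \<iota>[OF that]] by (simp add: L_simps)
  have LG: "AMap (cfun_comp J L G) u = L_arr (AMap G u)" if "u \<in> Hom J i j" for u i j
    using G.dom.HomD(1)[OF that] p.cod.HomD(1)[OF G.AMap_Hom[OF that]] by (simp add: L_simps)
  show ?thesis
    unfolding is_colimit_iff_gcolimit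
  proof (rule f.cod.gcolimitI)
    show "gcocone E (Obj J) (OMap (cfun_comp J L G)) (edges J (cfun_comp J L G)) (OMap L c) (\<lambda>j. AMap
        L (\<iota> j))"
      unfolding is_cocone_iff_gcocone[symmetric] is_cocone_def
    proof (intro conjI ballI)
      show "OMap L c \<in> Obj E" using cO by (rule L.OMap_Obj)
      show "AMap L (\<iota> j) \<in> Hom E (OMap (cfun_comp J L G) j) (OMap L c)" if "j \<in> Obj J" for j
        using L.AMap_Hom[OF \<iota>[OF that]] that by simp
      fix i j u assume *: "i \<in> Obj J" "j \<in> Obj J" "u \<in> Hom J i j"
      then show "Comp E (AMap L (\<iota> j)) (AMap (cfun_comp J L G) u) = AMap L (\<iota> i)"
        using L.AMap_Comp[OF G.AMap_Hom[OF *(3)] \<iota>[OF *(2)]] \<iota>G[OF *] G.dom.HomD(1)[OF *(3)] by simp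
    qed
  next
    fix y \<tau> assume t: "gcocone E (Obj J) (OMap (cfun_comp J L G)) (edges J (cfun_comp J L G)) y \<tau>"
    have t': "is_cocone J E (cfun_comp J L G) y \<tau>" using t unfolding is_cocone_iff_gcocone .
    have y: "y \<in> Obj E" using gcoconeD(1)[OF t] .
    have \<tau>: "\<tau> j \<in> Hom E (Lo (OMap G j)) y" if "j \<in> Obj J" for j using gcoconeD(2)[OF t that] Lj[OF
        that] by simp
    have \<tau>G: "Comp E (\<tau> j) (L_arr (AMap G u)) = \<tau> i" if "i \<in> Obj J" "j \<in> Obj J" "u \<in> Hom J i j" for i
        j u
      using t' that LG[OF that(3)] unfolding is_cocone_def by metis
    have \<tau>incl: "Comp E (\<tau> j) (incl (OMap G j) (a, Comp D (AMap G u) g)) = Comp E (\<tau> i) (incl (OMap G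
        i) (a, g))"
      if *: "i \<in> Obj J" "j \<in> Obj J" "u \<in> Hom J i j" and ag: "a \<in> A" "g \<in> Hom D (OMap p a) (OMap G i)"
          for i j u a g
      using f.cod.Comp_assoc[OF incl_Hom[OF ag] L_arr(1)[OF G.AMap_Hom[OF *(3)]] \<tau>[OF *(2)]]
        L_arr(2)[OF G.AMap_Hom[OF *(3)] ag] \<tau>G[OF *] by simp
    \<comment> \<open>Two factorizations of the same arrow \<open>p a \<rightarrow> c\<close> agree
      at a later stage, and compatibility of \<tau> with the transition maps carries the agreement
      back.\<close>
    have wd: "Comp E (\<tau> i) (incl (OMap G i) (a, g)) = Comp E (\<tau> j) (incl (OMap G j) (a, g'))"
      if a: "a \<in> A" and i: "i \<in> Obj J" "g \<in> Hom D (OMap p a) (OMap G i)"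
        and j: "j \<in> Obj J" "g' \<in> Hom D (OMap p a) (OMap G j)"
        and eq: "Comp D (\<iota> i) g = Comp D (\<iota> j) g'" for a i j g g'
    proof -
      obtain k u v where k: "k \<in> Obj J" "u \<in> Hom J i k" "v \<in> Hom J j k"
        "Comp D (AMap G u) g = Comp D (AMap G v) g'"
        by (rule p.cod.ess_factors_two[OF ef[OF a] G cc J \<mu> i j eq])
      then show ?thesis using \<tau>incl[OF i(1) k(1,2) a i(2)] \<tau>incl[OF j(1) k(1,3) a j(2)] by simp
    qed
    \<comment> \<open>Yields a function \<open>t\<close> whose value \<open>t a g\<close> is the
      future leg at \<open>(a, g)\<close>: the value of \<tau> at any stage through which
      \<open>g\<close> factors.\<close>
    have "\<exists>x. \<forall>j\<in>Obj J. \<forall>g\<in>Hom D (OMap p a) (OMap G j). k = Comp D (\<iota> j) g \<longrightarrow>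
        Comp E (\<tau> j) (incl (OMap G j) (a, g)) = x" if "a \<in> A" for a k
      using wd[OF that] by metis
    then obtain t where t: "\<And>a j g. a \<in> A \<Longrightarrow> j \<in> Obj J \<Longrightarrow> g \<in> Hom D (OMap p a) (OMap G j) \<Longrightarrow>
        Comp E (\<tau> j) (incl (OMap G j) (a, g)) = t a (Comp D (\<iota> j) g)" by metis
    have "\<exists>h. h \<in> Hom E (Lo c) y \<and> (\<forall>a\<in>A. \<forall>g\<in>Hom D (OMap p a) c. Comp E h (incl c (a, g)) = t a g)"
    proof (rule incl_factor[OF cO y])
      fix a g assume ag: "a \<in> A" "g \<in> Hom D (OMap p a) c"
      obtain j g' where j: "j \<in> Obj J" "g' \<in> Hom D (OMap p a) (OMap G j)" "g = Comp D (\<iota> j) g'"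
        by (rule p.cod.ess_factorsD1[OF ef[OF ag(1)] ag(2)])
      show "t a g \<in> Hom E (OMap f a) y"
        using t[OF ag(1) j(1,2)] f.cod.Comp_Hom[OF incl_Hom[OF ag(1) j(2)] \<tau>[OF j(1)]] j(3) by simp
    next
      fix a b u g assume *: "a \<in> A" "b \<in> A" "u \<in> Hom C a b" "g \<in> Hom D (OMap p b) c"
      obtain j g' where j: "j \<in> Obj J" "g' \<in> Hom D (OMap p b) (OMap G j)" "g = Comp D (\<iota> j) g'"
        by (rule p.cod.ess_factorsD1[OF ef[OF *(2)] *(4)])
      note pu = p.AMap_Hom[OF *(3)]
      show "Comp E (t b g) (AMap f u) = t a (Comp D g (AMap p u))"
        using t[OF *(2) j(1,2)] t[OF *(1) j(1) p.cod.Comp_Hom[OF pu j(2)]] j(3)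
          f.cod.Comp_assoc[OF f.AMap_Hom[OF *(3)] incl_Hom[OF *(2) j(2)] \<tau>[OF j(1)]]
          incl_edge[OF *(1-3) j(2)] p.cod.Comp_assoc[OF pu j(2) \<iota>[OF j(1)]] by simp
    qed
    then obtain h where h: "h \<in> Hom E (Lo c) y" "\<And>a g. a \<in> A \<Longrightarrow> g \<in> Hom D (OMap p a) c \<Longrightarrow> Comp E h (incl
        c (a, g)) = t a g"
      by metis
    have "Comp E h (L_arr (\<iota> j)) = \<tau> j" if j: "j \<in> Obj J" for j
    proof (rule incl_eqI[OF G.OMap_Obj[OF j] f.cod.Comp_Hom[OF L_arr(1)[OF \<iota>[OF j]] h(1)] \<tau>[OF j]])
      fix a g assume ag: "a \<in> A" "g \<in> Hom D (OMap p a) (OMap G j)"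
      show "Comp E (Comp E h (L_arr (\<iota> j))) (incl (OMap G j) (a, g)) = Comp E (\<tau> j) (incl (OMap G j)
          (a, g))"
        using f.cod.Comp_assoc[OF incl_Hom[OF ag] L_arr(1)[OF \<iota>[OF j]] h(1)] L_arr(2)[OF \<iota>[OF j] ag]
          h(2)[OF ag(1) p.cod.Comp_Hom[OF ag(2) \<iota>[OF j]]] t[OF ag(1) j ag(2)] by simp
    qed
    then show "\<exists>h. h \<in> Hom E (OMap L c) y \<and> (\<forall>j\<in>Obj J. Comp E h (AMap L (\<iota> j)) = \<tau> j)"
      using h(1) L\<iota> cO by (intro exI[of _ h]) (simp add: L_simps)
  next
    fix y h h' assume h: "h \<in> Hom E (OMap L c) y" "h' \<in> Hom E (OMap L c) y"
      and eq: "\<And>j. j \<in> Obj J \<Longrightarrow> Comp E h (AMap L (\<iota> j)) = Comp E h' (AMap L (\<iota> j))"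
    have hc: "h \<in> Hom E (Lo c) y" "h' \<in> Hom E (Lo c) y" using h cO by (simp_all add: L_simps)
    show "h = h'"
    proof (rule incl_eqI[OF cO hc])
      fix a g assume ag: "a \<in> A" "g \<in> Hom D (OMap p a) c"
      obtain j g' where j: "j \<in> Obj J" "g' \<in> Hom D (OMap p a) (OMap G j)" "g = Comp D (\<iota> j) g'"
        by (rule p.cod.ess_factorsD1[OF ef[OF ag(1)] ag(2)])
      \<comment> \<open>Each leg at \<open>c\<close> passes through some
        \<open>L (\<iota> j)\<close>, so these arrows are jointly epic because the legs are.\<close>
      have 1: "incl c (a, g) = Comp E (L_arr (\<iota> j)) (incl (OMap G j) (a, g'))"
        using L_arr(2)[OF \<iota>[OF j(1)] ag(1) j(2)] j(3) by simp
      show "Comp E h (incl c (a, g)) = Comp E h' (incl c (a, g))"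
        unfolding 1
        using f.cod.Comp_assoc[OF incl_Hom[OF ag(1) j(2)] L_arr(1)[OF \<iota>[OF j(1)]] hc(1)]
          f.cod.Comp_assoc[OF incl_Hom[OF ag(1) j(2)] L_arr(1)[OF \<iota>[OF j(1)]] hc(2)]
          eq[OF j(1)] L\<iota>[OF j(1)] by simp
    qed
  qed
qed

end

section \<open>Natural transformations\<close>

lemma cfun_comp_assoc:
  assumes "is_functor A B F"
  shows "cfun_comp A (cfun_comp B H G) F = cfun_comp A H (cfun_comp A G F)"
proof -
  interpret F: is_functor A B F by fact
  show ?thesis
    unfolding cfun_comp_def using F.OMap_Obj F.AMap_Arr by (simp cong: restrict_cong)
qed

lemma cfun_comp_id:
  assumes "is_functor A B F"
  shows "cfun_comp A F (id_fun A) = F" "cfun_comp A (id_fun B) F = F"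
proof -
  interpret F: is_functor A B F by fact
  show "cfun_comp A F (id_fun A) = F"
    by (rule cfun_eqI[OF is_functor_comp[OF is_functor_id[OF F.dom.category_axioms] assms] assms])
        simp_all
  show "cfun_comp A (id_fun B) F = F"
    by (rule cfun_eqI[OF is_functor_comp[OF assms is_functor_id[OF F.cod.category_axioms]] assms])
      (simp_all add: F.OMap_Obj F.AMap_Arr)
qed

lemma nat_trans_eqI:
  assumes "nat_trans C D F G \<sigma>" "nat_trans C D F' G' \<tau>" "\<And>a. a \<in> Obj C \<Longrightarrow> \<sigma> a = \<tau> a"
  shows "\<sigma> = \<tau>"
  using extensionalityI[OF nat_trans.comp_ext[OF assms(1)] nat_trans.comp_ext[OF assms(2)] assms(3)] .

lemma nat_trans_ident:
  assumes "is_functor C D F" shows "nat_trans C D F F (nt_ident C D F)"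
proof -
  interpret is_functor C D F by fact
  show ?thesis
  proof
    show "nt_ident C D F \<in> extensional (Obj C)" by (simp add: nt_ident_def)
    show "nt_ident C D F a \<in> Hom D (OMap F a) (OMap F a)" if "a \<in> Obj C" for a
      using that cod.Ident_Hom[OF OMap_Obj[OF that]] by (simp add: nt_ident_def)
    show "Comp D (nt_ident C D F b) (AMap F f) = Comp D (AMap F f) (nt_ident C D F a)" if "f \<in> Hom C a
        b" for f a b
      using dom.HomD[OF that] cod.Ident_Comp[OF AMap_Hom[OF that]] cod.Comp_Ident[OF AMap_Hom[OF that]]
      by (simp add: nt_ident_def)
  qed
qed

lemma nat_trans_vcomp:
  assumes "nat_trans C D F G \<tau>" "nat_trans C D G H \<sigma>"
  shows "nat_trans C D F H (vcomp C D \<sigma> \<tau>)"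
proof -
  interpret t: nat_trans C D F G \<tau> by fact
  interpret s: nat_trans C D G H \<sigma> by fact
  show ?thesis
  proof
    show "vcomp C D \<sigma> \<tau> \<in> extensional (Obj C)" by (simp add: vcomp_def)
    show "vcomp C D \<sigma> \<tau> a \<in> Hom D (OMap F a) (OMap H a)" if "a \<in> Obj C" for a
      using that t.src.cod.Comp_Hom[OF t.comp_Hom s.comp_Hom] by (simp add: vcomp_def)
    fix f a b assume f: "f \<in> Hom C a b"
    note ab = t.src.dom.HomD(4,5)[OF f]
    show "Comp D (vcomp C D \<sigma> \<tau> b) (AMap F f) = Comp D (AMap H f) (vcomp C D \<sigma> \<tau> a)"
      using ab t.naturality[OF f] s.naturality[OF f]
        t.src.cod.Comp_assoc[OF t.src.AMap_Hom[OF f] t.comp_Hom[OF ab(2)] s.comp_Hom[OF ab(2)]]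
        t.src.cod.Comp_assoc[OF t.comp_Hom[OF ab(1)] t.tgt.AMap_Hom[OF f] s.comp_Hom[OF ab(2)]]
        t.src.cod.Comp_assoc[OF t.comp_Hom[OF ab(1)] s.comp_Hom[OF ab(1)] s.tgt.AMap_Hom[OF f]]
      by (simp add: vcomp_def)
  qed
qed

lemma nat_trans_whisker_right:
  assumes F: "is_functor B C F" and \<tau>: "nat_trans C D G H \<tau>"
  shows "nat_trans B D (cfun_comp B G F) (cfun_comp B H F) (whisker_right B \<tau> F)"
proof -
  interpret F: is_functor B C F by fact
  interpret t: nat_trans C D G H \<tau> by fact
  interpret GF: is_functor B D "cfun_comp B G F" using F t.src.is_functor_axioms by (rule
      is_functor_comp)
  interpret HF: is_functor B D "cfun_comp B H F" using F t.tgt.is_functor_axioms by (rule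
      is_functor_comp)
  show ?thesis
  proof
    show "whisker_right B \<tau> F \<in> extensional (Obj B)" by (simp add: whisker_right_def)
    show "whisker_right B \<tau> F a \<in> Hom D (OMap (cfun_comp B G F) a) (OMap (cfun_comp B H F) a)" if "a \<in>
        Obj B" for a
      using that t.comp_Hom[OF F.OMap_Obj[OF that]] by (simp add: whisker_right_def)
    show "Comp D (whisker_right B \<tau> F b) (AMap (cfun_comp B G F) f) =
      Comp D (AMap (cfun_comp B H F) f) (whisker_right B \<tau> F a)" if "f \<in> Hom B a b" for f a b
      using F.dom.HomD[OF that] t.naturality[OF F.AMap_Hom[OF that]] by (simp add: whisker_right_def)
  qed
qed

lemma nat_trans_whisker_left:
  assumes \<tau>: "nat_trans B C F G \<tau>" and H: "is_functor C D H"
  shows "nat_trans B D (cfun_comp B H F) (cfun_comp B H G) (whisker_left B H \<tau>)"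
proof -
  interpret H: is_functor C D H by fact
  interpret t: nat_trans B C F G \<tau> by fact
  interpret HF: is_functor B D "cfun_comp B H F" using t.src.is_functor_axioms H by (rule
      is_functor_comp)
  interpret HG: is_functor B D "cfun_comp B H G" using t.tgt.is_functor_axioms H by (rule
      is_functor_comp)
  show ?thesis
  proof
    show "whisker_left B H \<tau> \<in> extensional (Obj B)" by (simp add: whisker_left_def)
    show "whisker_left B H \<tau> a \<in> Hom D (OMap (cfun_comp B H F) a) (OMap (cfun_comp B H G) a)" if "a \<in>
        Obj B" for a
      using that H.AMap_Hom[OF t.comp_Hom[OF that]] by (simp add: whisker_left_def)
    fix f a b assume f: "f \<in> Hom B a b"
    note ab = t.src.dom.HomD[OF f]
    show "Comp D (whisker_left B H \<tau> b) (AMap (cfun_comp B H F) f) =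
      Comp D (AMap (cfun_comp B H G) f) (whisker_left B H \<tau> a)"
      using ab t.naturality[OF f] H.AMap_Comp[OF t.src.AMap_Hom[OF f] t.comp_Hom[OF ab(5)]]
        H.AMap_Comp[OF t.comp_Hom[OF ab(4)] t.tgt.AMap_Hom[OF f]]
      by (simp add: whisker_left_def)
  qed
qed

section \<open>Uniqueness of left Kan extensions\<close>

lemma left_kan_extensionD:
  assumes "left_kan_extension C C' D q f L \<eta>"
  shows "is_functor C C' q" "is_functor C D f" "is_functor C' D L" "nat_trans C D f (cfun_comp C L q) \<eta>"
  using assms unfolding left_kan_extension_def by simp_all

lemma left_kan_extension_ex1:
  assumes "left_kan_extension C C' D q f L \<eta>" "is_functor C' D R" "nat_trans C D f (cfun_comp C R q) \<sigma>"
  shows "\<exists>!\<tau>. nat_trans C' D L R \<tau> \<and> vcomp C D (whisker_right C \<tau> q) \<eta> = \<sigma>"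
  using assms unfolding left_kan_extension_def by simp

text \<open>Whiskering both transformations with \<open>q\<close> and composing with the unit gives
  the same mate, and mates correspond uniquely to transformations. The pointwise hypothesis avoids
  composites of whiskerings in later computations.\<close>

lemma left_kan_extension_eqI:
  assumes L: "left_kan_extension C C' D q f L \<eta>"
    and \<sigma>: "nat_trans C' D L R \<sigma>" and \<tau>: "nat_trans C' D L R \<tau>"
    and eq: "\<And>x. x \<in> Obj C \<Longrightarrow> Comp D (\<sigma> (OMap q x)) (\<eta> x) = Comp D (\<tau> (OMap q x)) (\<eta> x)"
  shows "\<sigma> = \<tau>"
proof -
  interpret s: nat_trans C' D L R \<sigma> by fact
  have nt: "nat_trans C D f (cfun_comp C R q) (vcomp C D (whisker_right C \<sigma> q) \<eta>)"
    using left_kan_extensionD(4)[OF L] nat_trans_whisker_right[OF left_kan_extensionD(1)[OF L] \<sigma>]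
    by (rule nat_trans_vcomp)
  have "vcomp C D (whisker_right C \<tau> q) \<eta> = vcomp C D (whisker_right C \<sigma> q) \<eta>"
    unfolding vcomp_def whisker_right_def using eq by (simp cong: restrict_cong)
  then show ?thesis
    using left_kan_extension_ex1[OF L s.tgt.is_functor_axioms nt] \<sigma> \<tau> by blast
qed

lemma left_kan_extension_factor:
  assumes L: "left_kan_extension C C' D q f L \<eta>" and R: "is_functor C' D R"
    and \<sigma>: "nat_trans C D f (cfun_comp C R q) \<sigma>"
  obtains \<tau> where "nat_trans C' D L R \<tau>" "\<And>x. x \<in> Obj C \<Longrightarrow> Comp D (\<tau> (OMap q x)) (\<eta> x) = \<sigma> x"
proof -
  obtain \<tau> where \<tau>: "nat_trans C' D L R \<tau>" "vcomp C D (whisker_right C \<tau> q) \<eta> = \<sigma>"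
    using left_kan_extension_ex1[OF assms] by blast
  have "Comp D (\<tau> (OMap q x)) (\<eta> x) = \<sigma> x" if "x \<in> Obj C" for x
    using fun_cong[OF \<tau>(2), of x] that by (simp add: vcomp_def whisker_right_def)
  then show thesis using that \<tau>(1) by blast
qed

text \<open>The composite of \<sigma> and \<tau> fixes the unit, as does the identity, so uniqueness
  identifies the two.\<close>

lemma left_kan_extension_inverse:
  assumes L: "left_kan_extension C C' D q f L \<eta>"
    and \<sigma>: "nat_trans C' D L L' \<sigma>" "\<And>x. x \<in> Obj C \<Longrightarrow> Comp D (\<sigma> (OMap q x)) (\<eta> x) = \<eta>' x"
    and \<tau>: "nat_trans C' D L' L \<tau>" "\<And>x. x \<in> Obj C \<Longrightarrow> Comp D (\<tau> (OMap q x)) (\<eta>' x) = \<eta> x"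
    and d: "d \<in> Obj C'"
  shows "Comp D (\<tau> d) (\<sigma> d) = Ident D (OMap L d)"
proof -
  interpret q: is_functor C C' q using left_kan_extensionD(1)[OF L] .
  interpret L: is_functor C' D L using left_kan_extensionD(3)[OF L] .
  interpret \<eta>: nat_trans C D f "cfun_comp C L q" \<eta> using left_kan_extensionD(4)[OF L] .
  interpret s: nat_trans C' D L L' \<sigma> by (rule \<sigma>(1))
  interpret t: nat_trans C' D L' L \<tau> by (rule \<tau>(1))
  have "vcomp C' D \<tau> \<sigma> = nt_ident C' D L"
  proof (rule left_kan_extension_eqI[OF L nat_trans_vcomp[OF \<sigma>(1) \<tau>(1)] nat_trans_ident[OF
      L.is_functor_axioms]])
    fix x assume x: "x \<in> Obj C"
    note qx = q.OMap_Obj[OF x]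
    have \<eta>x: "\<eta> x \<in> Hom D (OMap f x) (OMap L (OMap q x))" using \<eta>.comp_Hom[OF x] x by simp
    show "Comp D (vcomp C' D \<tau> \<sigma> (OMap q x)) (\<eta> x) = Comp D (nt_ident C' D L (OMap q x)) (\<eta> x)"
      using qx L.cod.Comp_assoc[OF \<eta>x s.comp_Hom[OF qx] t.comp_Hom[OF qx]] \<sigma>(2)[OF x] \<tau>(2)[OF x]
          L.cod.Ident_Comp[OF \<eta>x]
      by (simp add: vcomp_def nt_ident_def)
  qed
  from fun_cong[OF this, of d] show ?thesis using d by (simp add: vcomp_def nt_ident_def)
qed

lemma left_kan_extension_iso:
  assumes L: "left_kan_extension C C' D q f L \<eta>" and L': "left_kan_extension C C' D q f L' \<eta>'"
  obtains \<sigma> \<tau> where "nat_trans C' D L L' \<sigma>" "nat_trans C' D L' L \<tau>"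
    "\<And>d. d \<in> Obj C' \<Longrightarrow> Comp D (\<tau> d) (\<sigma> d) = Ident D (OMap L d)"
    "\<And>d. d \<in> Obj C' \<Longrightarrow> Comp D (\<sigma> d) (\<tau> d) = Ident D (OMap L' d)"
proof -
  obtain \<sigma> where \<sigma>: "nat_trans C' D L L' \<sigma>" "\<And>x. x \<in> Obj C \<Longrightarrow> Comp D (\<sigma> (OMap q x)) (\<eta> x) = \<eta>' x"
    by (rule left_kan_extension_factor[OF L left_kan_extensionD(3,4)[OF L']]) blast
  obtain \<tau> where \<tau>: "nat_trans C' D L' L \<tau>" "\<And>x. x \<in> Obj C \<Longrightarrow> Comp D (\<tau> (OMap q x)) (\<eta>' x) = \<eta> x"
    by (rule left_kan_extension_factor[OF L' left_kan_extensionD(3,4)[OF L]]) blast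
  show thesis
    using that[OF \<sigma>(1) \<tau>(1)] left_kan_extension_inverse[OF L \<sigma> \<tau>] left_kan_extension_inverse[OF L' \<tau>
        \<sigma>] by blast
qed

section \<open>Accessible functors\<close>

text \<open>A cocone on \<open>L' \<circ> G\<close> becomes one on \<open>L \<circ> G\<close> by
  precomposing with \<sigma>. Its factorization through \<open>L c\<close>, precomposed with
  \<open>\<tau> c\<close>, is the one sought.\<close>

lemma is_colimit_iso:
  assumes \<sigma>: "nat_trans C D L L' \<sigma>" and \<tau>: "nat_trans C D L' L \<tau>"
    and \<tau>\<sigma>: "\<And>d. d \<in> Obj C \<Longrightarrow> Comp D (\<tau> d) (\<sigma> d) = Ident D (OMap L d)"
    and \<sigma>\<tau>: "\<And>d. d \<in> Obj C \<Longrightarrow> Comp D (\<sigma> d) (\<tau> d) = Ident D (OMap L' d)"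
    and G: "is_functor J C G" and cc: "is_cocone J C G c \<iota>"
    and col: "is_colimit J D (cfun_comp J L G) (OMap L c) (\<lambda>j. AMap L (\<iota> j))"
  shows "is_colimit J D (cfun_comp J L' G) (OMap L' c) (\<lambda>j. AMap L' (\<iota> j))"
proof -
  interpret s: nat_trans C D L L' \<sigma> by fact
  interpret t: nat_trans C D L' L \<tau> by fact
  interpret G: is_functor J C G by fact
  note Dc = s.src.cod.Comp_Hom and as = s.src.cod.Comp_assoc
  have cO: "c \<in> Obj C" using cc unfolding is_cocone_def by (rule conjunct1)
  have \<iota>: "\<iota> j \<in> Hom C (OMap G j) c" if "j \<in> Obj J" for j using cc that unfolding is_cocone_def by blast
  have \<iota>G: "Comp C (\<iota> j) (AMap G u) = \<iota> i" if "i \<in> Obj J" "j \<in> Obj J" "u \<in> Hom J i j" for i j u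
    using cc that unfolding is_cocone_def by blast
  have gc: "gcolimit D (Obj J) (OMap (cfun_comp J L G)) (edges J (cfun_comp J L G)) (OMap L c) (\<lambda>j.
      AMap L (\<iota> j))"
    using col unfolding is_colimit_iff_gcolimit .
  note gd = gdiagram_edges[OF is_functor_comp[OF G s.src.is_functor_axioms]]
  show ?thesis
    unfolding is_colimit_iff_gcolimit
  proof (rule s.src.cod.gcolimitI)
    show "gcocone D (Obj J) (OMap (cfun_comp J L' G)) (edges J (cfun_comp J L' G)) (OMap L' c) (\<lambda>j.
        AMap L' (\<iota> j))"
      unfolding is_cocone_iff_gcocone[symmetric] is_cocone_def
    proof (intro conjI ballI)
      show "OMap L' c \<in> Obj D" using cO by (rule s.tgt.OMap_Obj)
      show "AMap L' (\<iota> j) \<in> Hom D (OMap (cfun_comp J L' G) j) (OMap L' c)" if "j \<in> Obj J" for j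
        using s.tgt.AMap_Hom[OF \<iota>[OF that]] that by simp
      fix i j u assume *: "i \<in> Obj J" "j \<in> Obj J" "u \<in> Hom J i j"
      then show "Comp D (AMap L' (\<iota> j)) (AMap (cfun_comp J L' G) u) = AMap L' (\<iota> i)"
        using s.tgt.AMap_Comp[OF G.AMap_Hom[OF *(3)] \<iota>[OF *(2)]] \<iota>G[OF *] G.dom.HomD(1)[OF *(3)] by simp
    qed
  next
    fix y \<rho> assume r: "gcocone D (Obj J) (OMap (cfun_comp J L' G)) (edges J (cfun_comp J L' G)) y \<rho>"
    have \<rho>: "\<rho> j \<in> Hom D (OMap L' (OMap G j)) y" if "j \<in> Obj J" for j using gcoconeD(2)[OF r that]
        that by simp
    have \<rho>G: "Comp D (\<rho> j) (AMap L' (AMap G u)) = \<rho> i" if "i \<in> Obj J" "j \<in> Obj J" "u \<in> Hom J i j" for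
        i j u
    proof -
      have "(i, j, AMap (cfun_comp J L' G) u) \<in> edges J (cfun_comp J L' G)" unfolding edges_def using
          that by blast
      from gcoconeD(3)[OF r this] show ?thesis using G.dom.HomD(1)[OF that(3)] by simp
    qed
    have "is_cocone J D (cfun_comp J L G) y (\<lambda>j. Comp D (\<rho> j) (\<sigma> (OMap G j)))"
      unfolding is_cocone_def
    proof (intro conjI ballI)
      show "y \<in> Obj D" using gcoconeD(1)[OF r] .
      show "Comp D (\<rho> j) (\<sigma> (OMap G j)) \<in> Hom D (OMap (cfun_comp J L G) j) y" if "j \<in> Obj J" for j
        using Dc[OF s.comp_Hom[OF G.OMap_Obj[OF that]] \<rho>[OF that]] that by simp
      fix i j u assume *: "i \<in> Obj J" "j \<in> Obj J" "u \<in> Hom J i j"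
      note Gu = G.AMap_Hom[OF *(3)] and Gi = G.OMap_Obj[OF *(1)] and Gj = G.OMap_Obj[OF *(2)]
      show "Comp D (Comp D (\<rho> j) (\<sigma> (OMap G j))) (AMap (cfun_comp J L G) u) = Comp D (\<rho> i) (\<sigma> (OMap G
          i))"
        using as[OF s.src.AMap_Hom[OF Gu] s.comp_Hom[OF Gj] \<rho>[OF *(2)]] s.naturality[OF Gu]
          as[OF s.comp_Hom[OF Gi] s.tgt.AMap_Hom[OF Gu] \<rho>[OF *(2)]] \<rho>G[OF *] G.dom.HomD(1)[OF *(3)] by
              simp
    qed
    then have "gcocone D (Obj J) (OMap (cfun_comp J L G)) (edges J (cfun_comp J L G)) y (\<lambda>j. Comp D (\<rho>
        j) (\<sigma> (OMap G j)))"
      unfolding is_cocone_iff_gcocone .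
    then obtain h where h: "h \<in> Hom D (OMap L c) y"
      "\<And>j. j \<in> Obj J \<Longrightarrow> Comp D h (AMap L (\<iota> j)) = Comp D (\<rho> j) (\<sigma> (OMap G j))"
      by (rule gcolimit_factor[OF gc]) blast
    have "Comp D (Comp D h (\<tau> c)) (AMap L' (\<iota> j)) = \<rho> j" if j: "j \<in> Obj J" for j
    proof -
      note Gj = G.OMap_Obj[OF j]
      have "Comp D (Comp D h (\<tau> c)) (AMap L' (\<iota> j)) = Comp D h (Comp D (AMap L (\<iota> j)) (\<tau> (OMap G j)))"
        using as[OF s.tgt.AMap_Hom[OF \<iota>[OF j]] t.comp_Hom[OF cO] h(1)] t.naturality[OF \<iota>[OF j]] by simp
      also have "\<dots> = Comp D (Comp D (\<rho> j) (\<sigma> (OMap G j))) (\<tau> (OMap G j))"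
        using as[OF t.comp_Hom[OF Gj] s.src.AMap_Hom[OF \<iota>[OF j]] h(1)] h(2)[OF j] by simp
      also have "\<dots> = \<rho> j"
        using as[OF t.comp_Hom[OF Gj] s.comp_Hom[OF Gj] \<rho>[OF j]] \<sigma>\<tau>[OF Gj] s.src.cod.Comp_Ident[OF
            \<rho>[OF j]] by simp
      finally show ?thesis .
    qed
    then show "\<exists>h. h \<in> Hom D (OMap L' c) y \<and> (\<forall>j\<in>Obj J. Comp D h (AMap L' (\<iota> j)) = \<rho> j)"
      using Dc[OF t.comp_Hom[OF cO] h(1)] by blast
  next
    fix y h h' assume h: "h \<in> Hom D (OMap L' c) y" and h': "h' \<in> Hom D (OMap L' c) y"
      and eq: "\<And>j. j \<in> Obj J \<Longrightarrow> Comp D h (AMap L' (\<iota> j)) = Comp D h' (AMap L' (\<iota> j))"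
    note sc = s.comp_Hom[OF cO] and tc = t.comp_Hom[OF cO]
    have *: "Comp D (Comp D k (\<sigma> c)) (AMap L (\<iota> j)) = Comp D (Comp D k (AMap L' (\<iota> j))) (\<sigma> (OMap G j))"
      if j: "j \<in> Obj J" and k: "k \<in> Hom D (OMap L' c) y" for j k
      using as[OF s.src.AMap_Hom[OF \<iota>[OF j]] sc k] s.naturality[OF \<iota>[OF j]]
        as[OF s.comp_Hom[OF G.OMap_Obj[OF j]] s.tgt.AMap_Hom[OF \<iota>[OF j]] k] by simp
    have "Comp D h (\<sigma> c) = Comp D h' (\<sigma> c)"
      by (rule s.src.cod.gcolimit_eqI[OF gc Dc[OF sc h] Dc[OF sc h'] _ gd]) (simp add: * h h' eq)
    then have "Comp D (Comp D h (\<sigma> c)) (\<tau> c) = Comp D (Comp D h' (\<sigma> c)) (\<tau> c)" by simp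
    then show "h = h'"
      using as[OF tc sc h] as[OF tc sc h'] \<sigma>\<tau>[OF cO] s.src.cod.Comp_Ident[OF h]
          s.src.cod.Comp_Ident[OF h'] by simp
  qed
qed

lemma is_colimit_cong:
  assumes "is_functor J C G" "\<And>j. j \<in> Obj J \<Longrightarrow> \<iota> j = \<iota>' j"
  shows "is_colimit J C G c \<iota> \<longleftrightarrow> is_colimit J C G c \<iota>'"
  unfolding is_colimit_iff_gcolimit
  using gdiagram_edge_subset[OF gdiagram_edges[OF assms(1)]] assms(2) by (intro gcolimit_cong) auto

lemma preserves_directed_colimits_comp:
  assumes F: "is_functor A B F" "preserves_directed_colimits U \<kappa> A B F"
    and H: "is_functor B C H" "preserves_directed_colimits U \<kappa> B C H"
  shows "preserves_directed_colimits U \<kappa> A C (cfun_comp A H F)"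
  unfolding preserves_directed_colimits_def
proof (intro allI impI, elim conjE)
  fix J G c \<iota> assume J: "directed_poset U \<kappa> J" and G: "is_functor J A G" and c: "is_colimit J A G c \<iota>"
  interpret F: is_functor A B F by (rule F(1))
  have cc: "is_cocone J A G c \<iota>" using c unfolding is_colimit_def by (rule conjunct1)
  have \<iota>: "\<iota> j \<in> Arr A" if "j \<in> Obj J" for j
  proof -
    have "\<iota> j \<in> Hom A (OMap G j) c" using cc that unfolding is_cocone_def by blast
    then show ?thesis by (rule F.dom.HomD(1))
  qed
  have "is_colimit J B (cfun_comp J F G) (OMap F c) (\<lambda>j. AMap F (\<iota> j))"
    using F(2) J G c unfolding preserves_directed_colimits_def by blast
  then have "is_colimit J C (cfun_comp J H (cfun_comp J F G)) (OMap H (OMap F c)) (\<lambda>j. AMap H (AMap F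
      (\<iota> j)))"
    using H(2) J is_functor_comp[OF G F(1)] unfolding preserves_directed_colimits_def by blast
  then have "is_colimit J C (cfun_comp J (cfun_comp A H F) G) (OMap (cfun_comp A H F) c) (\<lambda>j. AMap H
      (AMap F (\<iota> j)))"
    using cfun_comp_assoc[OF G, of H F] is_colimit_imp_Obj[OF c] by simp
  moreover have "is_functor J C (cfun_comp J (cfun_comp A H F) G)"
    using is_functor_comp[OF G is_functor_comp[OF F(1) H(1)]] .
  ultimately show "is_colimit J C (cfun_comp J (cfun_comp A H F) G) (OMap (cfun_comp A H F) c)
      (\<lambda>j. AMap (cfun_comp A H F) (\<iota> j))"
    by (subst is_colimit_cong[where \<iota>' = "\<lambda>j. AMap H (AMap F (\<iota> j))"]) (simp_all add: \<iota>)
qed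

lemma accessible_functorD:
  "accessible_functor U C D F \<Longrightarrow> is_functor C D F"
  unfolding accessible_functor_def by (rule conjunct1)

lemma accessible_functorE:
  assumes "accessible_functor U C D F"
  obtains \<kappa> where "regular_cardinal U \<kappa>" "accessible_at U \<kappa> C" "accessible_at U \<kappa> D"
    "preserves_directed_colimits U \<kappa> C D F"
  using assms unfolding accessible_functor_def by (elim conjE exE) (rule that)

lemma accessible_functor_id:
  fixes U :: "'u set"
  assumes "accessible U C" shows "accessible_functor U C C (id_fun C)"
proof -
  obtain \<kappa> where \<kappa>: "regular_cardinal U \<kappa>" "accessible_at U \<kappa> C"
    using assms unfolding accessible_def by (elim exE conjE) (rule that)
  note C = accessible_atD(1)[OF \<kappa>(2)]
  interpret category C by (rule C)
  have "preserves_directed_colimits U \<kappa> C C (id_fun C)"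
    unfolding preserves_directed_colimits_def
  proof (intro allI impI, elim conjE)
    fix J :: "('u, 'u) cat" and G c \<iota> assume G: "is_functor J C G" and c: "is_colimit J C G c \<iota>"
    have cc: "is_cocone J C G c \<iota>" using c unfolding is_colimit_def by (rule conjunct1)
    have \<iota>: "\<iota> j \<in> Arr C" if "j \<in> Obj J" for j
    proof -
      have "\<iota> j \<in> Hom C (OMap G j) c" using cc that unfolding is_cocone_def by blast
      then show ?thesis by (rule HomD(1))
    qed
    show "is_colimit J C (cfun_comp J (id_fun C) G) (OMap (id_fun C) c) (\<lambda>j. AMap (id_fun C) (\<iota> j))"
      using c unfolding cfun_comp_id(2)[OF G] id_fun_simps(1)[OF is_colimit_imp_Obj[OF c]]
      by (subst is_colimit_cong[OF G, where \<iota>' = \<iota>]) (simp_all add: \<iota>)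
  qed
  then show ?thesis using \<kappa> is_functor_id[OF C] unfolding accessible_functor_def by blast
qed

text \<open>
  Of two indices of accessibility the larger one serves both functors, because \<open>C\<close> is accessible
  at it by assumption; no sharp inequality between the indices is needed.
\<close>

lemma common_preservation_index:
  assumes q: "accessible_functor U C C q" and p: "accessible_functor U C D p"
  obtains \<kappa> where "regular_cardinal U \<kappa>" "accessible_at U \<kappa> C"
    "preserves_directed_colimits U \<kappa> C C q" "preserves_directed_colimits U \<kappa> C D p"
proof -
  obtain \<kappa> where \<kappa>: "regular_cardinal U \<kappa>" "accessible_at U \<kappa> C" "preserves_directed_colimits U \<kappa> C C q"
    by (rule accessible_functorE[OF q])
  obtain \<mu> where \<mu>: "regular_cardinal U \<mu>" "accessible_at U \<mu> C" "preserves_directed_colimits U \<mu> C D p"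
    by (rule accessible_functorE[OF p])
  consider "\<kappa> \<le>o \<mu>" | "\<mu> \<le>o \<kappa>" using regular_cardinal_linear[OF \<kappa>(1) \<mu>(1)] by blast
  then show thesis
  proof cases
    case 1
    then show thesis using that[OF \<mu>(1,2)] preserves_directed_colimits_mono[OF \<kappa>(3)] \<mu>(3) by blast
  next
    case 2
    then show thesis using that[OF \<kappa>(1,2)] preserves_directed_colimits_mono[OF \<mu>(3)] \<kappa>(3) by blast
  qed
qed

lemma accessible_functor_comp:
  assumes q: "accessible_functor U C C q" and r: "accessible_functor U C C r"
  shows "accessible_functor U C C (cfun_comp C q r)"
proof -
  obtain \<kappa> where \<kappa>: "regular_cardinal U \<kappa>" "accessible_at U \<kappa> C"
    "preserves_directed_colimits U \<kappa> C C r" "preserves_directed_colimits U \<kappa> C C q"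
    by (rule common_preservation_index[OF r q])
  note f = accessible_functorD[OF q] accessible_functorD[OF r]
  show ?thesis
    unfolding accessible_functor_def
    using is_functor_comp[OF f(2,1)] preserves_directed_colimits_comp[OF f(2) \<kappa>(3) f(1) \<kappa>(4)] \<kappa>(1,2)
        by blast
qed

lemma accessible_functor_iso:
  assumes L: "accessible_functor U C D L" and \<sigma>: "nat_trans C D L L' \<sigma>" and \<tau>: "nat_trans C D L' L \<tau>"
    and inv: "\<And>d. d \<in> Obj C \<Longrightarrow> Comp D (\<tau> d) (\<sigma> d) = Ident D (OMap L d)"
      "\<And>d. d \<in> Obj C \<Longrightarrow> Comp D (\<sigma> d) (\<tau> d) = Ident D (OMap L' d)"
  shows "accessible_functor U C D L'"
proof -
  interpret s: nat_trans C D L L' \<sigma> by fact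
  obtain \<kappa> where \<kappa>: "regular_cardinal U \<kappa>" "accessible_at U \<kappa> C" "accessible_at U \<kappa> D"
    "preserves_directed_colimits U \<kappa> C D L" by (rule accessible_functorE[OF L])
  have "preserves_directed_colimits U \<kappa> C D L'"
    unfolding preserves_directed_colimits_def
  proof (intro allI impI, elim conjE)
    fix J G c \<iota> assume J: "directed_poset U \<kappa> J" and G: "is_functor J C G" and c: "is_colimit J C G c \<iota>"
    have cc: "is_cocone J C G c \<iota>" using c unfolding is_colimit_def by (rule conjunct1)
    have col: "is_colimit J D (cfun_comp J L G) (OMap L c) (\<lambda>j. AMap L (\<iota> j))"
      using \<kappa>(4) J G c unfolding preserves_directed_colimits_def by blast
    show "is_colimit J D (cfun_comp J L' G) (OMap L' c) (\<lambda>j. AMap L' (\<iota> j))"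
      by (rule is_colimit_iso[OF \<sigma> \<tau> inv(1) inv(2) G cc col])
  qed
  then show ?thesis using \<kappa>(1-3) s.tgt.is_functor_axioms unfolding accessible_functor_def by blast
qed

section \<open>Existence and accessibility of left Kan extensions\<close>

text \<open>Two indices are at work: \<kappa> lives on the side of \<open>C\<close>, yielding the
  generators \<open>A\<close> and the determination of \<open>f\<close> by them; \<mu> lives on the
  side of \<open>D\<close>, where all \<open>p a\<close> are presentable. They need not be
  comparable.\<close>

lemma exists_accessible_left_kan_extension:
  fixes U :: "'u set" and C :: "('o1, 'm1, 'z1) cat_scheme" and D :: "('o2, 'm2, 'z2) cat_scheme"
  assumes U: "inaccessible U" and \<kappa>: "regular_cardinal U \<kappa>" and C: "accessible_at U \<kappa> C"
    and D: "accessible U D" and co: "cocomplete U D" and p: "is_functor C D p"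
    and f: "is_functor C D f" "preserves_directed_colimits U \<kappa> C D f"
  shows "\<exists>L \<eta>. left_kan_extension C D D p f L \<eta> \<and> accessible_functor U D D L"
proof -
  interpret p: is_functor C D p by fact
  interpret f: is_functor C D f by (rule f(1))
  note catC = accessible_atD(1)[OF C] and lsC = accessible_atD(2)[OF C]
  note \<kappa>inf = regular_cardinalD(1)[OF \<kappa>]
  obtain A where A: "small U A" "\<forall>a\<in>A. presentable U \<kappa> C a"
    "\<forall>x\<in>Obj C. \<exists>J G \<iota>. directed_poset U \<kappa> J \<and> is_functor J C G \<and> OMap G ` Obj J \<subseteq> A \<and> is_colimit J C G
        x \<iota>"
    by (rule accessible_atE[OF C])
  have AO: "A \<subseteq> Obj C" using A(2) unfolding presentable_def by auto
  obtain \<nu> where \<nu>: "regular_cardinal U \<nu>" "accessible_at U \<nu> D"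
    using D unfolding accessible_def by (elim exE conjE) (rule that)
  note catD = accessible_atD(1)[OF \<nu>(2)] and lsD = accessible_atD(2)[OF \<nu>(2)]
  have "OMap p ` A \<subseteq> Obj D" using AO p.OMap_Obj by auto
  \<comment> \<open>Smallness of \<open>A\<close> is what allows a single rank for all objects
    \<open>p a\<close>; starting from an index \<nu> of \<open>D\<close> makes it an index of
    \<open>D\<close> again.\<close>
  then obtain \<mu> where \<mu>: "regular_cardinal U \<mu>" "\<nu> \<le>o \<mu>" "\<And>x. x \<in> OMap p ` A \<Longrightarrow> presentable U \<mu> D x"
    by (rule exists_presentability_rank[OF U \<nu>(2,1) small_image[OF A(1)]]) blast
  note \<mu>inf = regular_cardinalD(1)[OF \<mu>(1)]
  have D\<mu>: "accessible_at U \<mu> D" using U co \<nu>(2,1) \<mu>(1,2) by (rule cocomplete_accessible_at_mono)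
  have "\<exists>c \<iota>. gcolimit D (comma_obj D A p d) (\<lambda>k. OMap f (fst k)) (comma_edges C D A p f d) c \<iota>"
    if d: "d \<in> Obj D" for d
    by (rule cocomplete_gcolimit[OF U catD co gdiagram_comma[OF p f(1) AO, of d] small_comma_obj[OF U
        p A(1) AO lsD d]
      small_comma_edges[OF U p A(1) AO lsC lsD d]]) blast
  then obtain Lo incl where Lo: "\<And>d. d \<in> Obj D \<Longrightarrow>
    gcolimit D (comma_obj D A p d) (\<lambda>k. OMap f (fst k)) (comma_edges C D A p f d) (Lo d) (incl d)"
    by metis
  interpret pointwise_lan C D D p f A Lo incl
  proof
    show "A \<subseteq> Obj C" by (rule AO)
    fix x assume x: "x \<in> Obj C"
    obtain J G \<iota> where J: "directed_poset U \<kappa> J" and G: "is_functor J C G" and GA: "OMap G ` Obj J \<subseteq> A"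
      and col: "is_colimit J C G x \<iota>" using bspec[OF A(3) x] by (elim exE conjE) (rule that)
    show "gcolimit D (comma_obj C A (id_fun C) x) (\<lambda>k. OMap f (fst k))
      (comma_edges C C A (id_fun C) f x) (OMap f x) (\<lambda>k. AMap f (snd k))"
    proof (rule canonical_gcolimit[OF f(1) G GA AO col])
      show "is_colimit J D (cfun_comp J f G) (OMap f x) (\<lambda>j. AMap f (\<iota> j))"
        using f(2) J G col unfolding preserves_directed_colimits_def by blast
      show "category.ess_factors C a J G x \<iota>" if "a \<in> A" for a
        using bspec[OF A(2) that] J G col unfolding presentable_iff[OF U catC lsC \<kappa>inf] by blast
    qed
  next
    show "gcolimit D (comma_obj D A p d) (\<lambda>k. OMap f (fst k)) (comma_edges C D A p f d) (Lo d) (incl d)"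
      if "d \<in> Obj D" for d using Lo[OF that] .
  qed
  have "preserves_directed_colimits U \<mu> D D L"
    unfolding preserves_directed_colimits_def
  proof (intro allI impI, elim conjE)
    fix J G c \<iota> assume J: "directed_poset U \<mu> J" and G: "is_functor J D G" and c: "is_colimit J D G c \<iota>"
    show "is_colimit J D (cfun_comp J L G) (OMap L c) (\<lambda>j. AMap L (\<iota> j))"
    proof (rule L_preserves_colimit[OF J \<mu>inf G c])
      fix a assume "a \<in> A"
      then have "presentable U \<mu> D (OMap p a)" by (intro \<mu>(3) imageI)
      then show "category.ess_factors D (OMap p a) J G c \<iota>"
        using J G c unfolding presentable_iff[OF U catD lsD \<mu>inf] by blast
    qed
  qed
  then have "accessible_functor U D D L"
    using is_functor_L D\<mu> \<mu>(1) unfolding accessible_functor_def by blast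
  then show ?thesis using left_kan_extension_L by blast
qed

lemma left_kan_extension_Lan:
  assumes "\<exists>L \<eta>. left_kan_extension C C' D q f L \<eta>"
  shows "left_kan_extension C C' D q f (Lan C C' D q f) (lan_unit C C' D q f)"
proof -
  have "\<exists>x. case x of (L, \<eta>) \<Rightarrow> left_kan_extension C C' D q f L \<eta>" using assms by simp
  then have "case lan_pair C C' D q f of (L, \<eta>) \<Rightarrow> left_kan_extension C C' D q f L \<eta>"
    unfolding lan_pair_def by (rule someI_ex)
  then show ?thesis unfolding Lan_def lan_unit_def by (simp add: split_beta)
qed

text \<open>The choice in \<open>Lan\<close> is a Kan extension because the pointwise one is a
  witness, and two Kan extensions of the same functor are isomorphic. Accessibility of the pointwise
  one therefore transfers.\<close>

lemma Lan_accessible: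
  assumes U: "inaccessible U" and D: "accessible U D" and co: "cocomplete U D"
    and p: "accessible_functor U C D p" and q: "accessible_functor U C C q"
  shows "left_kan_extension C D D p (cfun_comp C p q) (Lan C D D p (cfun_comp C p q)) (lan_unit C D D
      p (cfun_comp C p q))"
    and "accessible_functor U D D (Lan C D D p (cfun_comp C p q))"
proof -
  note fp = accessible_functorD[OF p] and fq = accessible_functorD[OF q]
  obtain \<kappa> where \<kappa>: "regular_cardinal U \<kappa>" "accessible_at U \<kappa> C"
    "preserves_directed_colimits U \<kappa> C C q" "preserves_directed_colimits U \<kappa> C D p"
    by (rule common_preservation_index[OF q p])
  obtain L \<eta> where L: "left_kan_extension C D D p (cfun_comp C p q) L \<eta>" "accessible_functor U D D L"
    using exists_accessible_left_kan_extension[OF U \<kappa>(1,2) D co fp is_functor_comp[OF fq fp]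
      preserves_directed_colimits_comp[OF fq \<kappa>(3) fp \<kappa>(4)]] by blast
  show *: "left_kan_extension C D D p (cfun_comp C p q) (Lan C D D p (cfun_comp C p q)) (lan_unit C D
      D p (cfun_comp C p q))"
    by (rule left_kan_extension_Lan) (use L(1) in blast)
  show "accessible_functor U D D (Lan C D D p (cfun_comp C p q))"
    by (rule left_kan_extension_iso[OF L(1) *]) (rule accessible_functor_iso[OF L(2)])
qed

section \<open>The monoidal category of accessible endofunctors\<close>

lemma End_cat_simps [simp]:
  "Obj (End_cat U C) = {q. accessible_functor U C C q}"
  "Arr (End_cat U C) = {(q, r, \<alpha>). accessible_functor U C C q \<and> accessible_functor U C C r \<and> nat_trans
      C C q r \<alpha>}"
  "Ident (End_cat U C) q = (q, q, nt_ident C C q)"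
  "Comp (End_cat U C) (r, s, \<beta>) (q, r', \<alpha>) = (q, s, vcomp C C \<beta> \<alpha>)"
  "TensO (End_cat U C) q r = cfun_comp C q r"
  "TensA (End_cat U C) (q, q', \<alpha>) (r, r', \<beta>) =
    (cfun_comp C q r, cfun_comp C q' r', vcomp C C (whisker_right C \<alpha> r') (whisker_left C q \<beta>))"
  "Unit (End_cat U C) = id_fun C"
  by (simp_all add: End_cat_def)

lemma Hom_End_cat:
  "Hom (End_cat U C) q r = {(q, r, \<alpha>) | \<alpha>. accessible_functor U C C q \<and> accessible_functor U C C r \<and>
      nat_trans C C q r \<alpha>}"
  unfolding Hom_def End_cat_def by auto

lemma Hom_End_catE:
  assumes "f \<in> Hom (End_cat U C) q r"
  obtains \<alpha> where "f = (q, r, \<alpha>)" "accessible_functor U C C q" "accessible_functor U C C r" "nat_trans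
      C C q r \<alpha>"
  using assms unfolding Hom_End_cat by blast

lemma Hom_End_catI:
  "accessible_functor U C C q \<Longrightarrow> accessible_functor U C C r \<Longrightarrow> nat_trans C C q r \<alpha> \<Longrightarrow>
    (q, r, \<alpha>) \<in> Hom (End_cat U C) q r"
  unfolding Hom_End_cat by blast

lemma nat_trans_hcomp:
  assumes \<alpha>: "nat_trans C C q q' \<alpha>" and \<beta>: "nat_trans C C r r' \<beta>"
  shows "nat_trans C C (cfun_comp C q r) (cfun_comp C q' r') (vcomp C C (whisker_right C \<alpha> r')
      (whisker_left C q \<beta>))"
proof -
  interpret a: nat_trans C C q q' \<alpha> by fact
  interpret b: nat_trans C C r r' \<beta> by fact
  show ?thesis
    using nat_trans_whisker_left[OF \<beta> a.src.is_functor_axioms] nat_trans_whisker_right[OF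
        b.tgt.is_functor_axioms \<alpha>]
    by (rule nat_trans_vcomp)
qed

lemma hcomp_apply:
  "x \<in> Obj C \<Longrightarrow> vcomp C C (whisker_right C \<alpha> r') (whisker_left C q \<beta>) x = Comp C (\<alpha> (OMap r' x)) (AMap
      q (\<beta> x))"
  by (simp add: vcomp_def whisker_right_def whisker_left_def)

lemma category_End_cat: "category (End_cat U C)" (is "category ?M")
proof
  show "Dom ?M f \<in> Obj ?M" "Cod ?M f \<in> Obj ?M"
    if "f \<in> Arr ?M" for f
    using that by (auto simp: End_cat_def)
  show "Ident ?M q \<in> Hom ?M q q" if "q \<in> Obj ?M" for q
    using that by (simp add: Hom_End_catI nat_trans_ident accessible_functorD)
  show "Comp ?M g f \<in> Hom ?M q s"
    if f: "f \<in> Hom ?M q r" and g: "g \<in> Hom ?M r s" for f g q r s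
  proof -
    obtain \<alpha> where a: "f = (q, r, \<alpha>)" "accessible_functor U C C q" "nat_trans C C q r \<alpha>" by (rule
        Hom_End_catE[OF f])
    obtain \<beta> where b: "g = (r, s, \<beta>)" "accessible_functor U C C s" "nat_trans C C r s \<beta>" by (rule
        Hom_End_catE[OF g])
    show ?thesis using Hom_End_catI[OF a(2) b(2) nat_trans_vcomp[OF a(3) b(3)]] a(1) b(1) by simp
  qed
  show "Comp ?M h (Comp ?M g f) = Comp ?M (Comp ?M h g) f"
    if f: "f \<in> Hom ?M q r" and g: "g \<in> Hom ?M r s" and h: "h \<in> Hom ?M s t" for f g h q r s t
  proof -
    obtain \<alpha> where a: "f = (q, r, \<alpha>)" "nat_trans C C q r \<alpha>" by (rule Hom_End_catE[OF f])
    obtain \<beta> where b: "g = (r, s, \<beta>)" "nat_trans C C r s \<beta>" by (rule Hom_End_catE[OF g])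
    obtain \<gamma> where c: "h = (s, t, \<gamma>)" "nat_trans C C s t \<gamma>" by (rule Hom_End_catE[OF h])
    interpret a: nat_trans C C q r \<alpha> by (rule a(2))
    interpret b: nat_trans C C r s \<beta> by (rule b(2))
    interpret c: nat_trans C C s t \<gamma> by (rule c(2))
    have "vcomp C C \<gamma> (vcomp C C \<beta> \<alpha>) = vcomp C C (vcomp C C \<gamma> \<beta>) \<alpha>"
    proof (rule nat_trans_eqI[OF nat_trans_vcomp[OF nat_trans_vcomp[OF a(2) b(2)] c(2)]
        nat_trans_vcomp[OF a(2) nat_trans_vcomp[OF b(2) c(2)]]])
      fix x assume x: "x \<in> Obj C"
      then show "vcomp C C \<gamma> (vcomp C C \<beta> \<alpha>) x = vcomp C C (vcomp C C \<gamma> \<beta>) \<alpha> x"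
        using a.src.dom.Comp_assoc[OF a.comp_Hom[OF x] b.comp_Hom[OF x] c.comp_Hom[OF x]] by (simp
            add: vcomp_def)
    qed
    then show ?thesis using a(1) b(1) c(1) by simp
  qed
  show "Comp ?M f (Ident ?M q) = f" "Comp ?M (Ident ?M r) f = f"
    if f: "f \<in> Hom ?M q r" for f q r
  proof -
    obtain \<alpha> where a: "f = (q, r, \<alpha>)" "nat_trans C C q r \<alpha>" by (rule Hom_End_catE[OF f])
    interpret a: nat_trans C C q r \<alpha> by (rule a(2))
    have "vcomp C C \<alpha> (nt_ident C C q) = \<alpha>"
      by (rule nat_trans_eqI[OF nat_trans_vcomp[OF nat_trans_ident[OF a.src.is_functor_axioms] a(2)]
          a(2)])
        (simp add: vcomp_def nt_ident_def a.src.dom.Comp_Ident[OF a.comp_Hom])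
    then show "Comp ?M f (Ident ?M q) = f" using a(1) by simp
    have "vcomp C C (nt_ident C C r) \<alpha> = \<alpha>"
      by (rule nat_trans_eqI[OF nat_trans_vcomp[OF a(2) nat_trans_ident[OF a.tgt.is_functor_axioms]]
          a(2)])
        (simp add: vcomp_def nt_ident_def a.src.dom.Ident_Comp[OF a.comp_Hom])
    then show "Comp ?M (Ident ?M r) f = f" using a(1) by simp
  qed
qed

text \<open>The interchange law. Beyond reassociation, the one essential move is naturality of
  \<alpha> at \<open>\<beta>' x\<close>, which exchanges the two middle factors.\<close>

lemma hcomp_vcomp:
  assumes \<alpha>: "nat_trans C C a b \<alpha>" and \<alpha>': "nat_trans C C b c \<alpha>'"
    and \<beta>: "nat_trans C C a' b' \<beta>" and \<beta>': "nat_trans C C b' c' \<beta>'"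
  shows "vcomp C C (whisker_right C (vcomp C C \<alpha>' \<alpha>) c') (whisker_left C a (vcomp C C \<beta>' \<beta>)) =
    vcomp C C (vcomp C C (whisker_right C \<alpha>' c') (whisker_left C b \<beta>'))
      (vcomp C C (whisker_right C \<alpha> b') (whisker_left C a \<beta>))"
proof (rule nat_trans_eqI[OF nat_trans_hcomp[OF nat_trans_vcomp[OF \<alpha> \<alpha>'] nat_trans_vcomp[OF \<beta> \<beta>']]
    nat_trans_vcomp[OF nat_trans_hcomp[OF \<alpha> \<beta>] nat_trans_hcomp[OF \<alpha>' \<beta>']]])
  interpret \<alpha>: nat_trans C C a b \<alpha> by fact
  interpret \<alpha>': nat_trans C C b c \<alpha>' by fact
  interpret \<beta>: nat_trans C C a' b' \<beta> by fact
  interpret \<beta>': nat_trans C C b' c' \<beta>' by fact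
  note as = \<alpha>.src.dom.Comp_assoc and Ho = \<alpha>.src.dom.Comp_Hom
  fix x assume x: "x \<in> Obj C"
  note bx = \<beta>.comp_Hom[OF x] and b'x = \<beta>'.comp_Hom[OF x]
  note b'O = \<beta>.tgt.OMap_Obj[OF x] and c'O = \<beta>'.tgt.OMap_Obj[OF x]
  note 1 = \<alpha>.src.AMap_Hom[OF bx] and 2 = \<alpha>.src.AMap_Hom[OF b'x] and 3 = \<alpha>.comp_Hom[OF c'O]
    and 4 = \<alpha>'.comp_Hom[OF c'O] and 5 = \<alpha>.comp_Hom[OF b'O] and 6 = \<alpha>.tgt.AMap_Hom[OF b'x]
  have "Comp C (Comp C (\<alpha>' (OMap c' x)) (\<alpha> (OMap c' x))) (AMap a (Comp C (\<beta>' x) (\<beta> x))) =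
    Comp C (\<alpha>' (OMap c' x)) (Comp C (Comp C (\<alpha> (OMap c' x)) (AMap a (\<beta>' x))) (AMap a (\<beta> x)))"
    using as[OF Ho[OF 1 2] 3 4] as[OF 1 2 3] \<alpha>.src.AMap_Comp[OF bx b'x] by simp
  also have "\<dots> = Comp C (\<alpha>' (OMap c' x)) (Comp C (Comp C (AMap b (\<beta>' x)) (\<alpha> (OMap b' x))) (AMap a (\<beta>
      x)))"
    using \<alpha>.naturality[OF b'x] by simp
  also have "\<dots> = Comp C (Comp C (\<alpha>' (OMap c' x)) (AMap b (\<beta>' x))) (Comp C (\<alpha> (OMap b' x)) (AMap a (\<beta>
      x)))"
    using as[OF 1 5 6] as[OF Ho[OF 1 5] 6 4] by simp
  finally show "vcomp C C (whisker_right C (vcomp C C \<alpha>' \<alpha>) c') (whisker_left C a (vcomp C C \<beta>' \<beta>)) x =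
    vcomp C C (vcomp C C (whisker_right C \<alpha>' c') (whisker_left C b \<beta>'))
      (vcomp C C (whisker_right C \<alpha> b') (whisker_left C a \<beta>)) x"
    using x c'O by (simp add: vcomp_def whisker_right_def whisker_left_def)
qed

text \<open>At each object the two sides differ by functoriality of \<open>q\<close> on the
  composite of components of \<beta> and \<gamma>, and by reassociation.\<close>

lemma hcomp_assoc:
  assumes \<alpha>: "nat_trans C C q q' \<alpha>" and \<beta>: "nat_trans C C r r' \<beta>" and \<gamma>: "nat_trans C C s s' \<gamma>"
  shows "vcomp C C (whisker_right C (vcomp C C (whisker_right C \<alpha> r') (whisker_left C q \<beta>)) s')
      (whisker_left C (cfun_comp C q r) \<gamma>) =
    vcomp C C (whisker_right C \<alpha> (cfun_comp C r' s'))
      (whisker_left C q (vcomp C C (whisker_right C \<beta> s') (whisker_left C r \<gamma>)))" (is "?l = ?r")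
proof -
  interpret \<alpha>: nat_trans C C q q' \<alpha> by fact
  interpret \<beta>: nat_trans C C r r' \<beta> by fact
  interpret \<gamma>: nat_trans C C s s' \<gamma> by fact
  show ?thesis
  proof (rule nat_trans_eqI[OF nat_trans_hcomp[OF nat_trans_hcomp[OF \<alpha> \<beta>] \<gamma>] nat_trans_hcomp[OF \<alpha>
      nat_trans_hcomp[OF \<beta> \<gamma>]]])
    fix x assume x: "x \<in> Obj C"
    note gx = \<gamma>.comp_Hom[OF x] and sO = \<gamma>.tgt.OMap_Obj[OF x]
    note rgx = \<beta>.src.AMap_Hom[OF gx] and bx = \<beta>.comp_Hom[OF sO] and rO = \<beta>.tgt.OMap_Obj[OF sO]
    show "?l x = ?r x"
      using x sO \<alpha>.src.dom.HomD(1)[OF gx] \<alpha>.src.AMap_Comp[OF rgx bx]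
        \<alpha>.src.dom.Comp_assoc[OF \<alpha>.src.AMap_Hom[OF rgx] \<alpha>.src.AMap_Hom[OF bx] \<alpha>.comp_Hom[OF rO]]
      by (simp add: vcomp_def whisker_right_def whisker_left_def)
  qed
qed

lemma strict_monoidal_End_cat:
  assumes C: "accessible U C"
  shows "strict_monoidal_category (End_cat U C)" (is "strict_monoidal_category ?M")
proof -
  interpret E: category ?M by (rule category_End_cat)
  have id: "accessible_functor U C C (id_fun C)" using C by (rule accessible_functor_id)
  interpret I: is_functor C C "id_fun C" using id by (rule accessible_functorD)
  show ?thesis
  proof
    show "Unit ?M \<in> Obj ?M" using id by simp
    show "TensO ?M q r \<in> Obj ?M" if "q \<in> Obj ?M" "r \<in> Obj ?M" for q r
      using that accessible_functor_comp by simp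
    show "TensA ?M f g \<in> Hom ?M (TensO ?M q r) (TensO ?M q' r')"
      if f: "f \<in> Hom ?M q q'" and g: "g \<in> Hom ?M r r'" for f g q q' r r'
    proof -
      obtain \<alpha> where a: "f = (q, q', \<alpha>)" "accessible_functor U C C q" "accessible_functor U C C q'"
          "nat_trans C C q q' \<alpha>"
        by (rule Hom_End_catE[OF f])
      obtain \<beta> where b: "g = (r, r', \<beta>)" "accessible_functor U C C r" "accessible_functor U C C r'"
          "nat_trans C C r r' \<beta>"
        by (rule Hom_End_catE[OF g])
      show ?thesis
        using Hom_End_catI[OF accessible_functor_comp[OF a(2) b(2)] accessible_functor_comp[OF a(3)
            b(3)]
          nat_trans_hcomp[OF a(4) b(4)]] a(1) b(1) by simp
    qed
    show "TensA ?M (Ident ?M q) (Ident ?M r) = Ident ?M (TensO ?M q r)"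
      if q: "q \<in> Obj ?M" and r: "r \<in> Obj ?M" for q r
    proof -
      interpret q: is_functor C C q using q by (simp add: accessible_functorD)
      interpret r: is_functor C C r using r by (simp add: accessible_functorD)
      have "vcomp C C (whisker_right C (nt_ident C C q) r) (whisker_left C q (nt_ident C C r)) =
          nt_ident C C (cfun_comp C q r)"
      proof (rule nat_trans_eqI[OF nat_trans_hcomp[OF nat_trans_ident[OF q.is_functor_axioms]
          nat_trans_ident[OF r.is_functor_axioms]]
          nat_trans_ident[OF is_functor_comp[OF r.is_functor_axioms q.is_functor_axioms]]])
        fix x assume x: "x \<in> Obj C"
        note rO = r.OMap_Obj[OF x]
        show "vcomp C C (whisker_right C (nt_ident C C q) r) (whisker_left C q (nt_ident C C r)) x =
            nt_ident C C (cfun_comp C q r) x"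
          using x rO q.AMap_Ident[OF rO] I.dom.Ident_Comp[OF I.dom.Ident_Hom[OF q.OMap_Obj[OF rO]]]
          by (simp add: vcomp_def whisker_right_def whisker_left_def nt_ident_def)
      qed
      then show ?thesis by simp
    qed
    show "TensA ?M (Comp ?M f' f) (Comp ?M g' g) =
        Comp ?M (TensA ?M f' g') (TensA ?M f g)"
      if f: "f \<in> Hom ?M a b" and f': "f' \<in> Hom ?M b c"
        and g: "g \<in> Hom ?M a' b'" and g': "g' \<in> Hom ?M b' c'" for f f' g g' a b c a' b' c'
    proof -
      obtain \<alpha> where a: "f = (a, b, \<alpha>)" "nat_trans C C a b \<alpha>" by (rule Hom_End_catE[OF f])
      obtain \<alpha>' where a': "f' = (b, c, \<alpha>')" "nat_trans C C b c \<alpha>'" by (rule Hom_End_catE[OF f'])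
      obtain \<beta> where b: "g = (a', b', \<beta>)" "nat_trans C C a' b' \<beta>" by (rule Hom_End_catE[OF g])
      obtain \<beta>' where b': "g' = (b', c', \<beta>')" "nat_trans C C b' c' \<beta>'" by (rule Hom_End_catE[OF g'])
      show ?thesis using hcomp_vcomp[OF a(2) a'(2) b(2) b'(2)] a(1) a'(1) b(1) b'(1) by simp
    qed
    show "TensO ?M (TensO ?M q r) s = TensO ?M q (TensO ?M r s)"
      if "q \<in> Obj ?M" "r \<in> Obj ?M" "s \<in> Obj ?M" for q r s
      using that cfun_comp_assoc[OF accessible_functorD, of U C C s] by simp
    show "TensA ?M (TensA ?M f g) h = TensA ?M f (TensA ?M g h)"
      if f: "f \<in> Arr ?M" and g: "g \<in> Arr ?M" and h: "h \<in> Arr ?M" for f g h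
    proof -
      obtain q q' \<alpha> where a: "f = (q, q', \<alpha>)" "nat_trans C C q q' \<alpha>" using f by auto
      obtain r r' \<beta> where b: "g = (r, r', \<beta>)" "nat_trans C C r r' \<beta>" using g by auto
      obtain s s' \<gamma> where c: "h = (s, s', \<gamma>)" "accessible_functor U C C s" "accessible_functor U C C
          s'" "nat_trans C C s s' \<gamma>"
        using h by auto
      show ?thesis
        using hcomp_assoc[OF a(2) b(2) c(4)] a(1) b(1) c(1)
        by (simp add: cfun_comp_assoc[OF accessible_functorD[OF c(2)]] cfun_comp_assoc[OF
            accessible_functorD[OF c(3)]])
    qed
    show "TensO ?M q (Unit ?M) = q" "TensO ?M (Unit ?M) q = q"
      if "q \<in> Obj ?M" for q
      using that cfun_comp_id[OF accessible_functorD] by simp_all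
    show "TensA ?M f (Ident ?M (Unit ?M)) = f"
      "TensA ?M (Ident ?M (Unit ?M)) f = f" if f: "f \<in> Arr ?M" for f
    proof -
      obtain q q' \<alpha> where a: "f = (q, q', \<alpha>)" "nat_trans C C q q' \<alpha>" using f by auto
      interpret a: nat_trans C C q q' \<alpha> by (rule a(2))
      note i = nat_trans_ident[OF I.is_functor_axioms]
      note c = cfun_comp_id[OF a.src.is_functor_axioms] cfun_comp_id[OF a.tgt.is_functor_axioms]
      have "vcomp C C (whisker_right C \<alpha> (id_fun C)) (whisker_left C q (nt_ident C C (id_fun C))) = \<alpha>"
      proof (rule nat_trans_eqI[OF nat_trans_hcomp[OF a(2) i] a(2)])
        fix x assume x: "x \<in> Obj C"
        then show "vcomp C C (whisker_right C \<alpha> (id_fun C)) (whisker_left C q (nt_ident C C (id_fun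
            C))) x = \<alpha> x"
          using a.src.AMap_Ident[OF x] I.dom.Comp_Ident[OF a.comp_Hom[OF x]]
          by (simp add: vcomp_def whisker_right_def whisker_left_def nt_ident_def)
      qed
      then show "TensA ?M f (Ident ?M (Unit ?M)) = f" using a(1) c by simp
      have "vcomp C C (whisker_right C (nt_ident C C (id_fun C)) q') (whisker_left C (id_fun C) \<alpha>) = \<alpha>"
      proof (rule nat_trans_eqI[OF nat_trans_hcomp[OF i a(2)] a(2)])
        fix x assume x: "x \<in> Obj C"
        then show "vcomp C C (whisker_right C (nt_ident C C (id_fun C)) q') (whisker_left C (id_fun C)
            \<alpha>) x = \<alpha> x"
          using a.tgt.OMap_Obj[OF x] I.dom.HomD(1)[OF a.comp_Hom[OF x]] I.dom.Ident_Comp[OF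
              a.comp_Hom[OF x]]
          by (simp add: vcomp_def whisker_right_def whisker_left_def nt_ident_def)
      qed
      then show "TensA ?M (Ident ?M (Unit ?M)) f = f" using a(1) c by simp
    qed
  qed
qed

section \<open>The colax structure\<close>

locale lan_post_setting =
  fixes U :: "'u set" and C :: "('o1, 'm1, 'z1) cat_scheme" and D :: "('o2, 'm2, 'z2) cat_scheme"
    and p :: "('o1, 'm1, 'o2, 'm2) cfun"
  assumes U: "inaccessible U" and accC: "accessible U C" and accD: "accessible U D"
    and co: "cocomplete U D" and accp: "accessible_functor U C D p"
begin

sublocale p: is_functor C D p using accp by (rule accessible_functorD)

abbreviation acc :: "('o1, 'm1, 'o1, 'm1) cfun \<Rightarrow> bool" where
  "acc q \<equiv> accessible_functor U C C q"

abbreviation LL :: "('o1, 'm1, 'o1, 'm1) cfun \<Rightarrow> ('o2, 'm2, 'o2, 'm2) cfun" where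
  "LL q \<equiv> lan_post C D p q"

abbreviation eta :: "('o1, 'm1, 'o1, 'm1) cfun \<Rightarrow> 'o1 \<Rightarrow> 'm2" where
  "eta q \<equiv> lan_unit C D D p (cfun_comp C p q)"

section \<open>Units, mates and the action on transformations\<close>

lemma acc_functor: "acc q \<Longrightarrow> is_functor C C q"
  by (rule accessible_functorD)

lemma acc_id: "acc (id_fun C)"
  using accC by (rule accessible_functor_id)

lemma lke: "acc q \<Longrightarrow> left_kan_extension C D D p (cfun_comp C p q) (LL q) (eta q)"
  unfolding lan_post_def using Lan_accessible(1)[OF U accD co accp] .

lemma LL_accessible: "acc q \<Longrightarrow> accessible_functor U D D (LL q)"
  unfolding lan_post_def using Lan_accessible(2)[OF U accD co accp] .

lemma LL_functor: "acc q \<Longrightarrow> is_functor D D (LL q)"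
  using LL_accessible accessible_functorD by blast

lemma eta_nat_trans: "acc q \<Longrightarrow> nat_trans C D (cfun_comp C p q) (cfun_comp C (LL q) p) (eta q)"
  using left_kan_extensionD(4)[OF lke] .

lemma eta_Hom:
  assumes "acc q" "x \<in> Obj C"
  shows "eta q x \<in> Hom D (OMap p (OMap q x)) (OMap (LL q) (OMap p x))"
  using nat_trans.comp_Hom[OF eta_nat_trans[OF assms(1)] assms(2)] assms(2) by simp

lemma eta_natural:
  assumes "acc q" "h \<in> Hom C x y"
  shows "Comp D (eta q y) (AMap p (AMap q h)) = Comp D (AMap (LL q) (AMap p h)) (eta q x)"
  using nat_trans.naturality[OF eta_nat_trans[OF assms(1)] assms(2)] p.dom.HomD(1)[OF assms(2)] by simp

text \<open>All structure maps are defined as mates; below they are handled through these two facts,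
  their type and their value after the unit.\<close>

lemma mate:
  assumes q: "acc q" and R: "is_functor D D R" and \<sigma>: "nat_trans C D (cfun_comp C p q) (cfun_comp C R
      p) \<sigma>"
  shows "nat_trans D D (LL q) R (lan_mate C D D p (cfun_comp C p q) R \<sigma>)"
    and "x \<in> Obj C \<Longrightarrow> Comp D (lan_mate C D D p (cfun_comp C p q) R \<sigma> (OMap p x)) (eta q x) = \<sigma> x"
proof -
  have *: "nat_trans D D (LL q) R (lan_mate C D D p (cfun_comp C p q) R \<sigma>) \<and>
    vcomp C D (whisker_right C (lan_mate C D D p (cfun_comp C p q) R \<sigma>) p) (eta q) = \<sigma>"
    unfolding lan_mate_def lan_post_def[symmetric]
    using theI'[OF left_kan_extension_ex1[OF lke[OF q] R \<sigma>]] .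
  then show "nat_trans D D (LL q) R (lan_mate C D D p (cfun_comp C p q) R \<sigma>)" by blast
  show "Comp D (lan_mate C D D p (cfun_comp C p q) R \<sigma> (OMap p x)) (eta q x) = \<sigma> x" if "x \<in> Obj C"
    using fun_cong[OF conjunct2[OF *], of x] that by (simp add: vcomp_def whisker_right_def)
qed

lemma LL_eqI:
  assumes "acc q" "nat_trans D D (LL q) R \<sigma>" "nat_trans D D (LL q) R \<tau>"
    and "\<And>x. x \<in> Obj C \<Longrightarrow> Comp D (\<sigma> (OMap p x)) (eta q x) = Comp D (\<tau> (OMap p x)) (eta q x)"
  shows "\<sigma> = \<tau>"
  using left_kan_extension_eqI[OF lke[OF assms(1)] assms(2-4)] .

abbreviation Lmap :: "('o1, 'm1, 'o1, 'm1) cfun \<Rightarrow> ('o1, 'm1, 'o1, 'm1) cfun \<Rightarrow> ('o1 \<Rightarrow> 'm1) \<Rightarrow> 'o2 \<Rightarrow> 'm2"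
    where
  "Lmap q r \<alpha> \<equiv> lan_map C D D p (cfun_comp C p q) (cfun_comp C p r) (whisker_left C p \<alpha>)"

text \<open>The second fact is naturality of the units in \<open>q\<close>. Since it determines the
  action on transformations, functoriality reduces to computations after a unit.\<close>

lemma Lmap:
  assumes q: "acc q" and r: "acc r" and \<alpha>: "nat_trans C C q r \<alpha>"
  shows "nat_trans D D (LL q) (LL r) (Lmap q r \<alpha>)"
    and "x \<in> Obj C \<Longrightarrow> Comp D (Lmap q r \<alpha> (OMap p x)) (eta q x) = Comp D (eta r x) (AMap p (\<alpha> x))"
proof -
  have s: "nat_trans C D (cfun_comp C p q) (cfun_comp C (LL r) p) (vcomp C D (eta r) (whisker_left C p
      \<alpha>))"
    using nat_trans_whisker_left[OF \<alpha> p.is_functor_axioms] eta_nat_trans[OF r] by (rule nat_trans_vcomp)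
  note m = mate[OF q LL_functor[OF r] s]
  show "nat_trans D D (LL q) (LL r) (Lmap q r \<alpha>)"
    using m(1) unfolding lan_map_def lan_post_def .
  show "Comp D (Lmap q r \<alpha> (OMap p x)) (eta q x) = Comp D (eta r x) (AMap p (\<alpha> x))" if "x \<in> Obj C"
    using m(2)[OF that] that unfolding lan_map_def lan_post_def by (simp add: vcomp_def
        whisker_left_def)
qed

lemma Lmap_ident:
  assumes q: "acc q" shows "Lmap q q (nt_ident C C q) = nt_ident D D (LL q)"
proof -
  interpret q: is_functor C C q using q by (rule acc_functor)
  note i = nat_trans_ident[OF q.is_functor_axioms]
  show ?thesis
  proof (rule LL_eqI[OF q Lmap(1)[OF q q i] nat_trans_ident[OF LL_functor[OF q]]])
    fix x assume x: "x \<in> Obj C"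
    show "Comp D (Lmap q q (nt_ident C C q) (OMap p x)) (eta q x) = Comp D (nt_ident D D (LL q) (OMap
        p x)) (eta q x)"
      using Lmap(2)[OF q q i x] x p.AMap_Ident[OF q.OMap_Obj[OF x]] p.cod.Comp_Ident[OF eta_Hom[OF q x]]
        p.cod.Ident_Comp[OF eta_Hom[OF q x]] p.OMap_Obj[OF x]
      by (simp add: nt_ident_def)
  qed
qed

text \<open>After the unit, each of the two factors on the right moves past it by
  \<open>Lmap(2)\<close>, and functoriality of \<open>p\<close> merges \<open>p \<beta>\<close> and
  \<open>p \<alpha>\<close>.\<close>

lemma Lmap_vcomp:
  assumes q: "acc q" and r: "acc r" and s: "acc s" and \<alpha>: "nat_trans C C q r \<alpha>" and \<beta>: "nat_trans C C
      r s \<beta>"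
  shows "Lmap q s (vcomp C C \<beta> \<alpha>) = vcomp D D (Lmap r s \<beta>) (Lmap q r \<alpha>)"
proof -
  interpret \<alpha>: nat_trans C C q r \<alpha> by fact
  interpret \<beta>: nat_trans C C r s \<beta> by fact
  note v = nat_trans_vcomp[OF \<alpha> \<beta>]
  show ?thesis
  proof (rule LL_eqI[OF q Lmap(1)[OF q s v] nat_trans_vcomp[OF Lmap(1)[OF q r \<alpha>] Lmap(1)[OF r s \<beta>]]])
    fix x assume x: "x \<in> Obj C"
    note px = p.OMap_Obj[OF x]
    note a = \<alpha>.comp_Hom[OF x] and b = \<beta>.comp_Hom[OF x]
    note La = nat_trans.comp_Hom[OF Lmap(1)[OF q r \<alpha>] px] and Lb = nat_trans.comp_Hom[OF Lmap(1)[OF r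
        s \<beta>] px]
    have "Comp D (Comp D (Lmap r s \<beta> (OMap p x)) (Lmap q r \<alpha> (OMap p x))) (eta q x) =
      Comp D (Lmap r s \<beta> (OMap p x)) (Comp D (eta r x) (AMap p (\<alpha> x)))"
      using p.cod.Comp_assoc[OF eta_Hom[OF q x] La Lb] Lmap(2)[OF q r \<alpha> x] by simp
    also have "\<dots> = Comp D (Comp D (eta s x) (AMap p (\<beta> x))) (AMap p (\<alpha> x))"
      using p.cod.Comp_assoc[OF p.AMap_Hom[OF a] eta_Hom[OF r x] Lb] Lmap(2)[OF r s \<beta> x] by simp
    also have "\<dots> = Comp D (eta s x) (AMap p (Comp C (\<beta> x) (\<alpha> x)))"
      using p.cod.Comp_assoc[OF p.AMap_Hom[OF a] p.AMap_Hom[OF b] eta_Hom[OF s x]] p.AMap_Comp[OF a b]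
          by simp
    finally show "Comp D (Lmap q s (vcomp C C \<beta> \<alpha>) (OMap p x)) (eta q x) =
      Comp D (vcomp D D (Lmap r s \<beta>) (Lmap q r \<alpha>) (OMap p x)) (eta q x)"
      using Lmap(2)[OF q s v x] x px by (simp add: vcomp_def)
  qed
qed

lemma lan_post_fun_simps:
  "acc q \<Longrightarrow> OMap (lan_post_fun U C D p) q = LL q"
  "acc q \<Longrightarrow> acc r \<Longrightarrow> nat_trans C C q r \<alpha> \<Longrightarrow>
    AMap (lan_post_fun U C D p) (q, r, \<alpha>) = (LL q, LL r, Lmap q r \<alpha>)"
  by (simp_all add: lan_post_fun_def)

lemma is_functor_lan_post: "is_functor (End_cat U C) (End_cat U D) (lan_post_fun U C D p)"
  (is "is_functor ?M ?N ?F")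
proof -
  interpret EC: category ?M by (rule category_End_cat)
  interpret ED: category ?N by (rule category_End_cat)
  show ?thesis
  proof
    show "OMap ?F \<in> extensional (Obj ?M)" "AMap ?F \<in> extensional (Arr ?M)"
      unfolding lan_post_fun_def by simp_all
    show "OMap ?F q \<in> Obj ?N" if "q \<in> Obj ?M" for q
      using that LL_accessible by (simp add: lan_post_fun_simps)
    show "AMap ?F f \<in> Hom ?N (OMap ?F q) (OMap ?F r)" if f: "f \<in> Hom ?M q r" for f q r
    proof -
      obtain \<alpha> where a: "f = (q, r, \<alpha>)" "acc q" "acc r" "nat_trans C C q r \<alpha>" by (rule Hom_End_catE[OF
          f])
      show ?thesis
        using Hom_End_catI[OF LL_accessible[OF a(2)] LL_accessible[OF a(3)] Lmap(1)[OF a(2-4)]] a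
        by (simp add: lan_post_fun_simps)
    qed
    show "AMap ?F (Ident ?M q) = Ident ?N (OMap ?F q)" if "q \<in> Obj ?M" for q
      using that by (simp add: lan_post_fun_simps nat_trans_ident acc_functor Lmap_ident)
    show "AMap ?F (Comp ?M g f) = Comp ?N (AMap ?F g) (AMap ?F f)"
      if f: "f \<in> Hom ?M q r" and g: "g \<in> Hom ?M r s" for f g q r s
    proof -
      obtain \<alpha> where a: "f = (q, r, \<alpha>)" "acc q" "acc r" "nat_trans C C q r \<alpha>" by (rule Hom_End_catE[OF
          f])
      obtain \<beta> where b: "g = (r, s, \<beta>)" "acc s" "nat_trans C C r s \<beta>" by (rule Hom_End_catE[OF g])
      show ?thesis
        using Lmap_vcomp[OF a(2,3) b(2) a(4) b(3)] nat_trans_vcomp[OF a(4) b(3)] a b by (simp add: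
            lan_post_fun_simps)
    qed
  qed
qed

text \<open>Written with \<open>p \<circ> id\<close> in order to be the instance of
  \<open>mate\<close> at the identity functor; strictness of composition makes it equal to the
  counit built from \<open>p\<close>.\<close>

abbreviation epsilon :: "'o2 \<Rightarrow> 'm2" where
  "epsilon \<equiv> lan_mate C D D p (cfun_comp C p (id_fun C)) (id_fun D) (nt_ident C D p)"

lemma p_id: "cfun_comp C p (id_fun C) = p"
  using cfun_comp_id(1)[OF p.is_functor_axioms] .

lemma lan_counit_eq: "lan_counit C D p = (LL (id_fun C), id_fun D, epsilon)"
  unfolding lan_counit_def lan_post_def p_id ..

lemma epsilon:
  shows "nat_trans D D (LL (id_fun C)) (id_fun D) epsilon"
    and "x \<in> Obj C \<Longrightarrow> Comp D (epsilon (OMap p x)) (eta (id_fun C) x) = Ident D (OMap p x)"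
proof -
  have "nat_trans C D (cfun_comp C p (id_fun C)) (cfun_comp C (id_fun D) p) (nt_ident C D p)"
    unfolding p_id cfun_comp_id(2)[OF p.is_functor_axioms] using p.is_functor_axioms by (rule
        nat_trans_ident)
  note m = mate[OF acc_id is_functor_id[OF p.cod.category_axioms] this]
  show "nat_trans D D (LL (id_fun C)) (id_fun D) epsilon" using m(1) .
  show "Comp D (epsilon (OMap p x)) (eta (id_fun C) x) = Ident D (OMap p x)" if "x \<in> Obj C"
    using m(2)[OF that] that by (simp add: nt_ident_def)
qed

section \<open>The comultiplication and its coherence laws\<close>

abbreviation delta :: "('o1, 'm1, 'o1, 'm1) cfun \<Rightarrow> ('o1, 'm1, 'o1, 'm1) cfun \<Rightarrow> 'o2 \<Rightarrow> 'm2" where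
  "delta q r \<equiv> lan_mate C D D p (cfun_comp C p (cfun_comp C q r)) (cfun_comp D (LL q) (LL r))
    (vcomp C D (whisker_left C (LL q) (eta r)) (whisker_right C (eta q) r))"

lemma lan_comult_eq: "lan_comult C D p q r = (LL (cfun_comp C q r), cfun_comp D (LL q) (LL r), delta q
    r)"
  unfolding lan_comult_def lan_post_def Let_def ..

lemma delta:
  assumes q: "acc q" and r: "acc r"
  shows "nat_trans D D (LL (cfun_comp C q r)) (cfun_comp D (LL q) (LL r)) (delta q r)"
    and "x \<in> Obj C \<Longrightarrow> Comp D (delta q r (OMap p x)) (eta (cfun_comp C q r) x) =
      Comp D (AMap (LL q) (eta r x)) (eta q (OMap r x))"
proof -
  interpret r: is_functor C C r using r by (rule acc_functor)
  note Lq = LL_functor[OF q] and Lr = LL_functor[OF r]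
  have 1: "nat_trans C D (cfun_comp C (cfun_comp C p q) r) (cfun_comp C (cfun_comp C (LL q) p) r)
      (whisker_right C (eta q) r)"
    using r.is_functor_axioms eta_nat_trans[OF q] by (rule nat_trans_whisker_right)
  have 2: "nat_trans C D (cfun_comp C (LL q) (cfun_comp C p r)) (cfun_comp C (LL q) (cfun_comp C (LL
      r) p)) (whisker_left C (LL q) (eta r))"
    using eta_nat_trans[OF r] Lq by (rule nat_trans_whisker_left)
  \<comment> \<open>The whiskered units meet at \<open>LL q \<circ> p \<circ> r\<close> only up to
    bracketing; strict associativity turns the bracketings into equalities.\<close>
  have "nat_trans C D (cfun_comp C p (cfun_comp C q r)) (cfun_comp C (cfun_comp D (LL q) (LL r)) p)
    (vcomp C D (whisker_left C (LL q) (eta r)) (whisker_right C (eta q) r))"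
    using nat_trans_vcomp[OF 1[unfolded cfun_comp_assoc[OF r.is_functor_axioms]] 2] cfun_comp_assoc[OF
        p.is_functor_axioms, of "LL q" "LL r"]
    by simp
  note m = mate[OF accessible_functor_comp[OF q r] is_functor_comp[OF Lr Lq] this]
  show "nat_trans D D (LL (cfun_comp C q r)) (cfun_comp D (LL q) (LL r)) (delta q r)" using m(1) .
  show "Comp D (delta q r (OMap p x)) (eta (cfun_comp C q r) x) = Comp D (AMap (LL q) (eta r x)) (eta
      q (OMap r x))"
    if "x \<in> Obj C"
    using m(2)[OF that] that by (simp add: vcomp_def whisker_right_def whisker_left_def)
qed

text \<open>After the unit at \<open>x\<close> both sides become the unit square of
  \<open>q'\<close> and \<open>r'\<close> preceded by \<open>p \<alpha>\<close> and
  \<open>p (q \<beta>)\<close>. On the right this takes naturality of \<open>eta q\<close> at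
  \<open>\<beta> x\<close> and of \<open>Lmap q q' \<alpha>\<close> at
  \<open>eta r' x\<close>.\<close>

lemma delta_natural:
  assumes q: "acc q" "acc q'" and r: "acc r" "acc r'" and \<alpha>: "nat_trans C C q q' \<alpha>" and \<beta>: "nat_trans
      C C r r' \<beta>"
  shows "vcomp D D (delta q' r') (Lmap (cfun_comp C q r) (cfun_comp C q' r') (vcomp C C (whisker_right
      C \<alpha> r') (whisker_left C q \<beta>))) =
    vcomp D D (vcomp D D (whisker_right D (Lmap q q' \<alpha>) (LL r')) (whisker_left D (LL q) (Lmap r r'
        \<beta>))) (delta q r)"
    (is "vcomp D D _ (Lmap _ _ ?h) = _")
proof -
  interpret \<alpha>: nat_trans C C q q' \<alpha> by fact
  interpret \<beta>: nat_trans C C r r' \<beta> by fact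
  interpret Lq: is_functor D D "LL q" using q(1) by (rule LL_functor)
  interpret Lq': is_functor D D "LL q'" using q(2) by (rule LL_functor)
  interpret Lr: is_functor D D "LL r" using r(1) by (rule LL_functor)
  interpret Lr': is_functor D D "LL r'" using r(2) by (rule LL_functor)
  note qr = accessible_functor_comp[OF q(1) r(1)] and qr' = accessible_functor_comp[OF q(2) r(2)]
  note h = nat_trans_hcomp[OF \<alpha> \<beta>]
  note L\<alpha> = Lmap(1)[OF q \<alpha>] and L\<beta> = Lmap(1)[OF r \<beta>] and Lh = Lmap(1)[OF qr qr' h]
  interpret La: nat_trans D D "LL q" "LL q'" "Lmap q q' \<alpha>" by (rule L\<alpha>)
  note as = p.cod.Comp_assoc and Ho = p.cod.Comp_Hom
  show ?thesis
  proof (rule LL_eqI[OF qr nat_trans_vcomp[OF Lh delta(1)[OF q(2) r(2)]] nat_trans_vcomp[OF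
      delta(1)[OF q(1) r(1)] nat_trans_hcomp[OF L\<alpha> L\<beta>]]])
    fix x assume x: "x \<in> Obj C"
    let ?e = "eta (cfun_comp C q r) x" and ?e' = "eta (cfun_comp C q' r') x"
      and ?er = "eta r x" and ?er' = "eta r' x" and ?px = "OMap p x" and ?rx = "OMap r x" and ?r'x =
          "OMap r' x"
    let ?Lr' = "OMap (LL r') ?px" and ?pq\<beta> = "AMap p (AMap q (\<beta> x))" and ?p\<alpha> = "AMap p (\<alpha> ?r'x)"
      and ?LqL\<beta> = "AMap (LL q) (Lmap r r' \<beta> ?px)" and ?Lqer' = "AMap (LL q) ?er'" and ?Lq'er' = "AMap
          (LL q') ?er'"
      and ?Lh = "Lmap (cfun_comp C q r) (cfun_comp C q' r') ?h ?px"
      and ?\<delta> = "delta q r ?px" and ?\<delta>' = "delta q' r' ?px"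
    let ?L\<alpha> = "Lmap q q' \<alpha> ?Lr'"
    note px = p.OMap_Obj[OF x]
    note rx = \<beta>.src.OMap_Obj[OF x] and r'x = \<beta>.tgt.OMap_Obj[OF x]
    note b = \<beta>.comp_Hom[OF x] and a = \<alpha>.comp_Hom[OF r'x]
    note qb = \<alpha>.src.AMap_Hom[OF b]
    note Lr'x = Lr'.OMap_Obj[OF px]
    have hx: "?h x = Comp C (\<alpha> ?r'x) (AMap q (\<beta> x))" using x by (rule hcomp_apply)
    note hH = nat_trans.comp_Hom[OF h x]
    have hp: "AMap p (?h x) \<in> Hom D (OMap p (OMap (cfun_comp C q r) x)) (OMap p (OMap (cfun_comp C q'
        r') x))"
      using p.AMap_Hom[OF hH] .
    note e1 = eta_Hom[OF qr x] and e2 = eta_Hom[OF qr' x] and er = eta_Hom[OF r(1) x] and er' =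
        eta_Hom[OF r(2) x]
      and eq = eta_Hom[OF q(1) rx] and eq1 = eta_Hom[OF q(1) r'x] and eq' = eta_Hom[OF q(2) r'x]
    note Lhx = nat_trans.comp_Hom[OF Lh px] and d' = nat_trans.comp_Hom[OF delta(1)[OF q(2) r(2)] px]
      and d = nat_trans.comp_Hom[OF delta(1)[OF q(1) r(1)] px]
    have dd: "delta q r ?px \<in> Hom D (OMap (LL (cfun_comp C q r)) ?px) (OMap (LL q) (OMap (LL r) ?px))"
      using d px by simp
    have e1': "?e \<in> Hom D (OMap p (OMap q ?rx)) (OMap (LL (cfun_comp C q r)) ?px)"
      using e1 x by simp
    note Lb = nat_trans.comp_Hom[OF L\<beta> px]
    note LqLb = Lq.AMap_Hom[OF Lb] and Lqer = Lq.AMap_Hom[OF er] and Lqer' = Lq.AMap_Hom[OF er'] and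
        Lq'er' = Lq'.AMap_Hom[OF er']
    note La1 = La.comp_Hom[OF Lr'x] and La2 = La.comp_Hom[OF p.OMap_Obj[OF r'x]]
    note pb = p.AMap_Hom[OF b] and pqb = p.AMap_Hom[OF qb] and pa = p.AMap_Hom[OF a]
    have "Comp D (Comp D ?\<delta>' ?Lh) ?e
      = Comp D ?\<delta>' (Comp D ?e' (AMap p (?h x)))"
      using as[OF e1 Lhx d'] Lmap(2)[OF qr qr' h x] by simp
    also have "\<dots> = Comp D (Comp D ?Lq'er' (eta q' ?r'x)) (AMap p (?h x))"
      using as[OF hp e2 d'] delta(2)[OF q(2) r(2) x] by simp
    also have "\<dots> = Comp D (Comp D ?Lq'er' (eta q' ?r'x)) (Comp D ?p\<alpha> ?pq\<beta>)"
      unfolding hx using p.AMap_Comp[OF qb a] by simp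
    finally have lhs: "Comp D (Comp D ?\<delta>' ?Lh) ?e
      = Comp D (Comp D ?Lq'er' (eta q' ?r'x)) (Comp D ?p\<alpha> ?pq\<beta>)" .
    have "Comp D (Comp D (Comp D ?L\<alpha> ?LqL\<beta>) ?\<delta>) ?e
      = Comp D (Comp D ?L\<alpha> ?LqL\<beta>) (Comp D (AMap (LL q) ?er) (eta q ?rx))"
      using as[OF e1' dd Ho[OF LqLb La1]] delta(2)[OF q(1) r(1) x] by simp
    also have "\<dots> = Comp D ?L\<alpha> (Comp D (Comp D ?LqL\<beta> (AMap (LL q) ?er)) (eta q ?rx))"
      using as[OF Ho[OF eq Lqer] LqLb La1] as[OF eq Lqer LqLb] by simp
    also have "\<dots> = Comp D ?L\<alpha> (Comp D (Comp D ?Lqer' (AMap (LL q) (AMap p (\<beta> x)))) (eta q ?rx))"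
      using Lq.AMap_Comp[OF er Lb] Lmap(2)[OF r \<beta> x] Lq.AMap_Comp[OF pb er'] by simp
    also have "\<dots> = Comp D ?L\<alpha> (Comp D ?Lqer' (Comp D (eta q ?r'x) ?pq\<beta>))"
      using as[OF eq Lq.AMap_Hom[OF pb] Lqer'] eta_natural[OF q(1) b] by simp
    also have "\<dots> = Comp D (Comp D ?L\<alpha> ?Lqer') (Comp D (eta q ?r'x) ?pq\<beta>)"
      using as[OF Ho[OF pqb eq1] Lqer' La1] by simp
    also have "\<dots> = Comp D (Comp D ?Lq'er' (Lmap q q' \<alpha> (OMap p ?r'x))) (Comp D (eta q ?r'x) ?pq\<beta>)"
      using La.naturality[OF er'] by simp
    also have "\<dots> = Comp D ?Lq'er' (Comp D (Comp D (Lmap q q' \<alpha> (OMap p ?r'x)) (eta q ?r'x)) ?pq\<beta>)"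
      using as[OF Ho[OF pqb eq1] La2 Lq'er'] as[OF pqb eq1 La2] by simp
    also have "\<dots> = Comp D ?Lq'er' (Comp D (Comp D (eta q' ?r'x) ?p\<alpha>) ?pq\<beta>)"
      using Lmap(2)[OF q \<alpha> r'x] by simp
    also have "\<dots> = Comp D (Comp D ?Lq'er' (eta q' ?r'x)) (Comp D ?p\<alpha> ?pq\<beta>)"
      using as[OF pqb pa eq'] as[OF Ho[OF pqb pa] eq' Lq'er'] by simp
    finally show "Comp D (vcomp D D (delta q' r') (Lmap (cfun_comp C q r) (cfun_comp C q' r') ?h) ?px)
        ?e =
      Comp D (vcomp D D (vcomp D D (whisker_right D (Lmap q q' \<alpha>) (LL r')) (whisker_left D (LL q)
          (Lmap r r' \<beta>))) (delta q r) ?px) ?e"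
      using lhs px by (simp add: vcomp_def[of D D] whisker_right_def[of D] whisker_left_def[of D])
  qed
qed

text \<open>Both sides, after the unit at \<open>x\<close>, are the composite of the three units of
  \<open>q\<close>, \<open>r\<close> and \<open>s\<close>, with those of \<open>r\<close> and
  \<open>s\<close> sent through \<open>LL q\<close>. Strict associativity is what makes the two
  sides parallel.\<close>

lemma delta_coassoc:
  assumes q: "acc q" and r: "acc r" and s: "acc s"
  shows "vcomp D D (vcomp D D (whisker_right D (delta q r) (LL s)) (whisker_left D (LL (cfun_comp C q
      r)) (nt_ident D D (LL s))))
      (delta (cfun_comp C q r) s) =
    vcomp D D (vcomp D D (whisker_right D (nt_ident D D (LL q)) (cfun_comp D (LL r) (LL s)))
        (whisker_left D (LL q) (delta r s)))
      (delta q (cfun_comp C r s))" (is "?l = ?r")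
proof -
  interpret s: is_functor C C s using s by (rule acc_functor)
  interpret r: is_functor C C r using r by (rule acc_functor)
  interpret Lq: is_functor D D "LL q" using q by (rule LL_functor)
  interpret Lr: is_functor D D "LL r" using r by (rule LL_functor)
  interpret Ls: is_functor D D "LL s" using s by (rule LL_functor)
  note qr = accessible_functor_comp[OF q r] and rs = accessible_functor_comp[OF r s]
  interpret Lqr: is_functor D D "LL (cfun_comp C q r)" using qr by (rule LL_functor)
  note qrs = accessible_functor_comp[OF qr s] and qrs' = accessible_functor_comp[OF q rs]
  have qeq: "cfun_comp C (cfun_comp C q r) s = cfun_comp C q (cfun_comp C r s)"
    using cfun_comp_assoc[OF s.is_functor_axioms] .
  have Leq: "cfun_comp D (cfun_comp D (LL q) (LL r)) (LL s) = cfun_comp D (LL q) (cfun_comp D (LL r)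
      (LL s))"
    using cfun_comp_assoc[OF Ls.is_functor_axioms] .
  interpret dqr: nat_trans D D "LL (cfun_comp C q r)" "cfun_comp D (LL q) (LL r)" "delta q r" using
      delta(1)[OF q r] .
  interpret drs: nat_trans D D "LL (cfun_comp C r s)" "cfun_comp D (LL r) (LL s)" "delta r s" using
      delta(1)[OF r s] .
  have l: "nat_trans D D (LL (cfun_comp C q (cfun_comp C r s))) (cfun_comp D (LL q) (cfun_comp D (LL
      r) (LL s))) ?l"
    using nat_trans_vcomp[OF delta(1)[OF qr s] nat_trans_hcomp[OF delta(1)[OF q r] nat_trans_ident[OF
        Ls.is_functor_axioms]]]
    unfolding qeq Leq .
  have r': "nat_trans D D (LL (cfun_comp C q (cfun_comp C r s))) (cfun_comp D (LL q) (cfun_comp D (LL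
      r) (LL s))) ?r"
    using nat_trans_vcomp[OF delta(1)[OF q rs] nat_trans_hcomp[OF nat_trans_ident[OF
        Lq.is_functor_axioms] delta(1)[OF r s]]] .
  note as = p.cod.Comp_assoc and Ho = p.cod.Comp_Hom
  show ?thesis
  proof (rule LL_eqI[OF qrs' l r'])
    fix x assume x: "x \<in> Obj C"
    let ?px = "OMap p x" and ?sx = "OMap s x" and ?qr = "cfun_comp C q r" and ?rs = "cfun_comp C r s"
    let ?rsx = "OMap r ?sx" and ?psx = "OMap p ?sx" and ?Ls = "OMap (LL s) ?px" and ?qrs = "cfun_comp
        C q ?rs"
    let ?e = "eta ?qrs x"
    note px = p.OMap_Obj[OF x] and sx = s.OMap_Obj[OF x]
    note rsx = r.OMap_Obj[OF sx] and psx = p.OMap_Obj[OF sx] and Lsx = Ls.OMap_Obj[OF px]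
    note LrLsx = Lr.OMap_Obj[OF Lsx]
    note es = eta_Hom[OF s x] and er = eta_Hom[OF r sx] and eq = eta_Hom[OF q rsx]
    have erq: "eta ?qr ?sx \<in> Hom D (OMap p (OMap q ?rsx)) (OMap (LL ?qr) ?psx)"
      using eta_Hom[OF qr sx] sx by simp
    have ers: "eta ?rs x \<in> Hom D (OMap p ?rsx) (OMap (LL ?rs) ?px)"
      using eta_Hom[OF rs x] x by simp
    have e: "?e \<in> Hom D (OMap p (OMap q ?rsx)) (OMap (LL ?qrs) ?px)"
      using eta_Hom[OF qrs' x] x by simp
    have d1: "delta ?qr s ?px \<in> Hom D (OMap (LL ?qrs) ?px) (OMap (LL ?qr) ?Ls)"
      using nat_trans.comp_Hom[OF delta(1)[OF qr s] px] px unfolding qeq by simp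
    have d2: "delta q ?rs ?px \<in> Hom D (OMap (LL ?qrs) ?px) (OMap (LL q) (OMap (LL ?rs) ?px))"
      using nat_trans.comp_Hom[OF delta(1)[OF q rs] px] px by simp
    have d3: "delta q r ?Ls \<in> Hom D (OMap (LL ?qr) ?Ls) (OMap (LL q) (OMap (LL r) ?Ls))"
      using dqr.comp_Hom[OF Lsx] Lsx by simp
    have d4: "delta q r ?psx \<in> Hom D (OMap (LL ?qr) ?psx) (OMap (LL q) (OMap (LL r) ?psx))"
      using dqr.comp_Hom[OF psx] psx by simp
    have d5: "delta r s ?px \<in> Hom D (OMap (LL ?rs) ?px) (OMap (LL r) ?Ls)"
      using drs.comp_Hom[OF px] px by simp
    note Lqres = Lqr.AMap_Hom[OF es] and Lres = Lr.AMap_Hom[OF es]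
    note LqLres = Lq.AMap_Hom[OF Lres] and Lqer = Lq.AMap_Hom[OF er] and Lqd5 = Lq.AMap_Hom[OF d5] and
        Lqers = Lq.AMap_Hom[OF ers]
    \<comment> \<open>Naturality at the unit of \<open>s\<close> moves \<open>delta q r\<close> from
      \<open>LL s (p x)\<close> to \<open>p (s x)\<close>, where a unit precedes it and its defining
      equation applies.\<close>
    have dn: "Comp D (delta q r ?Ls) (AMap (LL ?qr) (eta s x)) =
      Comp D (AMap (LL q) (AMap (LL r) (eta s x))) (delta q r ?psx)"
      using dqr.naturality[OF es] p.cod.HomD(1)[OF es] by simp
    have "?l ?px = Comp D (Comp D (delta q r ?Ls) (AMap (LL ?qr) (Ident D ?Ls))) (delta ?qr s ?px)"
      using px by (simp add: vcomp_def[of D D] whisker_right_def[of D] whisker_left_def[of D]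
          nt_ident_def)
    also have "\<dots> = Comp D (delta q r ?Ls) (delta ?qr s ?px)"
      using Lqr.AMap_Ident[OF Lsx] p.cod.Comp_Ident[OF d3] by simp
    finally have "Comp D (?l ?px) ?e =
      Comp D (delta q r ?Ls) (Comp D (delta ?qr s ?px) ?e)"
      using as[OF e d1 d3] by simp
    also have "\<dots> = Comp D (delta q r ?Ls) (Comp D (AMap (LL ?qr) (eta s x)) (eta ?qr ?sx))"
      using delta(2)[OF qr s x] unfolding qeq by simp
    also have "\<dots> = Comp D (AMap (LL q) (AMap (LL r) (eta s x))) (Comp D (delta q r ?psx) (eta ?qr ?sx))"
      using as[OF erq Lqres d3] dn as[OF erq d4 LqLres] by simp
    also have "\<dots> = Comp D (AMap (LL q) (AMap (LL r) (eta s x))) (Comp D (AMap (LL q) (eta r ?sx)) (eta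
        q ?rsx))"
      using delta(2)[OF q r sx] by simp
    also have "\<dots> = Comp D (AMap (LL q) (Comp D (AMap (LL r) (eta s x)) (eta r ?sx))) (eta q ?rsx)"
      using as[OF eq Lqer LqLres] Lq.AMap_Comp[OF er Lres] by simp
    finally have lhs: "Comp D (?l ?px) ?e =
      Comp D (AMap (LL q) (Comp D (AMap (LL r) (eta s x)) (eta r ?sx))) (eta q ?rsx)" .
    have "?r ?px = Comp D (Comp D (Ident D (OMap (LL q) (OMap (LL r) ?Ls))) (AMap (LL q) (delta r s
        ?px))) (delta q ?rs ?px)"
      using px LrLsx by (simp add: vcomp_def[of D D] whisker_right_def[of D] whisker_left_def[of D]
          nt_ident_def)
    also have "\<dots> = Comp D (AMap (LL q) (delta r s ?px)) (delta q ?rs ?px)"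
      using p.cod.Ident_Comp[OF Lqd5] by simp
    finally have "Comp D (?r ?px) ?e =
      Comp D (AMap (LL q) (delta r s ?px)) (Comp D (delta q ?rs ?px) ?e)"
      using as[OF e d2 Lqd5] by simp
    also have "\<dots> = Comp D (AMap (LL q) (delta r s ?px)) (Comp D (AMap (LL q) (eta ?rs x)) (eta q ?rsx))"
      using delta(2)[OF q rs x] x by simp
    also have "\<dots> = Comp D (AMap (LL q) (Comp D (delta r s ?px) (eta ?rs x))) (eta q ?rsx)"
      using as[OF eq Lqers Lqd5] Lq.AMap_Comp[OF ers d5] by simp
    also have "\<dots> = Comp D (AMap (LL q) (Comp D (AMap (LL r) (eta s x)) (eta r ?sx))) (eta q ?rsx)"
      using delta(2)[OF r s x] by simp
    finally show "Comp D (?l ?px) ?e =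
      Comp D (?r ?px) ?e" using lhs by simp
  qed
qed

text \<open>Naturality of \<open>epsilon\<close> at \<open>eta q x\<close> moves it to the object
  \<open>p (q x)\<close>, where it cancels against the unit of the identity functor.\<close>

lemma delta_counit_left:
  assumes q: "acc q"
  shows "vcomp D D (vcomp D D (whisker_right D epsilon (LL q)) (whisker_left D (LL (id_fun C))
      (nt_ident D D (LL q))))
    (delta (id_fun C) q) = nt_ident D D (LL q)" (is "?l = _")
proof -
  interpret q: is_functor C C q using q by (rule acc_functor)
  interpret Lq: is_functor D D "LL q" using q by (rule LL_functor)
  interpret L1: is_functor D D "LL (id_fun C)" using acc_id by (rule LL_functor)
  interpret e: nat_trans D D "LL (id_fun C)" "id_fun D" epsilon by (rule epsilon(1))
  have qeq: "cfun_comp C (id_fun C) q = q" using cfun_comp_id(2)[OF q.is_functor_axioms] .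
  have Leq: "cfun_comp D (id_fun D) (LL q) = LL q" using cfun_comp_id(2)[OF Lq.is_functor_axioms] .
  have l: "nat_trans D D (LL q) (LL q) ?l"
    using nat_trans_vcomp[OF delta(1)[OF acc_id q] nat_trans_hcomp[OF epsilon(1) nat_trans_ident[OF
        Lq.is_functor_axioms]]]
    unfolding qeq Leq .
  note as = p.cod.Comp_assoc
  show ?thesis
  proof (rule LL_eqI[OF q l nat_trans_ident[OF Lq.is_functor_axioms]])
    fix x assume x: "x \<in> Obj C"
    let ?px = "OMap p x" and ?L1 = "LL (id_fun C)" and ?e = "eta q x" and ?qx = "OMap q x"
    let ?Lq = "OMap (LL q) ?px"
    note px = p.OMap_Obj[OF x] and qx = q.OMap_Obj[OF x]
    note Lqx = Lq.OMap_Obj[OF px] and pqx = p.OMap_Obj[OF qx]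
    note eq = eta_Hom[OF q x]
    have e1: "eta (id_fun C) ?qx \<in> Hom D (OMap p ?qx) (OMap ?L1 (OMap p ?qx))"
      using eta_Hom[OF acc_id qx] qx by simp
    have d: "delta (id_fun C) q ?px \<in> Hom D ?Lq (OMap ?L1 ?Lq)"
      using nat_trans.comp_Hom[OF delta(1)[OF acc_id q] px] px unfolding qeq by simp
    have e2: "epsilon ?Lq \<in> Hom D (OMap ?L1 ?Lq) ?Lq"
      using e.comp_Hom[OF Lqx] Lqx by simp
    have e3: "epsilon (OMap p ?qx) \<in> Hom D (OMap ?L1 (OMap p ?qx)) (OMap p ?qx)"
      using e.comp_Hom[OF pqx] pqx by simp
    have "?l ?px = Comp D (Comp D (epsilon ?Lq) (AMap ?L1 (Ident D ?Lq))) (delta (id_fun C) q ?px)"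
      using px by (simp add: vcomp_def[of D D] whisker_right_def[of D] whisker_left_def[of D]
          nt_ident_def[of D])
    also have "\<dots> = Comp D (epsilon ?Lq) (delta (id_fun C) q ?px)"
      using L1.AMap_Ident[OF Lqx] p.cod.Comp_Ident[OF e2] by simp
    finally have "Comp D (?l ?px) ?e = Comp D (epsilon ?Lq) (Comp D (delta (id_fun C) q ?px) ?e)"
      using as[OF eq d e2] by simp
    also have "\<dots> = Comp D (epsilon ?Lq) (Comp D (AMap ?L1 ?e) (eta (id_fun C) ?qx))"
      using delta(2)[OF acc_id q x] unfolding qeq by simp
    also have "\<dots> = Comp D (Comp D ?e (epsilon (OMap p ?qx))) (eta (id_fun C) ?qx)"
      using as[OF e1 L1.AMap_Hom[OF eq] e2] e.naturality[OF eq] p.cod.HomD(1)[OF eq] by simp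
    also have "\<dots> = eta q x"
      using as[OF e1 e3 eq] epsilon(2)[OF qx] p.cod.Comp_Ident[OF eq] by simp
    finally show "Comp D (?l ?px) ?e = Comp D (nt_ident D D (LL q) ?px) ?e"
      using px p.cod.Ident_Comp[OF eq] by (simp add: nt_ident_def[of D])
  qed
qed

text \<open>Here the cancellation of \<open>epsilon\<close> against the unit takes place inside
  \<open>LL q\<close>, at the object \<open>p x\<close>; functoriality of \<open>LL q\<close> brings
  the two together.\<close>

lemma delta_counit_right:
  assumes q: "acc q"
  shows "vcomp D D (vcomp D D (whisker_right D (nt_ident D D (LL q)) (id_fun D)) (whisker_left D (LL
      q) epsilon))
    (delta q (id_fun C)) = nt_ident D D (LL q)" (is "?l = _")
proof -
  interpret q: is_functor C C q using q by (rule acc_functor)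
  interpret Lq: is_functor D D "LL q" using q by (rule LL_functor)
  interpret L1: is_functor D D "LL (id_fun C)" using acc_id by (rule LL_functor)
  interpret e: nat_trans D D "LL (id_fun C)" "id_fun D" epsilon by (rule epsilon(1))
  have qeq: "cfun_comp C q (id_fun C) = q" using cfun_comp_id(1)[OF q.is_functor_axioms] .
  have Leq: "cfun_comp D (LL q) (id_fun D) = LL q" using cfun_comp_id(1)[OF Lq.is_functor_axioms] .
  have l: "nat_trans D D (LL q) (LL q) ?l"
    using nat_trans_vcomp[OF delta(1)[OF q acc_id] nat_trans_hcomp[OF nat_trans_ident[OF
        Lq.is_functor_axioms] epsilon(1)]]
    unfolding qeq Leq .
  note as = p.cod.Comp_assoc
  show ?thesis
  proof (rule LL_eqI[OF q l nat_trans_ident[OF Lq.is_functor_axioms]])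
    fix x assume x: "x \<in> Obj C"
    let ?px = "OMap p x" and ?L1 = "LL (id_fun C)" and ?e = "eta q x"
    let ?Lq = "OMap (LL q) ?px"
    note px = p.OMap_Obj[OF x]
    note eq = eta_Hom[OF q x]
    have e1: "eta (id_fun C) x \<in> Hom D ?px (OMap ?L1 ?px)"
      using eta_Hom[OF acc_id x] x by simp
    have e2: "epsilon ?px \<in> Hom D (OMap ?L1 ?px) ?px"
      using e.comp_Hom[OF px] px by simp
    have d: "delta q (id_fun C) ?px \<in> Hom D ?Lq (OMap (LL q) (OMap ?L1 ?px))"
      using nat_trans.comp_Hom[OF delta(1)[OF q acc_id] px] px unfolding qeq by simp
    note Le1 = Lq.AMap_Hom[OF e1] and Le2 = Lq.AMap_Hom[OF e2]
    have "?l ?px = Comp D (Comp D (Ident D ?Lq) (AMap (LL q) (epsilon ?px))) (delta q (id_fun C) ?px)"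
      using px by (simp add: vcomp_def[of D D] whisker_right_def[of D] whisker_left_def[of D]
          nt_ident_def[of D])
    also have "\<dots> = Comp D (AMap (LL q) (epsilon ?px)) (delta q (id_fun C) ?px)"
      using p.cod.Ident_Comp[OF Le2] by simp
    finally have "Comp D (?l ?px) ?e = Comp D (AMap (LL q) (epsilon ?px)) (Comp D (delta q (id_fun C)
        ?px) ?e)"
      using as[OF eq d Le2] by simp
    also have "\<dots> = Comp D (AMap (LL q) (epsilon ?px)) (Comp D (AMap (LL q) (eta (id_fun C) x)) ?e)"
      using delta(2)[OF q acc_id x] x unfolding qeq by simp
    also have "\<dots> = Comp D (AMap (LL q) (Ident D ?px)) ?e"
      using as[OF eq Le1 Le2] Lq.AMap_Comp[OF e1 e2] epsilon(2)[OF x] by simp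
    finally show "Comp D (?l ?px) ?e = Comp D (nt_ident D D (LL q) ?px) ?e"
      using px Lq.AMap_Ident[OF px] by (simp add: nt_ident_def[of D])
  qed
qed

lemma colax_monoidal_lan_post:
  "colax_monoidal_functor (End_cat U C) (End_cat U D) (lan_post_fun U C D p)
    (lan_counit C D p) (lan_comult C D p)"
  (is "colax_monoidal_functor ?M ?N ?F ?\<epsilon> ?\<delta>")
proof -
  interpret M: strict_monoidal_category ?M using accC by (rule strict_monoidal_End_cat)
  interpret N: strict_monoidal_category ?N using accD by (rule strict_monoidal_End_cat)
  interpret F: is_functor ?M ?N ?F by (rule is_functor_lan_post)
  note simps = lan_counit_eq lan_comult_eq lan_post_fun_simps accessible_functor_comp acc_id
  show ?thesis
  proof
    show "?\<epsilon> \<in> Hom ?N (OMap ?F (Unit ?M)) (Unit ?N)"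
      using Hom_End_catI[OF LL_accessible[OF acc_id] accessible_functor_id[OF accD] epsilon(1)] by
          (simp add: simps)
    show "?\<delta> q r \<in> Hom ?N (OMap ?F (TensO ?M q r))
        (TensO ?N (OMap ?F q) (OMap ?F r))"
      if q: "q \<in> Obj ?M" and r: "r \<in> Obj ?M" for q r
    proof -
      have a: "acc q" "acc r" using q r by simp_all
      show ?thesis
        using Hom_End_catI[OF LL_accessible[OF accessible_functor_comp[OF a]]
          accessible_functor_comp[OF LL_accessible[OF a(1)] LL_accessible[OF a(2)]] delta(1)[OF a]] a
        by (simp add: simps)
    qed
    show "Comp ?N (?\<delta> q' r') (AMap ?F (TensA ?M f g)) =
        Comp ?N (TensA ?N (AMap ?F f) (AMap ?F g)) (?\<delta> q r)"
      if f: "f \<in> Hom ?M q q'" and g: "g \<in> Hom ?M r r'" for f g q q' r r'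
    proof -
      obtain \<alpha> where a: "f = (q, q', \<alpha>)" "acc q" "acc q'" "nat_trans C C q q' \<alpha>" by (rule
          Hom_End_catE[OF f])
      obtain \<beta> where b: "g = (r, r', \<beta>)" "acc r" "acc r'" "nat_trans C C r r' \<beta>" by (rule
          Hom_End_catE[OF g])
      show ?thesis
        using delta_natural[OF a(2,3) b(2,3) a(4) b(4)] nat_trans_hcomp[OF a(4) b(4)] a b by (simp
            add: simps)
    qed
    show "Comp ?N (TensA ?N (?\<delta> q r) (Ident ?N (OMap ?F s)))
        (?\<delta> (TensO ?M q r) s) =
      Comp ?N (TensA ?N (Ident ?N (OMap ?F q)) (?\<delta> r s))
        (?\<delta> q (TensO ?M r s))"
      if q: "q \<in> Obj ?M" and r: "r \<in> Obj ?M" and s: "s \<in> Obj ?M" for q r s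
    proof -
      have a: "acc q" "acc r" "acc s" using q r s by simp_all
      show ?thesis
        using delta_coassoc[OF a] a cfun_comp_assoc[OF acc_functor[OF a(3)], of q r]
          cfun_comp_assoc[OF LL_functor[OF a(3)], of "LL q" "LL r"] by (simp add: simps)
    qed
    show "Comp ?N (TensA ?N ?\<epsilon> (Ident ?N (OMap ?F q)))
        (?\<delta> (Unit ?M) q) = Ident ?N (OMap ?F q)"
      if q: "q \<in> Obj ?M" for q
    proof -
      have a: "acc q" using q by simp
      show ?thesis
        using delta_counit_left[OF a] a cfun_comp_id(2)[OF acc_functor[OF a]] cfun_comp_id(2)[OF
            LL_functor[OF a]]
        by (simp add: simps)
    qed
    show "Comp ?N (TensA ?N (Ident ?N (OMap ?F q)) ?\<epsilon>)
        (?\<delta> q (Unit ?M)) = Ident ?N (OMap ?F q)"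
      if q: "q \<in> Obj ?M" for q
    proof -
      have a: "acc q" using q by simp
      show ?thesis
        using delta_counit_right[OF a] a cfun_comp_id(1)[OF acc_functor[OF a]] cfun_comp_id(1)[OF
            LL_functor[OF a]]
        by (simp add: simps)
    qed
  qed
qed

end

theorem theorem4p1:
  fixes U :: "'u set"
    and C :: "('o1, 'm1) cat"
    and D :: "('o2, 'm2) cat"
    and p :: "('o1, 'm1, 'o2, 'm2) cfun"
  assumes "inaccessible U"
    and "accessible U C"
    and "accessible U D"
    and "cocomplete U D"
    and "accessible_functor U C D p"
  shows "(\<forall>q \<in> Obj (End_cat U C).
      left_kan_extension C D D p (cfun_comp C p q)
        (Lan C D D p (cfun_comp C p q)) (lan_unit C D D p (cfun_comp C p q))) \<and>
    colax_monoidal_functor (End_cat U C) (End_cat U D) (lan_post_fun U C D p)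
      (lan_counit C D p) (lan_comult C D p)"
proof -
  interpret lan_post_setting U C D p
    using assms by unfold_locales
  show ?thesis
    using lke colax_monoidal_lan_post by (simp add: lan_post_def)
qed

end
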